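(* For every integer $k\ge 2$ there are infinitely many integers $m\ge 1$ such that, taking alphabets $X_1,\dots,X_k$ all of size $m$ (so that the alphabets $Y_i = X_i\sqcup\overline{X}_i$ all have size $2m$), the groups $\mathscr{G}(C_u)$ and $\mathscr{G}(C_m)$ associated with the two $k$-graphs $C_u$ (uniform labelling) and $C_m$ (mixed labelling) are not isomorphic.
   Context: Categories and higher rank graphs. $\mathbb{N}=\{0,1,2,\dots\}$. A category $C$ is regarded as a set of arrows with set of identities $C_o\subseteq C$; each arrow $a$ has domain $\mathbf{d}(a)\in C_o$ and codomain $\mathbf{r}(a)\in C_o$, and $ab$ is defined exactly when $\mathbf{d}(a)=\mathbf{r}(b)$. Put $XC=\{xc: x\in X, c\in C, xc\text{ defined}\}$. A $k$-graph is a countable category $C$ with a functor $d\colon C\to\mathbb{N}^k$ (the degree) such that whenever $d(a)=\mathbf{m}+\mathbf{n}$ there are unique $a_1,a_2$ with $a=a_1a_2$, $d(a_1)=\mathbf{m}$, $d(a_2)=\mathbf{n}$. The $k$-graphs $C_u$, $C_m$. Let $X_1,\dots,X_k$ be pairwise disjoint finite alphabets, $X=\bigcup_i X_i$, and let $\ell\colon X\to\mathbb{Z}_2=\mathbb{Z}/2$ be a labelling. Let $\overline{X}_i=\{\overline{x}:x\in X_i\}$ be a disjoint copy of $X_i$. Let $E_\ell$ be the directed graph with vertex set $\{(v,0),(v,1)\}$ (identified with $\mathbb{Z}_2$) and, for each $1\le i\le k$, edges of colour $i$: $(x,j)$ and $(\overline{x},j)$ for $x\in X_i$, $j\in\mathbb{Z}_2$,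 where $\mathbf{r}(x,j)=j$, $\mathbf{d}(x,j)=j+\ell(x)$, $\mathbf{r}(\overline{x},j)=j+\ell(x)$, $\mathbf{d}(\overline{x},j)=j$. The $k$-graph $C_\ell$ is the quotient of the free category (paths) on $E_\ell$ by the congruence generated by the following relations, for all $i\ne i'$, $a\in X_i$, $b\in X_{i'}$, $t\in\mathbb{Z}_2$: $(a,t)(b,t+\ell(a))=(b,t)(a,t+\ell(b))$, $(a,t+\ell(b))(\overline{b},t+\ell(a))=(\overline{b},t)(a,t)$, $(\overline{a},t)(b,t)=(b,t+\ell(a))(\overline{a},t+\ell(b))$, $(\overline{b},t+\ell(a))(\overline{a},t)=(\overline{a},t+\ell(b))(\overline{b},t)$; the degree of a path has $i$th coordinate the number of its edges of colour $i$. (Geometrically, the $2$-coloured squares are those of the double cover, determined by $\ell$, of the product of $k$ wedges of circles labelled by $X_1,\dots,X_k$, each square giving one relation for each ordered pair of opposite corners.) $C_u=C_{\ell_u}$ with $\ell_u\equiv 1$ on $X$, and $C_m=C_{\ell_m}$ with $\ell_m\equiv0$ on $X_1$ and $\ell_m\equiv1$ on $X\setminus X_1$. These $k$-graphs have two identities, no sources, and only finitely many elements of each degree. The group $\mathscr{G}(C)$. A right ideal of $C$ is a (possibly empty) subset $R$ with $RC\subseteq R$; it is finitely generated if $R=XC$ with $X$ finite. A bijective morphism $\theta\colon R_1\to R_2$ of right ideals is a bijection with $\mathbf{d}(\theta(r))=\mathbf{d}(r)$ and $\theta(rc)=\theta(r)c$ whenever $rc$ is defined. $\mathsf{R}(C)$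 is the inverse monoid of bijective morphisms between finitely generated right ideals under composition of partial bijections (zero: the empty function). In an inverse semigroup $S$ with zero, $a\le b$ means $a=ba^{-1}a$; a non-zero idempotent $e$ is essential if $ef\ne0$ for all non-zero idempotents $f$; $S^e$ is the inverse subsemigroup of $s\in S$ with $s^{-1}s$, $ss^{-1}$ essential; $s\,\sigma\,t$ iff some $z$ satisfies $z\le s,t$. Then $\mathscr{G}(C)=\mathsf{R}(C)^e/\sigma$. *)

theory Defs
  imports "HOL-Algebra.Group" "HOL-Library.Z2" "HOL-Library.Disjoint_Sets"
    "HOL-Library.Countable_Set"
begin

section \<open>Categories and higher rank graphs\<close>

text \<open>
  A category is regarded as a set of arrows containing its identities, so the domain and
  codomain of an arrow are again arrows. The value of \<open>acomp C a b\<close> is only meaningful if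
  \<open>adom C a = acod C b\<close>.
\<close>

record 'a category =
  arrows :: "'a set"
  adom :: "'a \<Rightarrow> 'a"
  acod :: "'a \<Rightarrow> 'a"
  acomp :: "'a \<Rightarrow> 'a \<Rightarrow> 'a"

definition identities :: "('a, 'z) category_scheme \<Rightarrow> 'a set" where
  "identities C = adom C ` arrows C"

locale category =
  fixes C :: "('a, 'z) category_scheme"
  assumes dom_closed: "a \<in> arrows C \<Longrightarrow> adom C a \<in> arrows C"
    and cod_closed: "a \<in> arrows C \<Longrightarrow> acod C a \<in> arrows C"
    and dom_dom: "a \<in> arrows C \<Longrightarrow> adom C (adom C a) = adom C a"
    and cod_dom: "a \<in> arrows C \<Longrightarrow> acod C (adom C a) = adom C a"
    and dom_cod: "a \<in> arrows C \<Longrightarrow> adom C (acod C a) = acod C a"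
    and cod_cod: "a \<in> arrows C \<Longrightarrow> acod C (acod C a) = acod C a"
    and comp_closed: "\<lbrakk>a \<in> arrows C; b \<in> arrows C; adom C a = acod C b\<rbrakk>
      \<Longrightarrow> acomp C a b \<in> arrows C"
    and dom_comp: "\<lbrakk>a \<in> arrows C; b \<in> arrows C; adom C a = acod C b\<rbrakk>
      \<Longrightarrow> adom C (acomp C a b) = adom C b"
    and cod_comp: "\<lbrakk>a \<in> arrows C; b \<in> arrows C; adom C a = acod C b\<rbrakk>
      \<Longrightarrow> acod C (acomp C a b) = acod C a"
    and comp_assoc: "\<lbrakk>a \<in> arrows C; b \<in> arrows C; c \<in> arrows C; adom C a = acod C b;
      adom C b = acod C c\<rbrakk> \<Longrightarrow> acomp C (acomp C a b) c = acomp C a (acomp C b c)"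
    and comp_dom: "a \<in> arrows C \<Longrightarrow> acomp C a (adom C a) = a"
    and cod_comp_self: "a \<in> arrows C \<Longrightarrow> acomp C (acod C a) a = a"

text \<open>
  Elements of \<open>\<nat>\<^sup>k\<close> are the functions on \<open>nat\<close> vanishing outside \<open>{1..k}\<close>. The degree is part of
  the structure of a \<open>k\<close>-graph, but the group defined below only depends on the underlying
  category.
\<close>

record 'a graded_category = "'a category" +
  degree :: "'a \<Rightarrow> nat \<Rightarrow> nat"

definition nat_vecs :: "nat \<Rightarrow> (nat \<Rightarrow> nat) set" where
  "nat_vecs k = {n. \<forall>i. i \<notin> {1..k} \<longrightarrow> n i = 0}"

locale k_graph = category C for C :: "('a, 'z) graded_category_scheme" (structure) +
  fixes k :: nat
  assumes countable_arrows: "countable (arrows C)"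
    and degree_closed: "a \<in> arrows C \<Longrightarrow> degree C a \<in> nat_vecs k"
    and degree_identity: "e \<in> identities C \<Longrightarrow> degree C e = (\<lambda>i. 0)"
    and degree_comp: "\<lbrakk>a \<in> arrows C; b \<in> arrows C; adom C a = acod C b\<rbrakk>
      \<Longrightarrow> degree C (acomp C a b) = (\<lambda>i. degree C a i + degree C b i)"
    and unique_factorization:
      "\<lbrakk>a \<in> arrows C; m \<in> nat_vecs k; n \<in> nat_vecs k; degree C a = (\<lambda>i. m i + n i)\<rbrakk>
      \<Longrightarrow> \<exists>!(b, c). b \<in> arrows C \<and> c \<in> arrows C \<and> adom C b = acod C c \<and>
            a = acomp C b c \<and> degree C b = m \<and> degree C c = n"


section \<open>Path categories modulo relations\<close>

record ('v, 'e) digraph =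
  verts :: "'v set"
  edges :: "'e set"
  esrc :: "'e \<Rightarrow> 'v"
  erng :: "'e \<Rightarrow> 'v"

text \<open>
  A path \<open>(v, [e\<^sub>1, \<dots>, e\<^sub>n])\<close> has codomain \<open>v\<close>, the range of \<open>e\<^sub>1\<close>, and the
  source of each edge is the range of the next one, as for products in a category.
\<close>

type_synonym ('v, 'e) path = "'v \<times> 'e list"

fun is_path :: "('v, 'e) digraph \<Rightarrow> ('v, 'e) path \<Rightarrow> bool" where
  "is_path E (v, []) \<longleftrightarrow> v \<in> verts E"
| "is_path E (v, e # es) \<longleftrightarrow> v \<in> verts E \<and> e \<in> edges E \<and> erng E e = v \<and> is_path E (esrc E e, es)"

fun path_dom :: "('v, 'e) digraph \<Rightarrow> ('v, 'e) path \<Rightarrow> 'v" where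
  "path_dom E (v, []) = v"
| "path_dom E (v, e # es) = path_dom E (esrc E e, es)"

definition path_cod :: "('v, 'e) path \<Rightarrow> 'v" where
  "path_cod p = fst p"

definition path_comp :: "('v, 'e) path \<Rightarrow> ('v, 'e) path \<Rightarrow> ('v, 'e) path" where
  "path_comp p q = (fst p, snd p @ snd q)"

inductive_set path_cong ::
  "('v, 'e) digraph \<Rightarrow> (('v, 'e) path \<times> ('v, 'e) path) set \<Rightarrow> (('v, 'e) path \<times> ('v, 'e) path) set"
  for E rels where
  base: "(p, q) \<in> rels \<Longrightarrow> (p, q) \<in> path_cong E rels"
| refl: "is_path E p \<Longrightarrow> (p, p) \<in> path_cong E rels"
| sym: "(p, q) \<in> path_cong E rels \<Longrightarrow> (q, p) \<in> path_cong E rels"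
| trans: "\<lbrakk>(p, q) \<in> path_cong E rels; (q, r) \<in> path_cong E rels\<rbrakk> \<Longrightarrow> (p, r) \<in> path_cong E rels"
| comp: "\<lbrakk>(p, p') \<in> path_cong E rels; (q, q') \<in> path_cong E rels; path_dom E p = path_cod q\<rbrakk>
    \<Longrightarrow> (path_comp p q, path_comp p' q') \<in> path_cong E rels"

text \<open>
  The quotient of the free category on \<open>E\<close> by the congruence generated by \<open>rels\<close>, a set of
  pairs of parallel paths. Domain, codomain and product of classes are those of arbitrary
  (composable) representatives.
\<close>

definition path_quotient ::
  "('v, 'e) digraph \<Rightarrow> (('v, 'e) path \<times> ('v, 'e) path) set \<Rightarrow> ('v, 'e) path set category" where
  "path_quotient E rels = \<lparr>
     arrows = {p. is_path E p} // path_cong E rels,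
     adom = (\<lambda>A. path_cong E rels `` {(path_dom E p, []) | p. p \<in> A}),
     acod = (\<lambda>A. path_cong E rels `` {(path_cod p, []) | p. p \<in> A}),
     acomp = (\<lambda>A B. path_cong E rels ``
        {path_comp p q | p q. p \<in> A \<and> q \<in> B \<and> path_dom E p = path_cod q}) \<rparr>"


section \<open>The higher rank graphs of a labelling\<close>

text \<open>
  The alphabets \<open>X\<^sub>1, \<dots>, X\<^sub>k\<close> are given by \<open>X :: nat \<Rightarrow> 'x set\<close>; the values of \<open>X\<close> outside
  \<open>{1..k}\<close> are ignored. The type \<open>bit\<close> is the field \<open>\<int>/2\<close>, which also is the vertex set.
\<close>

definition alphabets :: "nat \<Rightarrow> nat \<Rightarrow> (nat \<Rightarrow> 'x set) \<Rightarrow> bool" where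
  "alphabets k m X \<longleftrightarrow> (\<forall>i\<in>{1..k}. finite (X i) \<and> card (X i) = m) \<and> disjoint_family_on X {1..k}"

datatype 'x letter = Pos 'x | Bar 'x

fun base_letter :: "'x letter \<Rightarrow> 'x" where
  "base_letter (Pos x) = x"
| "base_letter (Bar x) = x"

type_synonym 'x edge = "'x letter \<times> bit"

fun edge_rng :: "('x \<Rightarrow> bit) \<Rightarrow> 'x edge \<Rightarrow> bit" where
  "edge_rng l (Pos x, j) = j"
| "edge_rng l (Bar x, j) = j + l x"

fun edge_src :: "('x \<Rightarrow> bit) \<Rightarrow> 'x edge \<Rightarrow> bit" where
  "edge_src l (Pos x, j) = j + l x"
| "edge_src l (Bar x, j) = j"

definition label_graph :: "nat \<Rightarrow> (nat \<Rightarrow> 'x set) \<Rightarrow> ('x \<Rightarrow> bit) \<Rightarrow> (bit, 'x edge) digraph" where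
  "label_graph k X l = \<lparr>
     verts = UNIV,
     edges = {(y, j). base_letter y \<in> (\<Union>i\<in>{1..k}. X i)},
     esrc = edge_src l,
     erng = edge_rng l \<rparr>"

definition two_path :: "('x \<Rightarrow> bit) \<Rightarrow> 'x edge \<Rightarrow> 'x edge \<Rightarrow> (bit, 'x edge) path" where
  "two_path l e f = (edge_rng l e, [e, f])"

inductive_set square_rels ::
  "nat \<Rightarrow> (nat \<Rightarrow> 'x set) \<Rightarrow> ('x \<Rightarrow> bit) \<Rightarrow> ((bit, 'x edge) path \<times> (bit, 'x edge) path) set"
  for k X l where
  "\<lbrakk>i \<in> {1..k}; i' \<in> {1..k}; i \<noteq> i'; a \<in> X i; b \<in> X i'\<rbrakk> \<Longrightarrow>
    (two_path l (Pos a, t) (Pos b, t + l a), two_path l (Pos b, t) (Pos a, t + l b))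
      \<in> square_rels k X l"
| "\<lbrakk>i \<in> {1..k}; i' \<in> {1..k}; i \<noteq> i'; a \<in> X i; b \<in> X i'\<rbrakk> \<Longrightarrow>
    (two_path l (Pos a, t + l b) (Bar b, t + l a), two_path l (Bar b, t) (Pos a, t))
      \<in> square_rels k X l"
| "\<lbrakk>i \<in> {1..k}; i' \<in> {1..k}; i \<noteq> i'; a \<in> X i; b \<in> X i'\<rbrakk> \<Longrightarrow>
    (two_path l (Bar a, t) (Pos b, t), two_path l (Pos b, t + l a) (Bar a, t + l b))
      \<in> square_rels k X l"
| "\<lbrakk>i \<in> {1..k}; i' \<in> {1..k}; i \<noteq> i'; a \<in> X i; b \<in> X i'\<rbrakk> \<Longrightarrow>
    (two_path l (Bar b, t + l a) (Bar a, t), two_path l (Bar a, t + l b) (Bar b, t))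
      \<in> square_rels k X l"

definition path_degree :: "nat \<Rightarrow> (nat \<Rightarrow> 'x set) \<Rightarrow> (bit, 'x edge) path \<Rightarrow> nat \<Rightarrow> nat" where
  "path_degree k X p =
    (\<lambda>i. if i \<in> {1..k} then length (filter (\<lambda>e. base_letter (fst e) \<in> X i) (snd p)) else 0)"

definition C_label ::
  "nat \<Rightarrow> (nat \<Rightarrow> 'x set) \<Rightarrow> ('x \<Rightarrow> bit) \<Rightarrow> (bit, 'x edge) path set graded_category" where
  "C_label k X l = category.extend (path_quotient (label_graph k X l) (square_rels k X l))
     \<lparr> degree = (\<lambda>A. THE n. \<exists>p\<in>A. n = path_degree k X p) \<rparr>"

definition C_u :: "nat \<Rightarrow> (nat \<Rightarrow> 'x set) \<Rightarrow> (bit, 'x edge) path set graded_category" where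
  "C_u k X = C_label k X (\<lambda>x. 1)"

definition C_m :: "nat \<Rightarrow> (nat \<Rightarrow> 'x set) \<Rightarrow> (bit, 'x edge) path set graded_category" where
  "C_m k X = C_label k X (\<lambda>x. if x \<in> X 1 then 0 else 1)"


section \<open>Inverse semigroups with zero\<close>

record 'a zero_monoid = "'a monoid" +
  zero_elt :: 'a

definition sinv :: "('a, 'z) monoid_scheme \<Rightarrow> 'a \<Rightarrow> 'a" where
  "sinv S a = (THE b. b \<in> carrier S \<and> a \<otimes>\<^bsub>S\<^esub> b \<otimes>\<^bsub>S\<^esub> a = a \<and> b \<otimes>\<^bsub>S\<^esub> a \<otimes>\<^bsub>S\<^esub> b = b)"

definition nat_le :: "('a, 'z) monoid_scheme \<Rightarrow> 'a \<Rightarrow> 'a \<Rightarrow> bool" where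
  "nat_le S a b \<longleftrightarrow> a = b \<otimes>\<^bsub>S\<^esub> sinv S a \<otimes>\<^bsub>S\<^esub> a"

definition idempotents :: "('a, 'z) monoid_scheme \<Rightarrow> 'a set" where
  "idempotents S = {e \<in> carrier S. e \<otimes>\<^bsub>S\<^esub> e = e}"

definition essential :: "('a, 'z) zero_monoid_scheme \<Rightarrow> 'a \<Rightarrow> bool" where
  "essential S e \<longleftrightarrow> e \<in> idempotents S \<and> e \<noteq> zero_elt S \<and>
     (\<forall>f \<in> idempotents S. f \<noteq> zero_elt S \<longrightarrow> e \<otimes>\<^bsub>S\<^esub> f \<noteq> zero_elt S)"

definition essential_part :: "('a, 'z) zero_monoid_scheme \<Rightarrow> 'a monoid" where
  "essential_part S = \<lparr>
     carrier = {s \<in> carrier S. essential S (sinv S s \<otimes>\<^bsub>S\<^esub> s) \<and> essential S (s \<otimes>\<^bsub>S\<^esub> sinv S s)},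
     mult = mult S,
     one = one S \<rparr>"

text \<open>
  The common lower bound \<open>z\<close> ranges over \<open>T\<close> itself. For \<open>T = essential_part S\<close> this matters:
  the zero of \<open>S\<close> lies below everything but is not in \<open>T\<close>.
\<close>

definition sigma :: "('a, 'z) monoid_scheme \<Rightarrow> ('a \<times> 'a) set" where
  "sigma T = {(s, t). s \<in> carrier T \<and> t \<in> carrier T \<and>
     (\<exists>z \<in> carrier T. nat_le T z s \<and> nat_le T z t)}"

definition sigma_quotient :: "('a, 'z) monoid_scheme \<Rightarrow> 'a set monoid" where
  "sigma_quotient T = \<lparr>
     carrier = carrier T // sigma T,
     mult = (\<lambda>A B. sigma T `` {a \<otimes>\<^bsub>T\<^esub> b | a b. a \<in> A \<and> b \<in> B}),
     one = sigma T `` {\<one>\<^bsub>T\<^esub>} \<rparr>"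


section \<open>The group of a category\<close>

definition set_comp :: "('a, 'z) category_scheme \<Rightarrow> 'a set \<Rightarrow> 'a set \<Rightarrow> 'a set" where
  "set_comp C X Y = {acomp C x y | x y. x \<in> X \<and> y \<in> Y \<and> adom C x = acod C y}"

definition right_ideal :: "('a, 'z) category_scheme \<Rightarrow> 'a set \<Rightarrow> bool" where
  "right_ideal C R \<longleftrightarrow> R \<subseteq> arrows C \<and> set_comp C R (arrows C) \<subseteq> R"

definition fg_right_ideal :: "('a, 'z) category_scheme \<Rightarrow> 'a set \<Rightarrow> bool" where
  "fg_right_ideal C R \<longleftrightarrow> right_ideal C R \<and>
     (\<exists>X. finite X \<and> X \<subseteq> arrows C \<and> R = set_comp C X (arrows C))"

text \<open>A bijection \<open>R\<^sub>1 \<rightarrow> R\<^sub>2\<close> is represented as a partial function with domain \<open>R\<^sub>1\<close>.\<close>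

definition bij_morphism :: "('a, 'z) category_scheme \<Rightarrow> 'a set \<Rightarrow> 'a set \<Rightarrow> ('a \<rightharpoonup> 'a) \<Rightarrow> bool" where
  "bij_morphism C R1 R2 \<theta> \<longleftrightarrow> dom \<theta> = R1 \<and> ran \<theta> = R2 \<and> inj_on \<theta> R1 \<and>
     (\<forall>r \<in> R1. adom C (the (\<theta> r)) = adom C r) \<and>
     (\<forall>r \<in> R1. \<forall>c \<in> arrows C. adom C r = acod C c \<longrightarrow>
        \<theta> (acomp C r c) = Some (acomp C (the (\<theta> r)) c))"

definition R_monoid :: "('a, 'z) category_scheme \<Rightarrow> ('a \<rightharpoonup> 'a) zero_monoid" where
  "R_monoid C = \<lparr>
     carrier = {\<theta>. \<exists>R1 R2. fg_right_ideal C R1 \<and> fg_right_ideal C R2 \<and> bij_morphism C R1 R2 \<theta>},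
     mult = (\<circ>\<^sub>m),
     one = (\<lambda>a. if a \<in> arrows C then Some a else None),
     zero_elt = Map.empty \<rparr>"

definition G_group :: "('a, 'z) category_scheme \<Rightarrow> ('a \<rightharpoonup> 'a) set monoid" where
  "G_group C = sigma_quotient (essential_part (R_monoid C))"

end

theory Submission
  imports "HOL-Number_Theory.Cong" "HOL-Library.Stream" Defs
begin

text \<open>
  Let \<open>n = 2m\<close> be the number of letters of each colour. The defining squares say that letters of
  different colours commute, whatever the labels are. So an arrow of \<open>C\<^sub>\<ell>\<close> is a vertex \<open>j\<close>, its
  codomain, together with one word in the \<open>n\<close> letters of colour \<open>i\<close> for every \<open>i\<close>, and its domain is
  \<open>j\<close> plus the sum of all labels (\<open>square_cong_iff\<close>, \<open>adom_C\<close>, \<open>acomp_C\<close>). Arrows act by prefixing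
  on the boundary, the set of points \<open>(j, \<omega>)\<close> where \<open>\<omega>\<close> is a \<open>k\<close>-tuple of infinite words. An element
  of \<open>\<G>(C\<^sub>\<ell>)\<close> becomes a bijection of the boundary that locally replaces a prefix by another one with
  the same domain, and this identifies \<open>\<G>(C\<^sub>\<ell>)\<close> with the group \<open>H\<close> of all such bijections
  (\<open>germ_class_iso\<close>).

  The two groups are told apart by their numbers of conjugacy classes of involutions. The guiding
  invariant is the class of a clopen set in the zeroth homology of the boundary groupoid. It is
  generated by the classes \<open>e\<^sub>0\<close>, \<open>e\<^sub>1\<close> of a cylinder with domain \<open>0\<close> and \<open>1\<close>. Splitting a cylinder by
  its next letter of one colour gives \<open>e\<^sub>0 = n e\<^sub>1\<close> and \<open>e\<^sub>1 = n e\<^sub>0\<close> if that colour has label \<open>1\<close>, and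
  \<open>e\<^sub>j = n e\<^sub>j\<close> if it has label \<open>0\<close>. So the homology is cyclic of order \<open>n\<^sup>2 - 1\<close> for \<open>C\<^sub>u\<close>, but cyclic
  of order \<open>n - 1\<close> for \<open>C\<^sub>m\<close>.

  In the uniform case the class of the set of points that an involution moves is a conjugacy
  invariant. For each \<open>p\<close> with \<open>1 \<le> p \<le> n\<^sup>2 - 1\<close> there is an involution that exchanges \<open>p\<close> pairs of
  cylinders of class \<open>e\<^sub>0\<close>, hence with invariant \<open>2p\<close>. As \<open>n\<^sup>2 - 1\<close> is odd, no two of these are
  conjugate (\<open>nonconjugate_involutions\<close>).

  In the mixed case the set moved by an involution \<open>s \<noteq> id\<close> splits into two clopen halves
  exchanged by \<open>s\<close> (\<open>involution_halves\<close>), and every nonempty clopen set is a disjoint union of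
  cylinders with domain \<open>0\<close>, whose number may be increased by multiples of \<open>n - 1\<close>. Suppose
  that these numbers agree modulo \<open>n - 1\<close> for one half of the moved sets of \<open>s\<close> and \<open>t\<close>, and that
  their sets of fixed points are both empty or have numbers that agree as well. Then matching
  cylinders gives an element of \<open>H\<close> that conjugates \<open>s\<close> to \<open>t\<close> (\<open>same_code_conjugate\<close>). So there
  are at most \<open>(n - 1) n\<close> classes, while there are at least \<open>n\<^sup>2 - 1 = (n - 1)(n + 1)\<close> in the uniform
  case. The groups are therefore not isomorphic for
  any \<open>m \<ge> 1\<close>.
\<close>

section \<open>Arrows as tuples of words\<close>

text \<open>
  The simplifier would otherwise turn sums of vertices into exclusive disjunctions.
\<close>

declare add_bit_eq_xor [simp del]

lemma bit_cancel [simp]: "(a::bit) + (b + b) = a" "(a::bit) + b + b = a" "(a::bit) + (a + b) = b" "(a::bit) + a = 0"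
  by (cases a; cases b; simp add: add_bit_eq_xor)+

type_synonym 'x word = "nat \<Rightarrow> 'x letter list"
type_synonym 'x wordarrow = "bit \<times> 'x word"
type_synonym 'x point = "bit \<times> (nat \<Rightarrow> 'x letter stream)"

locale labelled_alphabets =
  fixes k m :: nat and X :: "nat \<Rightarrow> 'x set" and l :: "'x \<Rightarrow> bit"
  assumes alphabets: "alphabets k m X" and m_pos: "m \<ge> 1"
begin

text \<open>
  The alphabet of colour \<open>i\<close>. It is empty for \<open>i\<close> outside \<open>{1..k}\<close>, so that the words over it need no
  separate condition there.
\<close>

definition Y :: "nat \<Rightarrow> 'x letter set" where
  "Y i = {y. i \<in> {1..k} \<and> base_letter y \<in> X i}"

definition words :: "'x word set" where
  "words = {w. \<forall>i. set (w i) \<subseteq> Y i}"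

definition letter_sum :: "'x letter list \<Rightarrow> bit" where
  "letter_sum ys = (\<Sum>y\<leftarrow>ys. l (base_letter y))"

definition label_sum :: "'x word \<Rightarrow> bit" where
  "label_sum w = (\<Sum>i\<in>{1..k}. letter_sum (w i))"

definition word_cat :: "'x word \<Rightarrow> 'x word \<Rightarrow> 'x word"
    (infixr \<open>\<cdot>\<close> 70) where
  "v \<cdot> w = (\<lambda>i. v i @ w i)"

definition empty_word :: "'x word" where
  "empty_word = (\<lambda>i. [])"

definition split_colours :: "'x letter list \<Rightarrow> 'x word" where
  "split_colours ys = (\<lambda>i. filter (\<lambda>y. y \<in> Y i) ys)"

text \<open>
  An edge is determined by its letter and its range, so a path is determined by its first vertex
  and its list of letters.
\<close>

fun walk :: "bit \<Rightarrow> 'x letter list \<Rightarrow> 'x edge list" where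
  "walk v [] = []"
| "walk v (y # ys) = (y, case y of Pos x \<Rightarrow> v | Bar x \<Rightarrow> v + l x) # walk (v + l (base_letter y)) ys"

abbreviation "E \<equiv> label_graph k X l"
abbreviation "square_cong \<equiv> path_cong E (square_rels k X l)"

lemma disjoint_Y: "y \<in> Y i \<Longrightarrow> y \<in> Y i' \<Longrightarrow> i = i'"
  using alphabets unfolding Y_def alphabets_def disjoint_family_on_def by blast

lemma letter_sum_simps [simp]:
  "letter_sum [] = 0" "letter_sum (y # ys) = l (base_letter y) + letter_sum ys"
  "letter_sum (ys @ zs) = letter_sum ys + letter_sum zs"
  by (simp_all add: letter_sum_def)

lemma label_sum_cat [simp]: "label_sum (v \<cdot> w) = label_sum v + label_sum w"
  by (simp add: label_sum_def word_cat_def sum.distrib)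

lemma label_sum_empty [simp]: "label_sum empty_word = 0"
  by (simp add: label_sum_def empty_word_def)

lemma map_fst_walk [simp]: "map fst (walk v ys) = ys"
  by (induction ys arbitrary: v) auto

lemma walk_append: "walk v (ys @ zs) = walk v ys @ walk (v + letter_sum ys) zs"
  by (induction ys arbitrary: v) (auto simp: add.assoc)

lemma path_dom_walk: "path_dom E (v, walk v ys) = v + letter_sum ys"
proof (induction ys arbitrary: v)
  case (Cons y ys)
  have *: "esrc E (y, case y of Pos x \<Rightarrow> v | Bar x \<Rightarrow> v + l x) = v + l (base_letter y)"
    by (cases y) (auto simp: label_graph_def)
  show ?case by (simp add: * Cons.IH add.assoc)
qed auto

lemma is_path_iff: "is_path E p \<longleftrightarrow> (\<exists>v ys. p = (v, walk v ys) \<and> set ys \<subseteq> (\<Union>i. Y i))"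
proof -
  have "is_path E (v, es) \<longleftrightarrow> es = walk v (map fst es) \<and> set (map fst es) \<subseteq> (\<Union>i. Y i)" for v es
  proof (induction es arbitrary: v)
    case Nil
    then show ?case by (simp add: label_graph_def)
  next
    case (Cons e es)
    obtain y j where e: "e = (y, j)" by (cases e)
    have 1: "e \<in> edges E \<longleftrightarrow> y \<in> (\<Union>i. Y i)"
      by (auto simp: e label_graph_def Y_def)
    have 2: "erng E e = v \<longleftrightarrow> j = (case y of Pos x \<Rightarrow> v | Bar x \<Rightarrow> v + l x)"
      by (cases y) (auto simp: e label_graph_def)
    have 3: "esrc E e = v + l (base_letter y)" if "erng E e = v"
      using that by (cases y) (auto simp: e label_graph_def)
    have 4: "v \<in> verts E" by (simp add: label_graph_def)
    show ?case
    proof (cases "erng E e = v")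
      case True
      have "(if True then is_path E (v, e # es) else False) \<longleftrightarrow> y \<in> (\<Union>i. Y i) \<and> is_path E (v + l (base_letter y), es)"
        using 1 3[OF True] 4 True by simp
      then show ?thesis using True 2 unfolding Cons.IH by (auto simp: e)
    next
      case False
      then show ?thesis using 2 by (auto simp: e)
    qed
  qed
  then show ?thesis
    by (cases p) (metis map_fst_walk)
qed

lemma is_path_walk [simp]: "is_path E (v, walk v ys) \<longleftrightarrow> set ys \<subseteq> (\<Union>i. Y i)"
  unfolding is_path_iff by (metis Pair_inject map_fst_walk)

definition colour_form :: "(bit, 'x edge) path \<Rightarrow> 'x wordarrow" where
  "colour_form p = (fst p, split_colours (map fst (snd p)))"

lemma colour_form_walk [simp]: "colour_form (v, walk v ys) = (v, split_colours ys)"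
  by (simp add: colour_form_def)

lemma split_colours_Nil [simp]: "split_colours [] = empty_word"
  by (auto simp: split_colours_def empty_word_def)

lemma split_colours_append: "split_colours (ys @ zs) = split_colours ys \<cdot> split_colours zs"
  by (auto simp: split_colours_def word_cat_def)

lemma split_colours_words: "split_colours ys \<in> words"
  by (auto simp: split_colours_def words_def)

lemma label_sum_split:
  assumes "set ys \<subseteq> (\<Union>i. Y i)"
  shows "label_sum (split_colours ys) = letter_sum ys"
  using assms
proof (induction ys)
  case (Cons y ys)
  obtain i where i: "y \<in> Y i" using Cons.prems by auto
  have iK: "i \<in> {1..k}" using i by (auto simp: Y_def)
  have y: "y \<in> Y i' \<longleftrightarrow> i' = i" for i' using i disjoint_Y by blast
  have "label_sum (split_colours [y]) = (\<Sum>i'\<in>{1..k}. if i' = i then l (base_letter y) else 0)"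
    unfolding label_sum_def split_colours_def by (intro sum.cong) (auto simp: y)
  also have "\<dots> = l (base_letter y)" using iK by simp
  finally have "label_sum (split_colours [y]) = l (base_letter y)" .
  then show ?case
    using Cons split_colours_append[of "[y]" ys] by simp
qed simp

lemma square_rels_colour_form:
  assumes "(p, q) \<in> square_rels k X l"
  shows "\<exists>v y z i i'. p = (v, walk v [y, z]) \<and> q = (v, walk v [z, y]) \<and> y \<in> Y i \<and> z \<in> Y i' \<and> i \<noteq> i'"
  using assms
proof cases
  case (1 i i' a b t)
  then show ?thesis
    by (intro exI[of _ t] exI[of _ "Pos a"] exI[of _ "Pos b"] exI[of _ i] exI[of _ i'])
      (auto simp: two_path_def Y_def)
next
  case (2 i i' a b t)
  then show ?thesis
    by (intro exI[of _ "t + l b"] exI[of _ "Pos a"] exI[of _ "Bar b"] exI[of _ i] exI[of _ i'])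
      (auto simp: two_path_def Y_def ac_simps)
next
  case (3 i i' a b t)
  then show ?thesis
    by (intro exI[of _ "t + l a"] exI[of _ "Bar a"] exI[of _ "Pos b"] exI[of _ i] exI[of _ i'])
      (auto simp: two_path_def Y_def ac_simps)
next
  case (4 i i' a b t)
  then show ?thesis
    by (intro exI[of _ "t + l a + l b"] exI[of _ "Bar b"] exI[of _ "Bar a"] exI[of _ i'] exI[of _ i])
      (auto simp: two_path_def Y_def ac_simps)
qed

text \<open>
  A geometric square yields one relation at each of its four corners. Together they let any two
  adjacent letters of different colours be exchanged, barred or not.
\<close>

lemma square_rels_swap:
  assumes "y \<in> Y i" "z \<in> Y i'" "i \<noteq> i'"
  shows "((v, walk v [y, z]), (v, walk v [z, y])) \<in> square_cong"
proof -
  have K: "i \<in> {1..k}" "i' \<in> {1..k}" "base_letter y \<in> X i" "base_letter z \<in> X i'"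
    using assms by (auto simp: Y_def)
  show ?thesis
  proof (cases y; cases z)
    fix a b assume "y = Pos a" "z = Pos b"
    then show ?thesis
      using square_rels.intros(1)[of i k i' a X b l v] K assms
      by (intro path_cong.base) (simp add: two_path_def ac_simps)
  next
    fix a b assume "y = Pos a" "z = Bar b"
    then show ?thesis
      using square_rels.intros(2)[of i k i' a X b l "v + l b"] K assms
      by (intro path_cong.base) (simp add: two_path_def ac_simps)
  next
    fix a b assume "y = Bar a" "z = Pos b"
    then show ?thesis
      using square_rels.intros(3)[of i k i' a X b l "v + l a"] K assms
      by (intro path_cong.base) (simp add: two_path_def ac_simps)
  next
    fix a b assume "y = Bar a" "z = Bar b"
    then show ?thesis
      using square_rels.intros(4)[of i' k i b X a l "v + l a + l b"] K assms
      by (intro path_cong.base) (simp add: two_path_def ac_simps)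
  qed
qed

text \<open>
  Equality of the subwords of each colour is a congruence that contains the squares. Domains of
  equivalent paths agree because the sum of labels can be computed colour by colour, which is what
  makes the case of a composition work.
\<close>

lemma square_cong_sound:
  assumes "(p, q) \<in> square_cong"
  shows "is_path E p \<and> is_path E q \<and> colour_form p = colour_form q"
  using assms
proof induction
  case (base p q)
  from square_rels_colour_form[OF base] obtain v y z i i'
    where *: "p = (v, walk v [y, z])" "q = (v, walk v [z, y])" "y \<in> Y i" "z \<in> Y i'" "i \<noteq> i'" by blast
  have "is_path E p" "is_path E q" unfolding *(1,2) is_path_walk using *(3,4) by auto
  moreover have "colour_form p = colour_form q"
    proof -
    have "\<not> (y \<in> Y j \<and> z \<in> Y j)" for j using *(3-5) disjoint_Y by blast
    then show ?thesis by (auto simp: *(1,2) split_colours_def colour_form_def fun_eq_iff)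
  qed
  ultimately show ?case by blast
next
  case (comp p p' q q')
  from comp.IH obtain v ys v' ys' w zs w' zs' where
    p: "p = (v, walk v ys)" "set ys \<subseteq> (\<Union>i. Y i)" and
    p': "p' = (v', walk v' ys')" "set ys' \<subseteq> (\<Union>i. Y i)" and
    q: "q = (w, walk w zs)" "set zs \<subseteq> (\<Union>i. Y i)" and
    q': "q' = (w', walk w' zs')" "set zs' \<subseteq> (\<Union>i. Y i)"
    unfolding is_path_iff by blast
  have eq: "v = v'" "split_colours ys = split_colours ys'" "w = w'" "split_colours zs = split_colours zs'"
    using comp.IH by (simp_all add: p(1) p'(1) q(1) q'(1))
  have w: "w = v + letter_sum ys"
    using comp.hyps(3) by (simp add: p(1) q(1) path_dom_walk path_cod_def)
  have ls: "letter_sum ys = letter_sum ys'"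
    using label_sum_split p(2) p'(2) eq(2) by metis
  have 1: "path_comp p q = (v, walk v (ys @ zs))"
    by (simp add: p(1) q(1) w path_comp_def walk_append)
  have 2: "path_comp p' q' = (v, walk v (ys' @ zs'))"
    by (simp add: p'(1) q'(1) w eq(1) eq(3)[symmetric] path_comp_def walk_append ls)
  have "is_path E (path_comp p q)" "is_path E (path_comp p' q')"
    unfolding 1 2 is_path_walk using p p' q q' by auto
  then show ?case
    unfolding 1 2 by (simp add: split_colours_append eq)
qed auto

lemma square_cong_context:
  assumes "((v + letter_sum us, walk (v + letter_sum us) ys), (v + letter_sum us, walk (v + letter_sum us) zs)) \<in> square_cong"
    and "set us \<subseteq> (\<Union>i. Y i)" "set vs \<subseteq> (\<Union>i. Y i)"
  shows "((v, walk v (us @ ys @ vs)), (v, walk v (us @ zs @ vs))) \<in> square_cong"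
proof -
  let ?v = "v + letter_sum us"
  have s: "is_path E (?v, walk ?v ys)" "is_path E (?v, walk ?v zs)" 
     "split_colours ys = split_colours zs"
    using square_cong_sound[OF assms(1)] by auto
  have sub: "set ys \<subseteq> (\<Union>i. Y i)" "set zs \<subseteq> (\<Union>i. Y i)"
    using s(1,2) by auto
  have ls: "letter_sum ys = letter_sum zs" using s(3) sub label_sum_split by metis
  let ?w = "?v + letter_sum ys"
  have r1: "((v, walk v us), (v, walk v us)) \<in> square_cong"
    using assms(2) by (intro path_cong.refl) (simp only: is_path_walk)
  have r2: "((?w, walk ?w vs), (?w, walk ?w vs)) \<in> square_cong"
    using assms(3) by (intro path_cong.refl) (simp only: is_path_walk)
  have "(path_comp (?v, walk ?v ys) (?w, walk ?w vs), path_comp (?v, walk ?v zs) (?w, walk ?w vs)) \<in> square_cong"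
    by (rule path_cong.comp[OF assms(1) r2]) (simp add: path_dom_walk path_cod_def)
  then have "((?v, walk ?v (ys @ vs)), (?v, walk ?v (zs @ vs))) \<in> square_cong"
    by (simp add: path_comp_def walk_append ls)
  from path_cong.comp[OF r1 this] show ?thesis
    by (simp add: path_comp_def walk_append path_dom_walk path_cod_def)
qed

text \<open>
  A letter may jump to the front over letters of other colours, by the squares.
\<close>

lemma square_cong_move_front:
  assumes "y \<in> Y i" "set us \<subseteq> (\<Union>i'. Y i')" "\<forall>u\<in>set us. u \<notin> Y i" "set vs \<subseteq> (\<Union>i. Y i)"
  shows "((v, walk v (us @ y # vs)), (v, walk v (y # us @ vs))) \<in> square_cong"
  using assms(2,3)
proof (induction us arbitrary: v)
  case Nil
  have "is_path E (v, walk v (y # vs))" unfolding is_path_walk using assms(1,4) by auto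
  then show ?case by (simp add: path_cong.refl)
next
  case (Cons u us)
  then obtain i' where u: "u \<in> Y i'" "i' \<noteq> i" by auto
  have "((v, walk v ([u] @ (us @ y # vs) @ [])), (v, walk v ([u] @ (y # us @ vs) @ []))) \<in> square_cong"
    by (rule square_cong_context) (use Cons u in auto)
  moreover have "((v, walk v ([] @ [u, y] @ (us @ vs))), (v, walk v ([] @ [y, u] @ (us @ vs)))) \<in> square_cong"
    by (rule square_cong_context) (use square_rels_swap[OF u(1) assms(1) u(2)] Cons assms in auto)
  ultimately show ?case by (auto intro: path_cong.trans)
qed

text \<open>
  The first letter of one path is also the first letter of its colour in the other path. Moving it
  to the front there reduces the claim to shorter paths.
\<close>

lemma square_cong_complete:
  assumes "set ys \<subseteq> (\<Union>i. Y i)" "set zs \<subseteq> (\<Union>i. Y i)" "split_colours ys = split_colours zs"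
  shows "((v, walk v ys), (v, walk v zs)) \<in> square_cong"
  using assms
proof (induction ys arbitrary: v zs)
  case Nil
  have "zs = []"
  proof (cases zs)
    case (Cons z zs')
    then obtain i where "z \<in> Y i" using Nil by auto
    then have "split_colours zs i \<noteq> []" using Cons by (simp add: split_colours_def)
    then show ?thesis using Nil by (metis empty_word_def split_colours_Nil)
  qed auto
  then show ?case using path_cong.refl[of E "(v, walk v [])"] by (simp add: label_graph_def)
next
  case (Cons y ys)
  then obtain i where i: "y \<in> Y i" by auto
  have "filter (\<lambda>z. z \<in> Y i) zs = y # filter (\<lambda>z. z \<in> Y i) ys"
    using fun_cong[OF Cons.prems(3), of i] i by (simp add: split_colours_def)
  then obtain us vs where zs: "zs = us @ y # vs" "\<forall>u\<in>set us. u \<notin> Y i"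
    and fl: "filter (\<lambda>z. z \<in> Y i) ys = filter (\<lambda>z. z \<in> Y i) vs"
    by (auto simp: filter_eq_Cons_iff)
  have "split_colours ys i' = split_colours (us @ vs) i'" for i'
  proof (cases "i' = i")
    case True
    then show ?thesis using fl zs(2) by (simp add: split_colours_def)
  next
    case False
    then have "y \<notin> Y i'" using i disjoint_Y by blast
    then show ?thesis using fun_cong[OF Cons.prems(3), of i'] by (simp add: split_colours_def zs)
  qed
  then have "split_colours ys = split_colours (us @ vs)" by auto
  then have "((v + letter_sum [y], walk (v + letter_sum [y]) ys),
      (v + letter_sum [y], walk (v + letter_sum [y]) (us @ vs))) \<in> square_cong"
    using Cons zs by auto
  then have "((v, walk v ([y] @ ys @ [])), (v, walk v ([y] @ (us @ vs) @ []))) \<in> square_cong"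
    by (rule square_cong_context) (use Cons in auto)
  moreover have "((v, walk v (us @ y # vs)), (v, walk v (y # us @ vs))) \<in> square_cong"
    by (rule square_cong_move_front[OF i]) (use Cons zs in auto)
  ultimately show ?case unfolding zs(1) by (auto intro: path_cong.trans path_cong.sym)
qed

lemma square_cong_iff: "(p, q) \<in> square_cong \<longleftrightarrow> is_path E p \<and> is_path E q \<and> colour_form p = colour_form q"
proof
  assume *: "is_path E p \<and> is_path E q \<and> colour_form p = colour_form q"
  then obtain v ys v' zs where "p = (v, walk v ys)" "set ys \<subseteq> (\<Union>i. Y i)"
    "q = (v', walk v' zs)" "set zs \<subseteq> (\<Union>i. Y i)" unfolding is_path_iff by blast
  with * show "(p, q) \<in> square_cong" using square_cong_complete by auto
qed (use square_cong_sound in blast)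

text \<open>
  The arrow of \<open>C\<close> with given codomain and given words of each colour.
\<close>

definition arrow :: "'x wordarrow \<Rightarrow> (bit, 'x edge) path set" where
  "arrow c = {p. is_path E p \<and> colour_form p = c}"

text \<open>
  The words are concatenated colour by colour.
\<close>

lemma split_colours_surj:
  assumes "w \<in> words"
  obtains ys where "set ys \<subseteq> (\<Union>i. Y i)" "split_colours ys = w"
proof -
  have "\<exists>ys. set ys \<subseteq> (\<Union>i. Y i) \<and> (\<forall>i. split_colours ys i = (if i \<le> r then w i else []))" for r
  proof (induction r)
    case 0
    have "set (w 0) \<subseteq> Y 0" using assms by (simp add: words_def)
    then have "w 0 = []" by (simp add: Y_def)
    then show ?case by (intro exI[of _ "[]"]) (auto simp: empty_word_def)
  next
    case (Suc r)
    then obtain ys where ys: "set ys \<subseteq> (\<Union>i. Y i)"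
      "\<And>i. split_colours ys i = (if i \<le> r then w i else [])" by blast
    have sub: "set (w i) \<subseteq> Y i" for i using assms by (auto simp: words_def)
    have "split_colours (w (Suc r)) i = (if i = Suc r then w i else [])" for i
      using sub[of "Suc r"] disjoint_Y[of _ "Suc r" i]
      by (auto simp: split_colours_def filter_id_conv filter_empty_conv subset_iff)
    then have "split_colours (ys @ w (Suc r)) i = (if i \<le> Suc r then w i else [])" for i
      by (auto simp: split_colours_append word_cat_def ys)
    moreover have "set (ys @ w (Suc r)) \<subseteq> (\<Union>i. Y i)" using ys(1) sub by auto
    ultimately show ?case by blast
  qed
  from this[of k] obtain ys where ys: "set ys \<subseteq> (\<Union>i. Y i)"
    "\<And>i. split_colours ys i = (if i \<le> k then w i else [])" by blast
  have "w i = []" if "\<not> i \<le> k" for i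
  proof -
    have "set (w i) \<subseteq> Y i" using assms by (simp add: words_def)
    then show ?thesis using that by (simp add: Y_def)
  qed
  then have "split_colours ys = w" using ys(2) by auto
  then show ?thesis using that ys(1) by blast
qed

lemma arrow_nonempty:
  assumes "w \<in> words"
  obtains ys where "set ys \<subseteq> (\<Union>i. Y i)" "split_colours ys = w" "(j, walk j ys) \<in> arrow (j, w)"
proof -
  obtain ys where "set ys \<subseteq> (\<Union>i. Y i)" "split_colours ys = w"
    using split_colours_surj[OF assms] .
  then show ?thesis by (intro that[of ys]) (auto simp: arrow_def)
qed

lemma square_cong_class:
  assumes "is_path E p"
  shows "square_cong `` {p} = arrow (colour_form p)"
  using assms by (auto simp: square_cong_iff arrow_def)

lemma arrow_memD:
  assumes "p \<in> arrow (j, w)"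
  obtains ys where "p = (j, walk j ys)" "set ys \<subseteq> (\<Union>i. Y i)" "split_colours ys = w"
    "path_dom E p = j + label_sum w"
proof -
  from assms obtain v ys where "p = (v, walk v ys)" "set ys \<subseteq> (\<Union>i. Y i)" "v = j" "split_colours ys = w"
    by (auto simp: arrow_def is_path_iff)
  then show ?thesis using label_sum_split[of ys] by (intro that[of ys]) (auto simp: path_dom_walk)
qed

abbreviation "C \<equiv> C_label k X l"

lemma C_simps: 
  "arrows C = {p. is_path E p} // square_cong"
  "adom C A = square_cong `` {(path_dom E p, []) | p. p \<in> A}"
  "acod C A = square_cong `` {(path_cod p, []) | p. p \<in> A}"
  "acomp C A B = square_cong `` {path_comp p q | p q. p \<in> A \<and> q \<in> B \<and> path_dom E p = path_cod q}"
  by (simp_all add: C_label_def path_quotient_def category.defs)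

lemma arrows_C: "arrows C = arrow ` (UNIV \<times> words)"
proof -
  have "arrows C = (\<lambda>p. arrow (colour_form p)) ` {p. is_path E p}"
    unfolding C_simps quotient_def using square_cong_class by auto
  also have "\<dots> = arrow ` (UNIV \<times> words)"
  proof -
    have "colour_form ` {p. is_path E p} = UNIV \<times> words"
    proof (intro equalityI subsetI)
      fix c :: "'x wordarrow" assume c: "c \<in> UNIV \<times> words"
      obtain j w where jw: "c = (j, w)" by (cases c)
      with c arrow_nonempty[of w j] have "\<exists>p. p \<in> arrow c" by blast
      then show "c \<in> colour_form ` {p. is_path E p}" by (auto simp: arrow_def)
    qed (auto simp: is_path_iff split_colours_words)
    then show ?thesis by (metis image_image)
  qed
  finally show ?thesis .
qed

lemma arrow_inj: "inj_on arrow (UNIV \<times> words)"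
proof (rule inj_onI, clarify)
  fix j w j' w' assume w: "w \<in> words" "w' \<in> words" and eq: "arrow (j, w) = arrow (j', w')"
  obtain ys where "(j, walk j ys) \<in> arrow (j, w)" using arrow_nonempty[OF w(1)] by blast
  then have "(j, walk j ys) \<in> arrow (j', w')" "(j, walk j ys) \<in> arrow (j, w)" using eq by auto
  then show "j = j' \<and> w = w'" by (auto simp: arrow_def)
qed

lemma square_cong_vertex: "square_cong `` {(v, [])} = arrow (v, empty_word)"
  using square_cong_class[of "(v, [])"] is_path_iff[of "(v, [])"] colour_form_walk[of v "[]"]
  by (metis colour_form_walk walk.simps(1) split_colours_Nil empty_subsetI list.set(1))

lemma adom_C:
  assumes "w \<in> words"
  shows "adom C (arrow (j, w)) = arrow (j + label_sum w, empty_word)"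
proof -
  have "path_dom E p = j + label_sum w" if "p \<in> arrow (j, w)" for p
    using that by (rule arrow_memD)
  moreover obtain ys where "(j, walk j ys) \<in> arrow (j, w)"
    using arrow_nonempty[OF assms] by blast
  ultimately have "{(path_dom E p, []) | p. p \<in> arrow (j, w)}
      = {(j + label_sum w, [] :: 'x edge list)}"
    by (intro equalityI subsetI) (clarsimp, metis (mono_tags, lifting) CollectI singletonD)
  then show ?thesis unfolding C_simps by (simp only: square_cong_vertex)
qed

lemma acod_C:
  assumes "w \<in> words"
  shows "acod C (arrow (j, w)) = arrow (j, empty_word)"
proof -
  have "path_cod p = j" if "p \<in> arrow (j, w)" for p
    using that by (rule arrow_memD) (simp add: path_cod_def)
  moreover obtain ys where "(j, walk j ys) \<in> arrow (j, w)"
    using arrow_nonempty[OF assms] by blast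
  ultimately have "{(path_cod p, []) | p. p \<in> arrow (j, w)} = {(j, [] :: 'x edge list)}"
    by (intro equalityI subsetI) (clarsimp, metis (mono_tags, lifting) CollectI singletonD)
  then show ?thesis unfolding C_simps by (simp only: square_cong_vertex)
qed

lemma acomp_C:
  assumes w: "w \<in> words" "w' \<in> words"
  shows "acomp C (arrow (j, w)) (arrow (j + label_sum w, w')) = arrow (j, w \<cdot> w')"
proof -
  let ?P = "{path_comp p q | p q. p \<in> arrow (j, w) \<and> q \<in> arrow (j + label_sum w, w')
    \<and> path_dom E p = path_cod q}"
  obtain ys where ys: "set ys \<subseteq> (\<Union>i. Y i)" "split_colours ys = w" "(j, walk j ys) \<in> arrow (j, w)"
    using arrow_nonempty[OF w(1)] by blast
  obtain zs where zs: "set zs \<subseteq> (\<Union>i. Y i)" "split_colours zs = w'"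
    "(j + label_sum w, walk (j + label_sum w) zs) \<in> arrow (j + label_sum w, w')"
    using arrow_nonempty[OF w(2)] by blast
  have ls: "letter_sum ys = label_sum w" using label_sum_split[OF ys(1)] ys(2) by simp
  have "path_comp (j, walk j ys) (j + label_sum w, walk (j + label_sum w) zs) \<in> ?P"
    using ys zs ls by (fastforce simp: path_dom_walk path_cod_def)
  then have ne: "?P \<noteq> {}" by blast
  have sub: "?P \<subseteq> arrow (j, w \<cdot> w')"
  proof
    fix x assume "x \<in> ?P"
    then obtain p q where x: "x = path_comp p q" and p: "p \<in> arrow (j, w)"
      and q: "q \<in> arrow (j + label_sum w, w')" by blast
    from p obtain ys where ys: "p = (j, walk j ys)" "set ys \<subseteq> (\<Union>i. Y i)" "split_colours ys = w"
      "path_dom E p = j + label_sum w" by (rule arrow_memD)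
    from q obtain zs where zs: "q = (j + label_sum w, walk (j + label_sum w) zs)"
      "set zs \<subseteq> (\<Union>i. Y i)" "split_colours zs = w'" by (rule arrow_memD)
    have ls: "letter_sum ys = label_sum w" using label_sum_split[OF ys(2)] ys(3) by simp
    have "path_comp p q = (j, walk j (ys @ zs))"
      by (simp add: path_comp_def ys(1) zs(1) walk_append ls)
    moreover have "is_path E (j, walk j (ys @ zs))"
      unfolding is_path_walk using ys(2) zs(2) by auto
    ultimately show "x \<in> arrow (j, w \<cdot> w')"
      by (simp add: x arrow_def split_colours_append ys(3) zs(3))
  qed
  have "square_cong `` {p} = arrow (j, w \<cdot> w')" if "p \<in> ?P" for p
  proof -
    have "p \<in> arrow (j, w \<cdot> w')" using sub that by (rule subsetD)
    then show ?thesis using square_cong_class[of p] by (simp add: arrow_def)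
  qed
  then have "square_cong `` ?P = arrow (j, w \<cdot> w')"
    using ne by (metis (no_types, lifting) Image_eq_UN SUP_cong UN_constant)
  then show ?thesis unfolding C_simps .
qed

end

section \<open>Prefix replacing bijections of the boundary\<close>

context labelled_alphabets
begin

definition colours :: "nat set" where
  "colours = {1..k}"

definition boundary :: "(nat \<Rightarrow> 'x letter stream) set" where
  "boundary = {\<omega>. \<forall>i\<in>colours. sset (\<omega> i) \<subseteq> Y i}"

definition shift_word :: "'x word \<Rightarrow> (nat \<Rightarrow> 'x letter stream) \<Rightarrow> nat \<Rightarrow> 'x letter stream"
    (infixr \<open>\<triangleright>\<close> 70) where
  "w \<triangleright> \<omega> = (\<lambda>i. w i @- \<omega> i)"

text \<open>
  Streams of an index outside \<open>colours\<close> carry no information and are left alone, so that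
  \<open>take_word N \<omega> \<triangleright> drop_word N \<omega> = \<omega>\<close> holds for all indices.
\<close>

definition take_word :: "nat \<Rightarrow> (nat \<Rightarrow> 'x letter stream) \<Rightarrow> 'x word" where
  "take_word N \<omega> = (\<lambda>i. if i \<in> colours then stake N (\<omega> i) else [])"

definition drop_word :: "nat \<Rightarrow> (nat \<Rightarrow> 'x letter stream) \<Rightarrow> nat \<Rightarrow> 'x letter stream" where
  "drop_word N \<omega> = (\<lambda>i. if i \<in> colours then sdrop N (\<omega> i) else \<omega> i)"

definition long :: "nat \<Rightarrow> 'x word \<Rightarrow> bool" where
  "long N w \<longleftrightarrow> (\<forall>i\<in>colours. N \<le> length (w i))"

definition short :: "nat \<Rightarrow> 'x word \<Rightarrow> bool" where
  "short N w \<longleftrightarrow> (\<forall>i. length (w i) \<le> N)"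

definition level :: "nat \<Rightarrow> 'x word set" where
  "level N = {w \<in> words. \<forall>i\<in>colours. length (w i) = N}"

text \<open>
  From here on an arrow of \<open>C\<close> is represented by the pair of its codomain and its tuple of words.
  The bijection with the actual arrows is \<open>arrow\<close>.
\<close>

definition arr :: "'x wordarrow set" where
  "arr = UNIV \<times> words"

abbreviation level_arrows :: "nat \<Rightarrow> 'x wordarrow set" where
  "level_arrows N \<equiv> UNIV \<times> level N"

definition points :: "'x point set" where
  "points = UNIV \<times> boundary"

definition source :: "'x wordarrow \<Rightarrow> bit" where
  "source c = fst c + label_sum (snd c)"

definition act :: "'x wordarrow \<Rightarrow> (nat \<Rightarrow> 'x letter stream) \<Rightarrow> 'x point" where
  "act c \<omega> = (fst c, snd c \<triangleright> \<omega>)"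

definition extend :: "'x wordarrow \<Rightarrow> 'x word \<Rightarrow> 'x wordarrow"
    (infixl \<open>\<odot>\<close> 70) where
  "c \<odot> u = (fst c, snd c \<cdot> u)"

definition cyl :: "'x wordarrow \<Rightarrow> 'x point set" where
  "cyl c = act c ` boundary"

lemma Y_outside: "i \<notin> colours \<Longrightarrow> Y i = {}"
  by (auto simp: Y_def colours_def)

lemma finite_Y: "finite (Y i)"
proof (cases "i \<in> {1..k}")
  case True
  then have "finite (X i)" using alphabets by (auto simp: alphabets_def)
  moreover have "Y i \<subseteq> Pos ` X i \<union> Bar ` X i"
  proof
    fix y assume "y \<in> Y i"
    then show "y \<in> Pos ` X i \<union> Bar ` X i" by (cases y) (auto simp: Y_def)
  qed
  ultimately show ?thesis by (metis finite_Un finite_imageI finite_subset)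
qed (auto simp: Y_def)

lemma card_Y: "i \<in> colours \<Longrightarrow> card (Y i) = 2 * m"
proof -
  assume i: "i \<in> colours"
  then have X: "finite (X i)" "card (X i) = m"
    using alphabets by (auto simp: alphabets_def colours_def)
  have "Y i = Pos ` X i \<union> Bar ` X i"
  proof (intro equalityI subsetI)
    fix y assume "y \<in> Y i"
    then show "y \<in> Pos ` X i \<union> Bar ` X i" by (cases y) (auto simp: Y_def)
  qed (use i in \<open>auto simp: Y_def colours_def\<close>)
  moreover have "card (Pos ` X i \<union> Bar ` X i) = card (Pos ` X i) + card (Bar ` X i)"
    by (rule card_Un_disjoint) (use X in auto)
  moreover have "card (Pos ` X i) = m" "card (Bar ` X i) = m"
    using X by (auto simp: card_image inj_on_def)
  ultimately show ?thesis by simp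
qed

text \<open>
  The letters come in pairs \<open>x\<close>, \<open>\<bar>x\<close>, so no alphabet is a singleton. This is the reason why the
  action on infinite words is faithful.
\<close>

lemma other_letter:
  assumes "i \<in> colours"
  shows "\<exists>y\<in>Y i. y \<noteq> z"
proof (rule ccontr)
  assume "\<not> ?thesis"
  then have "Y i \<subseteq> {z}" by blast
  then have "card (Y i) \<le> 1" using card_mono[of "{z}" "Y i"] by simp
  then show False using card_Y[OF assms] m_pos by simp
qed

lemma words_outside: "w \<in> words \<Longrightarrow> i \<notin> colours \<Longrightarrow> w i = []"
  using Y_outside[of i] by (metis (mono_tags, lifting) empty_subsetI list.set(1) mem_Collect_eq set_empty subset_antisym words_def)

lemma cat_assoc: "(u \<cdot> v) \<cdot> w = u \<cdot> (v \<cdot> w)"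
  by (simp add: word_cat_def)

lemma cat_empty [simp]: "w \<cdot> empty_word = w" "empty_word \<cdot> w = w"
  by (simp_all add: word_cat_def empty_word_def)

lemma shift_cat [simp]: "(v \<cdot> w) \<triangleright> \<omega> = v \<triangleright> w \<triangleright> \<omega>"
  by (simp add: word_cat_def shift_word_def)

lemma shift_empty [simp]: "empty_word \<triangleright> \<omega> = \<omega>"
  by (simp add: empty_word_def shift_word_def)

lemma words_cat [simp, intro]: "v \<in> words \<Longrightarrow> w \<in> words \<Longrightarrow> v \<cdot> w \<in> words"
  by (auto simp: words_def word_cat_def)

lemma words_empty [simp, intro]: "empty_word \<in> words"
  by (simp add: words_def empty_word_def)

lemma boundary_shift [simp, intro]: "w \<in> words \<Longrightarrow> \<omega> \<in> boundary \<Longrightarrow> w \<triangleright> \<omega> \<in> boundary"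
  by (auto simp: words_def boundary_def shift_word_def)

lemma take_drop [simp]: "take_word N \<omega> \<triangleright> drop_word N \<omega> = \<omega>"
  by (auto simp: take_word_def drop_word_def shift_word_def stake_sdrop)

lemma take_level [simp, intro]: "\<omega> \<in> boundary \<Longrightarrow> take_word N \<omega> \<in> level N"
proof -
  assume *: "\<omega> \<in> boundary"
  have "set (stake N (\<omega> i)) \<subseteq> sset (\<omega> i)" for i
    by (metis stake_sdrop sset_shift Un_upper1)
  then show ?thesis using * by (fastforce simp: level_def words_def take_word_def boundary_def)
qed

lemma drop_boundary [simp, intro]: "\<omega> \<in> boundary \<Longrightarrow> drop_word N \<omega> \<in> boundary"
proof -
  assume *: "\<omega> \<in> boundary"
  have "sset (sdrop N (\<omega> i)) \<subseteq> sset (\<omega> i)" for i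
    by (metis stake_sdrop sset_shift Un_upper2)
  then show ?thesis using * by (fastforce simp: drop_word_def boundary_def)
qed

lemma level_words: "w \<in> level N \<Longrightarrow> w \<in> words"
  by (simp add: level_def)

lemma level_long: "w \<in> level N \<Longrightarrow> long N w"
  by (simp add: level_def long_def)

lemma long_mono: "long N w \<Longrightarrow> M \<le> N \<Longrightarrow> long M w"
  by (auto simp: long_def)

lemma short_mono: "short N w \<Longrightarrow> N \<le> M \<Longrightarrow> short M w"
  unfolding short_def using le_trans by blast

lemma long_split:
  assumes "w \<in> words" "long (N + M) w"
  obtains u v where "u \<in> level N" "v \<in> words" "w = u \<cdot> v" "long M v"
proof (rule that)
  let ?u = "\<lambda>i. take N (w i)" and ?v = "\<lambda>i. drop N (w i)"
  show "?u \<in> level N" using assms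
    by (auto simp: level_def words_def long_def dest!: in_set_takeD)
  show "?v \<in> words" using assms by (auto simp: words_def dest!: in_set_dropD)
  show "w = ?u \<cdot> ?v" by (simp add: word_cat_def)
  show "long M ?v" using assms by (fastforce simp: long_def)
qed

text \<open>
  Two prefixes of the same tuple of infinite words always have a common extension, but one of them
  extends the other only if it is at least as long in every colour.
\<close>

lemma prefix_words:
  assumes "v \<in> words" "w \<in> words" "v \<triangleright> \<omega> = w \<triangleright> \<omega>'" "\<And>i. i \<in> colours \<Longrightarrow> length (v i) \<le> length (w i)"
  obtains u where "u \<in> words" "w = v \<cdot> u" "\<omega> = u \<triangleright> \<omega>'"
proof (rule that)
  let ?u = "\<lambda>i. drop (length (v i)) (w i)"
  have eq: "v i @- \<omega> i = w i @- \<omega>' i" for i using fun_cong[OF assms(3), of i] by (simp add: shift_word_def)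
  have le: "length (v i) \<le> length (w i)" for i
    using assms(4) words_outside[OF assms(1)] by (cases "i \<in> colours") auto
  show "?u \<in> words" using assms by (auto simp: words_def dest!: in_set_dropD)
  have "take (length (v i)) (w i) = v i" for i
    using arg_cong[OF eq[of i], of "stake (length (v i))"] le[of i] by (simp add: stake_shift)
  then show "w = v \<cdot> ?u" unfolding word_cat_def by (metis append_take_drop_id)
  show "\<omega> = ?u \<triangleright> \<omega>'"
  proof
    fix i
    show "\<omega> i = (?u \<triangleright> \<omega>') i"
      using arg_cong[OF eq[of i], of "sdrop (length (v i))"] le[of i]
      by (simp add: sdrop_shift shift_word_def)
  qed
qed

lemma boundary_nonempty: "\<exists>\<omega>. \<omega> \<in> boundary"
proof -
  have "\<exists>y. i \<in> colours \<longrightarrow> y \<in> Y i" for i using other_letter by blast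
  then obtain y where "\<And>i. i \<in> colours \<longrightarrow> y i \<in> Y i" by metis
  then have "(\<lambda>i. sconst (y i)) \<in> boundary" by (auto simp: boundary_def)
  then show ?thesis by blast
qed

text \<open>
  If \<open>v i\<close> were shorter than \<open>w i\<close>, then \<open>v i\<close> could be continued by a constant stream of a letter
  different from the next letter of \<open>w i\<close>.
\<close>

lemma faithful_words:
  assumes "v \<in> words" "w \<in> words" "\<And>\<omega>. \<omega> \<in> boundary \<Longrightarrow> v \<triangleright> \<omega> = w \<triangleright> \<omega>"
  shows "v = w"
proof -
  have main: "\<not> length (v i) < length (w i)"
    if vw: "v \<in> words" "w \<in> words" "\<And>\<omega>. \<omega> \<in> boundary \<Longrightarrow> v \<triangleright> \<omega> = w \<triangleright> \<omega>" for v w i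
  proof
    assume less: "length (v i) < length (w i)"
    then have i: "i \<in> colours" using words_outside[OF vw(2)] by (metis list.size(3) not_less_zero)
    obtain y where y: "y \<in> Y i" "y \<noteq> w i ! length (v i)" using other_letter[OF i] by blast
    obtain \<omega> where \<omega>: "\<omega> \<in> boundary" using boundary_nonempty by blast
    have "\<omega>(i := sconst y) \<in> boundary" using \<omega> y by (auto simp: boundary_def)
    from vw(3)[OF this] have "v i @- sconst y = w i @- sconst y"
      by (metis shift_word_def fun_upd_same)
    then have "(v i @- sconst y) !! length (v i) = (w i @- sconst y) !! length (v i)" by simp
    then show False using less y by simp
  qed
  have "length (v i) = length (w i)" for i
    using main[OF assms, of i] main[OF assms(2,1), of i] assms(3) by force
  moreover obtain \<omega> where \<omega>: "\<omega> \<in> boundary" using boundary_nonempty by blast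
  ultimately obtain u where u: "u \<in> words" "w = v \<cdot> u"
    using prefix_words[OF assms(1,2) assms(3)[OF \<omega>]] by (metis order_refl)
  then have "u i = []" for i
    using \<open>\<And>i. length (v i) = length (w i)\<close>[of i] by (simp add: word_cat_def)
  then have "u = empty_word" by (auto simp: empty_word_def)
  then show ?thesis using u by simp
qed

definition words_of_length :: "(nat \<Rightarrow> nat) \<Rightarrow> 'x word set" where
  "words_of_length len = {w \<in> words. \<forall>i\<in>colours. length (w i) = len i}"

lemma bij_words_of_length:
  "bij_betw (\<lambda>w. restrict w colours) (words_of_length len)
     (PiE colours (\<lambda>i. {ys. set ys \<subseteq> Y i \<and> length ys = len i}))"
proof (rule bij_betwI[where g = "\<lambda>w i. if i \<in> colours then w i else []"])
  show "(\<lambda>w. restrict w colours) \<in> words_of_length len \<rightarrow>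
      (PiE colours (\<lambda>i. {ys. set ys \<subseteq> Y i \<and> length ys = len i}))"
    by (auto simp: words_of_length_def words_def)
  show "(\<lambda>w i. if i \<in> colours then w i else []) \<in>
      (PiE colours (\<lambda>i. {ys. set ys \<subseteq> Y i \<and> length ys = len i})) \<rightarrow> words_of_length len"
    by (auto simp: words_of_length_def words_def PiE_iff Ball_def subset_iff)
  show "(\<lambda>i. if i \<in> colours then restrict w colours i else []) = w" if "w \<in> words_of_length len" for w
    using that words_outside[of w] by (auto simp: words_of_length_def)
  show "restrict (\<lambda>i. if i \<in> colours then w i else []) colours = w"
    if "w \<in> PiE colours (\<lambda>i. {ys. set ys \<subseteq> Y i \<and> length ys = len i})" for w
    using that by (auto simp: PiE_iff extensional_def restrict_def)
qed

lemma finite_words_of_length: "finite (words_of_length len)"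
  using bij_betw_finite[OF bij_words_of_length[of len]]
  by (simp add: finite_PiE colours_def finite_lists_length_eq finite_Y)

lemma card_words_of_length: "card (words_of_length len) = (2 * m) ^ (\<Sum>i\<in>colours. len i)"
proof -
  have "card (words_of_length len) = (\<Prod>i\<in>colours. card {ys. set ys \<subseteq> Y i \<and> length ys = len i})"
    using bij_betw_same_card[OF bij_words_of_length[of len]]
    by (simp add: card_PiE colours_def)
  also have "\<dots> = (\<Prod>i\<in>colours. (2 * m) ^ len i)"
    by (intro prod.cong) (simp_all add: card_lists_length_eq finite_Y card_Y)
  finally show ?thesis by (simp add: power_sum)
qed

lemma level_eq: "level N = words_of_length (\<lambda>i. N)"
  by (simp add: level_def words_of_length_def)

lemma finite_level: "finite (level N)"
  by (simp add: level_eq finite_words_of_length)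

lemma finite_level_arrows: "finite (level_arrows N)"
proof -
  have "(UNIV :: bit set) = {0, 1}" using bit.exhaust by auto
  then have "finite (UNIV :: bit set)" by (metis finite.emptyI finite.insertI)
  then show ?thesis using finite_level by (rule finite_cartesian_product)
qed

lemma act_extend [simp]: "act (c \<odot> u) \<omega> = act c (u \<triangleright> \<omega>)"
  by (simp add: act_def extend_def)

lemma extend_extend: "(c \<odot> u) \<odot> v = c \<odot> (u \<cdot> v)"
  by (simp add: extend_def cat_assoc)

lemma extend_empty [simp]: "c \<odot> empty_word = c"
  by (simp add: extend_def)

lemma source_extend [simp]: "source (c \<odot> u) = source c + label_sum u"
  by (simp add: source_def extend_def add.assoc)

lemma arr_extend [simp, intro]: "c \<in> arr \<Longrightarrow> u \<in> words \<Longrightarrow> c \<odot> u \<in> arr"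
  by (auto simp: arr_def extend_def)

lemma act_points [simp, intro]: "c \<in> arr \<Longrightarrow> \<omega> \<in> boundary \<Longrightarrow> act c \<omega> \<in> points"
  by (auto simp: arr_def act_def points_def)

lemma cyl_points: "c \<in> arr \<Longrightarrow> cyl c \<subseteq> points"
  by (auto simp: cyl_def)

lemma cyl_extend: "u \<in> words \<Longrightarrow> cyl (c \<odot> u) \<subseteq> cyl c"
  by (auto simp: cyl_def)

lemma cyl_nonempty: "cyl c \<noteq> {}"
  using boundary_nonempty by (auto simp: cyl_def)

lemma act_inj: "act c \<omega> = act c \<omega>' \<longleftrightarrow> \<omega> = \<omega>'"
  by (auto simp: act_def shift_word_def fun_eq_iff)

lemma faithful:
  assumes "c \<in> arr" "d \<in> arr" "\<And>\<omega>. \<omega> \<in> boundary \<Longrightarrow> act c \<omega> = act d \<omega>"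
  shows "c = d"
proof -
  have "snd c = snd d"
    using assms by (intro faithful_words) (auto simp: arr_def act_def)
  moreover have "fst c = fst d" using assms(3) boundary_nonempty by (auto simp: act_def)
  ultimately show ?thesis by (simp add: prod_eq_iff)
qed

lemma prefix:
  assumes "c \<in> arr" "d \<in> arr" "act c \<omega> = act d \<omega>'" 
    "\<And>i. i \<in> colours \<Longrightarrow> length (snd c i) \<le> length (snd d i)"
  obtains u where "u \<in> words" "d = c \<odot> u" "\<omega> = u \<triangleright> \<omega>'"
proof -
  have "snd c \<in> words" "snd d \<in> words" "snd c \<triangleright> \<omega> = snd d \<triangleright> \<omega>'"
    using assms(1-3) by (auto simp: act_def arr_def)
  then obtain u where u: "u \<in> words" "snd d = snd c \<cdot> u" "\<omega> = u \<triangleright> \<omega>'"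
    by (rule prefix_words[OF _ _ _ assms(4)])
  then show ?thesis using assms(3) by (intro that[of u]) (auto simp: act_def extend_def prod_eq_iff)
qed

lemma prefix_long:
  assumes "c \<in> arr" "d \<in> arr" "act c \<omega> = act d \<omega>'" "short N (snd c)" "long N (snd d)"
  obtains u where "u \<in> words" "d = c \<odot> u" "\<omega> = u \<triangleright> \<omega>'"
proof (rule prefix[OF assms(1-3)])
  show "length (snd c i) \<le> length (snd d i)" if "i \<in> colours" for i
    using assms(4,5) that le_trans unfolding short_def long_def by blast
qed (rule that)

lemma arr_split:
  assumes "c \<in> arr" "long (N + M) (snd c)"
  obtains d u where "d \<in> level_arrows N" "u \<in> words" "c = d \<odot> u" "long M u"
proof -
  have "snd c \<in> words" using assms(1) by (auto simp: arr_def)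
  then obtain u v where "u \<in> level N" "v \<in> words" "snd c = u \<cdot> v" "long M v"
    using long_split assms(2) by blast
  then show ?thesis by (intro that[of "(fst c, u)" v]) (auto simp: extend_def prod_eq_iff)
qed

lemma level_arr: "c \<in> level_arrows N \<Longrightarrow> c \<in> arr"
  by (auto simp: arr_def level_words)

lemma points_split:
  assumes "x \<in> points"
  obtains c \<omega> where "c \<in> level_arrows N" "c \<in> arr" "\<omega> \<in> boundary" "x = act c \<omega>"
proof -
  obtain j \<omega> where x: "x = (j, \<omega>)" "\<omega> \<in> boundary" using assms by (auto simp: points_def)
  show ?thesis
    by (rule that[of "(j, take_word N \<omega>)" "drop_word N \<omega>"])
      (use x in \<open>auto simp: act_def intro: level_arr\<close>)
qed

lemma short_bound:
  assumes "finite A" "A \<subseteq> arr"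
  obtains N where "\<And>c. c \<in> A \<Longrightarrow> short N (snd c)"
proof -
  define g where "g c = (\<Sum>i\<in>colours. length (snd c i))" for c :: "'x wordarrow"
  have "short (g c) (snd c)" if "c \<in> A" for c
  proof -
    have "length (snd c i) \<le> g c" for i
    proof (cases "i \<in> colours")
      case True
      then show ?thesis unfolding g_def by (rule member_le_sum[of i colours "\<lambda>i. length (snd c i)"]) (auto simp: colours_def)
    next
      case False
      then have "snd c i = []" using that assms words_outside[of "snd c" i] by (auto simp: arr_def)
      then show ?thesis by simp
    qed
    then show ?thesis by (simp add: short_def)
  qed
  moreover obtain N where "\<And>c. c \<in> A \<Longrightarrow> g c \<le> N"
    using assms(1) by (metis finite_imageI finite_nat_set_iff_bounded_le image_eqI)
  ultimately show ?thesis using that short_mono by blast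
qed

text \<open>
  Equivalently, a finite union of cylinders: membership is decided by a prefix of bounded length.
\<close>

definition clopen :: "'x point set \<Rightarrow> bool" where
  "clopen U \<longleftrightarrow> U \<subseteq> points \<and>
    (\<exists>N. \<forall>c\<in>arr. long N (snd c) \<longrightarrow> cyl c \<subseteq> U \<or> cyl c \<inter> U = {})"

definition replaces ::
  "('x point \<Rightarrow> 'x point) \<Rightarrow>
   'x wordarrow \<Rightarrow> 'x wordarrow \<Rightarrow> bool" where
  "replaces f c c' \<longleftrightarrow> c' \<in> arr \<and> source c' = source c \<and> (\<forall>\<omega>\<in>boundary. f (act c \<omega>) = act c' \<omega>)"

text \<open>
  For clopen \<open>U\<close> a uniform bound \<open>N\<close> is no restriction, because the boundary is compact.
\<close>

definition locally_prefix ::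
  "'x point set \<Rightarrow>
   ('x point \<Rightarrow> 'x point) \<Rightarrow> bool" where
  "locally_prefix U f \<longleftrightarrow>
    (\<exists>N. \<forall>c\<in>arr. long N (snd c) \<longrightarrow> cyl c \<subseteq> U \<longrightarrow> (\<exists>c'. replaces f c c'))"

text \<open>
  Bijections of the boundary are total functions that fix everything else, so that composition and
  inverse are those of functions.
\<close>

definition H :: "('x point \<Rightarrow> 'x point) set" where
  "H = {f. bij_betw f points points \<and> (\<forall>x. x \<notin> points \<longrightarrow> f x = x) \<and> locally_prefix points f}"

lemma replacesD:
  assumes "replaces f c c'"
  shows "c' \<in> arr" "source c' = source c" "\<omega> \<in> boundary \<Longrightarrow> f (act c \<omega>) = act c' \<omega>"
  using assms by (auto simp: replaces_def)

lemma replaces_cyl: "replaces f c c' \<Longrightarrow> f ` cyl c = cyl c'"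
  by (auto simp: replaces_def cyl_def image_image)

lemma replaces_extend: "replaces f c c' \<Longrightarrow> u \<in> words \<Longrightarrow> replaces f (c \<odot> u) (c' \<odot> u)"
  by (auto simp: replaces_def)

lemma replaces_comp: "replaces f c c' \<Longrightarrow> replaces g c' c'' \<Longrightarrow> replaces (g \<circ> f) c c''"
  by (auto simp: replaces_def)

lemma replaces_unique: "replaces f c c' \<Longrightarrow> replaces f c c'' \<Longrightarrow> c' = c''"
  by (intro faithful) (auto simp: replaces_def)

lemma replaces_cong: "replaces f c c' \<Longrightarrow> (\<And>x. x \<in> cyl c \<Longrightarrow> f x = g x) \<Longrightarrow> replaces g c c'"
  by (auto simp: replaces_def cyl_def)

lemma clopenE:
  assumes "clopen U"
  obtains N where "\<And>c. c \<in> arr \<Longrightarrow> long N (snd c) \<Longrightarrow> cyl c \<subseteq> U \<or> cyl c \<inter> U = {}"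
  using assms unfolding clopen_def by auto

lemma locally_prefixE:
  assumes "locally_prefix U f"
  obtains N where "\<And>c. c \<in> arr \<Longrightarrow> long N (snd c) \<Longrightarrow> cyl c \<subseteq> U \<Longrightarrow> \<exists>c'. replaces f c c'"
  using assms unfolding locally_prefix_def by blast

lemma clopen_cylinders:
  assumes "finite A" "A \<subseteq> arr"
  shows "clopen (\<Union>(cyl ` A))"
proof -
  obtain N where N: "\<And>c. c \<in> A \<Longrightarrow> short N (snd c)" using short_bound[OF assms] by blast
  have "cyl d \<subseteq> \<Union>(cyl ` A) \<or> cyl d \<inter> \<Union>(cyl ` A) = {}" if d: "d \<in> arr" "long N (snd d)" for d
  proof (rule disjCI)
    assume "cyl d \<inter> \<Union>(cyl ` A) \<noteq> {}"
    then obtain c \<omega> \<omega>' where c: "c \<in> A" "act c \<omega> = act d \<omega>'" by (auto simp: cyl_def) (metis)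
    have "c \<in> arr" using c assms by blast
    then obtain u where "u \<in> words" "d = c \<odot> u"
      using prefix_long[OF _ d(1) c(2) N[OF c(1)] d(2)] by metis
    then show "cyl d \<subseteq> \<Union>(cyl ` A)" using c cyl_extend by blast
  qed
  then show ?thesis unfolding clopen_def using assms(2) cyl_points by blast
qed

lemma clopen_points: "clopen points"
  unfolding clopen_def using cyl_points by auto

lemma clopen_empty: "clopen {}"
  unfolding clopen_def by auto

lemma clopen_subset: "clopen U \<Longrightarrow> U \<subseteq> points"
  by (simp add: clopen_def)

lemma clopen_Diff:
  assumes "clopen U" "clopen V"
  shows "clopen (U - V)"
proof -
  obtain N where N: "\<And>c. c \<in> arr \<Longrightarrow> long N (snd c) \<Longrightarrow> cyl c \<subseteq> U \<or> cyl c \<inter> U = {}"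
    using clopenE[OF assms(1)] by blast
  obtain M where M: "\<And>c. c \<in> arr \<Longrightarrow> long M (snd c) \<Longrightarrow> cyl c \<subseteq> V \<or> cyl c \<inter> V = {}"
    using clopenE[OF assms(2)] by blast
  have "cyl c \<subseteq> U - V \<or> cyl c \<inter> (U - V) = {}" if "c \<in> arr" "long (max N M) (snd c)" for c
  proof -
    have "long N (snd c)" "long M (snd c)" using that(2) long_mono by auto
    then show ?thesis using N[OF that(1)] M[OF that(1)] by blast
  qed
  then show ?thesis using clopen_subset[OF assms(1)] unfolding clopen_def by blast
qed

lemma clopen_Un:
  assumes "clopen U" "clopen V"
  shows "clopen (U \<union> V)"
proof -
  have "U \<union> V = points - ((points - U) - V)" using assms by (auto simp: clopen_def)
  then show ?thesis using assms clopen_Diff clopen_points by metis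
qed

text \<open>
  A finite cover by cylinders suffices, as every arrow longer than all of them has one of them as
  a prefix.
\<close>

lemma locally_prefixI:
  assumes "finite A" "A \<subseteq> arr" "U \<subseteq> \<Union>(cyl ` A)"
    and "\<And>c. c \<in> A \<Longrightarrow> \<exists>c'. replaces f c c'"
  shows "locally_prefix U f"
proof -
  obtain N where N: "\<And>c. c \<in> A \<Longrightarrow> short N (snd c)" using short_bound[OF assms(1,2)] by blast
  have "\<exists>d'. replaces f d d'" if d: "d \<in> arr" "long N (snd d)" "cyl d \<subseteq> U" for d
  proof -
    have "cyl d \<inter> \<Union>(cyl ` A) \<noteq> {}" using d(3) assms(3) cyl_nonempty[of d] by blast
    then obtain c \<omega> \<omega>' where c: "c \<in> A" "act c \<omega> = act d \<omega>'" by (auto simp: cyl_def) (metis)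
    have "c \<in> arr" using c assms by blast
    then obtain u where u: "u \<in> words" "d = c \<odot> u"
      using prefix_long[OF _ d(1) c(2) N[OF c(1)] d(2)] by metis
    obtain c' where "replaces f c c'" using assms(4)[OF c(1)] by blast
    then show ?thesis using replaces_extend u by blast
  qed
  then show ?thesis unfolding locally_prefix_def by blast
qed

lemma locally_prefix_cong:
  assumes "locally_prefix U f" "\<And>x. x \<in> U \<Longrightarrow> f x = g x"
  shows "locally_prefix U g"
proof -
  obtain N where N: "\<And>c. c \<in> arr \<Longrightarrow> long N (snd c) \<Longrightarrow> cyl c \<subseteq> U \<Longrightarrow> \<exists>c'. replaces f c c'"
    using locally_prefixE[OF assms(1)] by blast
  have "\<exists>c'. replaces g c c'" if c: "c \<in> arr" "long N (snd c)" "cyl c \<subseteq> U" for c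
  proof -
    obtain c' where "replaces f c c'" using N[OF c] by blast
    then have "replaces g c c'" by (rule replaces_cong) (use assms(2) c(3) in blast)
    then show ?thesis by blast
  qed
  then show ?thesis unfolding locally_prefix_def by blast
qed

lemma long_cat: "long M u \<Longrightarrow> long M (v \<cdot> u)"
  by (auto simp: long_def word_cat_def trans_le_add2)

text \<open>
  A prefix that is longer by \<open>M\<close> than necessary keeps a remainder of length \<open>M\<close> when its initial part
  is replaced. Long prefixes are therefore mapped to long prefixes, which makes compositions local.
\<close>

lemma locally_prefix_long:
  assumes "locally_prefix U f" "clopen U"
  obtains N where "\<And>c. c \<in> arr \<Longrightarrow> long N (snd c) \<Longrightarrow> cyl c \<subseteq> U \<Longrightarrow> \<exists>c'. replaces f c c' \<and> long M (snd c')"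
proof -
  obtain N0 where N0: "\<And>c. c \<in> arr \<Longrightarrow> long N0 (snd c) \<Longrightarrow> cyl c \<subseteq> U \<or> cyl c \<inter> U = {}"
    using clopenE[OF assms(2)] by blast
  obtain N1 where N1: "\<And>c. c \<in> arr \<Longrightarrow> long N1 (snd c) \<Longrightarrow> cyl c \<subseteq> U \<Longrightarrow> \<exists>c'. replaces f c c'"
    using locally_prefixE[OF assms(1)] by blast
  show ?thesis
  proof (rule that[of "max N0 N1 + M"])
    fix c assume c: "c \<in> arr" "long (max N0 N1 + M) (snd c)" "cyl c \<subseteq> U"
    obtain d u where d: "d \<in> level_arrows (max N0 N1)" "u \<in> words" "c = d \<odot> u" "long M u"
      using arr_split[OF c(1,2)] .
    then have dl: "d \<in> arr" "long (max N0 N1) (snd d)" by (auto simp: level_arr level_long)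
    then have dN: "long N0 (snd d)" "long N1 (snd d)" using long_mono by auto
    have "cyl d \<inter> U \<noteq> {}" using c(3) cyl_nonempty[of c] cyl_extend[OF d(2), of d] d(3) by blast
    then have "cyl d \<subseteq> U" using N0 dl dN by blast
    then obtain d' where d': "replaces f d d'" using N1 dl dN by blast
    then have "replaces f c (d' \<odot> u)" using replaces_extend d by blast
    moreover have "long M (snd (d' \<odot> u))" using d(4) by (simp add: extend_def long_cat)
    ultimately show "\<exists>c'. replaces f c c' \<and> long M (snd c')" by blast
  qed
qed

lemma locally_prefix_comp:
  assumes "locally_prefix U f" "clopen U" "locally_prefix V g" "f ` U \<subseteq> V"
  shows "locally_prefix U (g \<circ> f)"
proof -
  obtain M where M: "\<And>c. c \<in> arr \<Longrightarrow> long M (snd c) \<Longrightarrow> cyl c \<subseteq> V \<Longrightarrow> \<exists>c'. replaces g c c'"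
    using locally_prefixE[OF assms(3)] by blast
  obtain N where N: "\<And>c. c \<in> arr \<Longrightarrow> long N (snd c) \<Longrightarrow> cyl c \<subseteq> U \<Longrightarrow>
     \<exists>c'. replaces f c c' \<and> long M (snd c')"
    using locally_prefix_long[OF assms(1,2)] by blast
  have "\<exists>c'. replaces (g \<circ> f) c c'" if c: "c \<in> arr" "long N (snd c)" "cyl c \<subseteq> U" for c
  proof -
    obtain c' where c': "replaces f c c'" "long M (snd c')" using N[OF c] by blast
    have "cyl c' \<subseteq> V" using assms(4) c(3) replaces_cyl[OF c'(1)] by blast
    then obtain c'' where "replaces g c' c''" using M c' replacesD(1) by blast
    then show ?thesis using c' replaces_comp by blast
  qed
  then show ?thesis unfolding locally_prefix_def by blast
qed

lemma locally_prefix_Un: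
  assumes "locally_prefix U f" "locally_prefix V f" "clopen U"
  shows "locally_prefix (U \<union> V) f"
proof -
  obtain N1 where N1: "\<And>c. c \<in> arr \<Longrightarrow> long N1 (snd c) \<Longrightarrow> cyl c \<subseteq> U \<Longrightarrow> \<exists>c'. replaces f c c'"
    using locally_prefixE[OF assms(1)] by blast
  obtain N2 where N2: "\<And>c. c \<in> arr \<Longrightarrow> long N2 (snd c) \<Longrightarrow> cyl c \<subseteq> V \<Longrightarrow> \<exists>c'. replaces f c c'"
    using locally_prefixE[OF assms(2)] by blast
  obtain N3 where N3: "\<And>c. c \<in> arr \<Longrightarrow> long N3 (snd c) \<Longrightarrow> cyl c \<subseteq> U \<or> cyl c \<inter> U = {}"
    using clopenE[OF assms(3)] by blast
  have "\<exists>c'. replaces f c c'"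
    if c: "c \<in> arr" "long (max N1 (max N2 N3)) (snd c)" "cyl c \<subseteq> U \<union> V" for c
  proof -
    have l: "long N1 (snd c)" "long N2 (snd c)" "long N3 (snd c)" using c(2) long_mono by auto
    show ?thesis
    proof (cases "cyl c \<subseteq> U")
      case False
      then have "cyl c \<subseteq> V" using N3[OF c(1) l(3)] c(3) by blast
      then show ?thesis using N2 c l by blast
    qed (use N1 c l in blast)
  qed
  then show ?thesis unfolding locally_prefix_def by blast
qed

lemma H_locally: "f \<in> H \<Longrightarrow> locally_prefix points f"
  by (simp add: H_def)

lemma H_replaces:
  assumes "f \<in> H"
  obtains N where "\<And>c. c \<in> arr \<Longrightarrow> long N (snd c) \<Longrightarrow> \<exists>c'. replaces f c c' \<and> long M (snd c')"
  using locally_prefix_long[OF H_locally[OF assms] clopen_points, of M] cyl_points by metis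

lemma clopen_preimage:
  assumes "f \<in> H" "clopen V"
  shows "clopen {x \<in> points. f x \<in> V}"
proof -
  obtain M where M: "\<And>c. c \<in> arr \<Longrightarrow> long M (snd c) \<Longrightarrow> cyl c \<subseteq> V \<or> cyl c \<inter> V = {}"
    using clopenE[OF assms(2)] by blast
  obtain N where N: "\<And>c. c \<in> arr \<Longrightarrow> long N (snd c) \<Longrightarrow> \<exists>c'. replaces f c c' \<and> long M (snd c')"
    using H_replaces[OF assms(1)] by blast
  have "cyl c \<subseteq> {x \<in> points. f x \<in> V} \<or> cyl c \<inter> {x \<in> points. f x \<in> V} = {}"
    if c: "c \<in> arr" "long N (snd c)" for c
  proof -
    obtain c' where c': "replaces f c c'" "long M (snd c')" using N[OF c] by blast
    then have "f ` cyl c = cyl c'" "c' \<in> arr" using replaces_cyl replacesD(1) by blast+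
    then show ?thesis using M[of c'] c' cyl_points[OF c(1)] by blast
  qed
  then show ?thesis unfolding clopen_def by blast
qed

text \<open>
  The images of the cylinders of a fixed level are finitely many cylinders that cover the boundary,
  and the inverse replaces prefixes on each of them.
\<close>

lemma H_inverse:
  assumes "f \<in> H" "g \<in> points \<rightarrow> points" "\<And>x. x \<in> points \<Longrightarrow> g (f x) = x" "\<And>x. x \<notin> points \<Longrightarrow> g x = x"
  shows "g \<in> H"
proof -
  have bij: "bij_betw f points points" using assms(1) by (simp add: H_def)
  have fg: "f (g y) = y" if y: "y \<in> points" for y
  proof -
    obtain x where "x \<in> points" "y = f x" using bij y unfolding bij_betw_def by blast
    then show ?thesis using assms(3) by simp
  qed
  have "bij_betw g points points"
    using assms(2,3) fg bij by (intro bij_betw_byWitness[of _ f]) (auto simp: bij_betw_def)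
  moreover have "locally_prefix points g"
  proof -
    obtain N where N: "\<And>c. c \<in> arr \<Longrightarrow> long N (snd c) \<Longrightarrow> \<exists>c'. replaces f c c' \<and> long 0 (snd c')"
      using H_replaces[OF assms(1)] by blast
    have "\<exists>c'. replaces f c c'" if "c \<in> level_arrows N" for c
    proof -
      have "c \<in> arr" "long N (snd c)" using that level_arr level_long by auto
      then show ?thesis using N by blast
    qed
    then obtain \<theta> where \<theta>: "\<And>c. c \<in> level_arrows N \<Longrightarrow> replaces f c (\<theta> c)" by metis
    show ?thesis
    proof (rule locally_prefixI[of "\<theta> ` (level_arrows N)"])
      show "finite (\<theta> ` (level_arrows N))" by (intro finite_imageI finite_level_arrows)
      show "\<theta> ` (level_arrows N) \<subseteq> arr" using \<theta> replacesD(1) by blast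
      show "points \<subseteq> \<Union>(cyl ` \<theta> ` (level_arrows N))"
      proof
        fix y assume y: "y \<in> points"
        then have "g y \<in> points" using assms(2) by blast
        then obtain c \<omega> where c: "c \<in> level_arrows N" "\<omega> \<in> boundary" "g y = act c \<omega>"
          by (rule points_split)
        then have "y = act (\<theta> c) \<omega>" using fg[OF y] replacesD(3)[OF \<theta>[OF c(1)] c(2)] by simp
        then show "y \<in> \<Union>(cyl ` \<theta> ` (level_arrows N))" using c by (auto simp: cyl_def)
      qed
      fix d assume "d \<in> \<theta> ` (level_arrows N)"
      then obtain c where c: "c \<in> level_arrows N" "d = \<theta> c" by blast
      have r: "replaces f c d" using \<theta> c by blast
      have "g (act d \<omega>) = act c \<omega>" if \<omega>: "\<omega> \<in> boundary" for \<omega>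
        using assms(3)[OF act_points[OF level_arr[OF c(1)] \<omega>]] replacesD(3)[OF r \<omega>] by simp
      then have "replaces g d c"
        using level_arr[OF c(1)] replacesD(2)[OF r] by (simp add: replaces_def)
      then show "\<exists>c'. replaces g d c'" by blast
    qed
  qed
  ultimately show ?thesis using assms(4) by (simp add: H_def)
qed

definition H_group :: "('x point \<Rightarrow> 'x point) monoid" where
  "H_group = \<lparr>carrier = H, mult = (\<circ>), one = id\<rparr>"

lemma H_group_simps [simp]: "carrier H_group = H" "x \<otimes>\<^bsub>H_group\<^esub> y = x \<circ> y" "\<one>\<^bsub>H_group\<^esub> = id"
  by (simp_all add: H_group_def)

lemma id_H: "id \<in> H"
proof -
  have "replaces id c c" if "c \<in> arr" for c using that by (simp add: replaces_def)
  then have "locally_prefix points id" unfolding locally_prefix_def by blast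
  then show ?thesis by (simp add: H_def)
qed

lemma comp_H: "f \<in> H \<Longrightarrow> g \<in> H \<Longrightarrow> f \<circ> g \<in> H"
  unfolding H_def using locally_prefix_comp[of points g points f] clopen_points bij_betw_trans[of g points points f]
  by (auto simp: bij_betw_def)

lemma H_points: "f \<in> H \<Longrightarrow> x \<in> points \<Longrightarrow> f x \<in> points"
  by (auto simp: H_def bij_betw_def)

lemma H_bij:
  assumes "f \<in> H"
  shows "bij f"
proof -
  have "bij_betw f points points" using assms by (simp add: H_def)
  moreover have "bij_betw f (- points) (- points)"
    using assms by (subst bij_betw_cong[of _ _ id]) (auto simp: H_def)
  ultimately have "bij_betw f (points \<union> - points) (points \<union> - points)"
    by (rule bij_betw_combine) auto
  then show ?thesis by simp
qed

lemma inv_H: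
  assumes "f \<in> H"
  shows "inv_into UNIV f \<in> H"
proof -
  have b: "bij f" using H_bij[OF assms] .
  have im: "f ` points = points" using assms by (auto simp: H_def bij_betw_def)
  have inv: "inv_into UNIV f (f x) = x" for x using b by (simp add: bij_is_inj)
  show ?thesis
  proof (rule H_inverse[OF assms])
    show "inv_into UNIV f \<in> points \<rightarrow> points"
    proof
      fix y assume "y \<in> points"
      then obtain x where "x \<in> points" "y = f x" using im by blast
      then show "inv_into UNIV f y \<in> points" using inv by simp
    qed
    show "inv_into UNIV f (f x) = x" for x by (rule inv)
    show "inv_into UNIV f x = x" if "x \<notin> points" for x
    proof -
      have "f x = x" using assms that unfolding H_def by blast
      then show ?thesis using inv[of x] by simp
    qed
  qed
qed

lemma group_H: "group H_group"
proof (rule groupI)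
  fix f assume "f \<in> carrier H_group"
  then show "\<exists>g\<in>carrier H_group. g \<otimes>\<^bsub>H_group\<^esub> f = \<one>\<^bsub>H_group\<^esub>"
    using inv_H H_bij by (intro bexI[of _ "inv_into UNIV f"]) (auto simp: bij_is_inj)
qed (auto simp: comp_H id_H comp_assoc)

end

section \<open>The inverse monoid of bijective morphisms\<close>

definition inverse_map :: "('a \<rightharpoonup> 'a) \<Rightarrow> ('a \<rightharpoonup> 'a)" where
  "inverse_map \<theta> = (\<lambda>b. if b \<in> ran \<theta> then Some (THE a. \<theta> a = Some b) else None)"

definition ident_on :: "'a set \<Rightarrow> ('a \<rightharpoonup> 'a)" where
  "ident_on R = (\<lambda>a. if a \<in> R then Some a else None)"

definition essential_ideal :: "('a, 'z) category_scheme \<Rightarrow> 'a set \<Rightarrow> bool" where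
  "essential_ideal C R \<longleftrightarrow> fg_right_ideal C R \<and> R \<noteq> {} \<and>
     (\<forall>R'. fg_right_ideal C R' \<longrightarrow> R' \<noteq> {} \<longrightarrow> R \<inter> R' \<noteq> {})"

lemma inj_on_domD: "inj_on \<theta> (dom \<theta>) \<Longrightarrow> \<theta> a = Some b \<Longrightarrow> \<theta> a' = Some b \<Longrightarrow> a = a'"
  by (auto simp: inj_on_def dom_def)

lemma inverse_map_iff:
  assumes "inj_on \<theta> (dom \<theta>)"
  shows "inverse_map \<theta> b = Some a \<longleftrightarrow> \<theta> a = Some b"
proof
  assume "\<theta> a = Some b"
  moreover have "(THE a. \<theta> a = Some b) = a"
    using \<open>\<theta> a = Some b\<close> inj_on_domD[OF assms] by blast
  ultimately show "inverse_map \<theta> b = Some a" by (auto simp: inverse_map_def ran_def)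
next
  assume *: "inverse_map \<theta> b = Some a"
  then obtain a' where a': "\<theta> a' = Some b" by (auto simp: inverse_map_def ran_def split: if_splits)
  moreover have "(THE a. \<theta> a = Some b) = a'"
    using a' inj_on_domD[OF assms] by blast
  ultimately show "\<theta> a = Some b" using * by (auto simp: inverse_map_def split: if_splits)
qed

lemma dom_inverse_map: "inj_on \<theta> (dom \<theta>) \<Longrightarrow> dom (inverse_map \<theta>) = ran \<theta>"
  by (auto simp: inverse_map_def dom_def)

lemma ran_inverse_map: "inj_on \<theta> (dom \<theta>) \<Longrightarrow> ran (inverse_map \<theta>) = dom \<theta>"
  by (auto simp: ran_def dom_def inverse_map_iff)

lemma inj_inverse_map: "inj_on \<theta> (dom \<theta>) \<Longrightarrow> inj_on (inverse_map \<theta>) (dom (inverse_map \<theta>))"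
  by (rule inj_onI) (metis (no_types, lifting) domD inverse_map_iff option.inject)

lemma inverse_map_comp:
  assumes "inj_on \<theta> (dom \<theta>)"
  shows "inverse_map \<theta> \<circ>\<^sub>m \<theta> = ident_on (dom \<theta>)" "\<theta> \<circ>\<^sub>m inverse_map \<theta> = ident_on (ran \<theta>)"
proof -
  show "inverse_map \<theta> \<circ>\<^sub>m \<theta> = ident_on (dom \<theta>)"
  proof
    fix a show "(inverse_map \<theta> \<circ>\<^sub>m \<theta>) a = ident_on (dom \<theta>) a"
      using inverse_map_iff[OF assms, of _ a]
      by (cases "\<theta> a") (auto simp: map_comp_def ident_on_def dom_def)
  qed
  show "\<theta> \<circ>\<^sub>m inverse_map \<theta> = ident_on (ran \<theta>)"
  proof
    fix b show "(\<theta> \<circ>\<^sub>m inverse_map \<theta>) b = ident_on (ran \<theta>) b"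
    proof (cases "inverse_map \<theta> b")
      case None
      then have "b \<notin> ran \<theta>" by (auto simp: inverse_map_def)
      then show ?thesis using None by (simp add: map_comp_def ident_on_def)
    next
      case (Some a)
      then have "\<theta> a = Some b" using inverse_map_iff[OF assms] by blast
      then show ?thesis using Some by (simp add: map_comp_def ident_on_def ranI)
    qed
  qed
qed

lemma dom_ident_on [simp]: "dom (ident_on R) = R" and ran_ident_on [simp]: "ran (ident_on R) = R"
  by (auto simp: ident_on_def dom_def ran_def split: if_splits)

lemma ident_on_eq_empty [simp]: "ident_on R = Map.empty \<longleftrightarrow> R = {}"
  by (metis dom_eq_empty_conv dom_ident_on)

lemma ident_on_comp [simp]: "ident_on R \<circ>\<^sub>m ident_on R' = ident_on (R \<inter> R')"
  by (auto simp: ident_on_def map_comp_def fun_eq_iff)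

lemma comp_ident_on: "\<theta> \<circ>\<^sub>m ident_on R = \<theta> |` R"
  by (auto simp: ident_on_def map_comp_def restrict_map_def fun_eq_iff)

lemma map_comp_assoc: "(\<theta> \<circ>\<^sub>m \<theta>') \<circ>\<^sub>m \<theta>'' = \<theta> \<circ>\<^sub>m (\<theta>' \<circ>\<^sub>m \<theta>'')"
  by (auto simp: map_comp_def fun_eq_iff split: option.splits)

lemma ident_on_dom [simp]: "\<theta> \<circ>\<^sub>m ident_on (dom \<theta>) = \<theta>"
  unfolding comp_ident_on by (auto simp: restrict_map_def fun_eq_iff dom_def)

lemma ident_on_ran [simp]: "ident_on (ran \<theta>) \<circ>\<^sub>m \<theta> = \<theta>"
  by (auto simp: ident_on_def map_comp_def fun_eq_iff ran_def split: option.splits)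

text \<open>
  In a monoid of partial injections the two equations for an inverse force it to be the inverse
  partial map.
\<close>

lemma sinv_map:
  assumes mult: "mult M = (\<circ>\<^sub>m)" and inj: "\<And>\<theta>. \<theta> \<in> carrier M \<Longrightarrow> inj_on \<theta> (dom \<theta>)"
    and \<theta>: "\<theta> \<in> carrier M" "inverse_map \<theta> \<in> carrier M"
  shows "sinv M \<theta> = inverse_map \<theta>"
  unfolding sinv_def mult
proof (rule the_equality)
  note i = inj[OF \<theta>(1)]
  show "inverse_map \<theta> \<in> carrier M \<and> \<theta> \<circ>\<^sub>m inverse_map \<theta> \<circ>\<^sub>m \<theta> = \<theta> \<and>
      inverse_map \<theta> \<circ>\<^sub>m \<theta> \<circ>\<^sub>m inverse_map \<theta> = inverse_map \<theta>"
    using \<theta>(2) inverse_map_comp[OF i] ident_on_dom[of \<theta>] ident_on_ran[of \<theta>]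
      ident_on_ran[of "inverse_map \<theta>"] ran_inverse_map[OF i]
    by (simp add: map_comp_assoc)
  fix \<beta> assume \<beta>: "\<beta> \<in> carrier M \<and> \<theta> \<circ>\<^sub>m \<beta> \<circ>\<^sub>m \<theta> = \<theta> \<and> \<beta> \<circ>\<^sub>m \<theta> \<circ>\<^sub>m \<beta> = \<beta>"
  have "inj_on \<beta> (dom \<beta>)" using inj \<beta> by blast
  have 1: "\<beta> b = Some a" if ab: "\<theta> a = Some b" for a b
  proof -
    have "(\<theta> \<circ>\<^sub>m \<beta> \<circ>\<^sub>m \<theta>) a = Some b" using \<beta> that by simp
    then obtain a' where "\<beta> b = Some a'" "\<theta> a' = Some b"
      using ab by (auto simp: map_comp_def split: option.splits)
    then show ?thesis using inj_on_domD[OF i ab] by auto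
  qed
  have 2: "\<theta> a = Some b" if ab: "\<beta> b = Some a" for a b
  proof -
    have "(\<beta> \<circ>\<^sub>m \<theta> \<circ>\<^sub>m \<beta>) b = Some a" using \<beta> that by simp
    then obtain b' where "\<theta> a = Some b'" "\<beta> b' = Some a"
      using ab by (auto simp: map_comp_def split: option.splits)
    then show ?thesis using inj_on_domD[OF \<open>inj_on \<beta> (dom \<beta>)\<close> ab] by auto
  qed
  show "\<beta> = inverse_map \<theta>"
  proof
    fix b show "\<beta> b = inverse_map \<theta> b"
    proof (cases "\<beta> b")
      case None
      then show ?thesis using 1 inverse_map_iff[OF i, of b] by (metis not_None_eq)
    next
      case (Some a)
      then show ?thesis using 2 inverse_map_iff[OF i, of b a] by simp
    qed
  qed
qed

lemma bij_morphismD: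
  assumes "bij_morphism C R1 R2 \<theta>"
  shows "dom \<theta> = R1" "ran \<theta> = R2" "inj_on \<theta> (dom \<theta>)"
    "\<theta> r = Some r' \<Longrightarrow> adom C r' = adom C r"
    "\<theta> r = Some r' \<Longrightarrow> c \<in> arrows C \<Longrightarrow> adom C r = acod C c \<Longrightarrow> \<theta> (acomp C r c) = Some (acomp C r' c)"
proof -
  have d: "r \<in> R1" if "\<theta> r = Some r'" for r r' using assms that by (auto simp: bij_morphism_def)
  show "dom \<theta> = R1" "ran \<theta> = R2" "inj_on \<theta> (dom \<theta>)" using assms by (auto simp: bij_morphism_def)
  show "adom C r' = adom C r" if "\<theta> r = Some r'"
    using assms d[OF that] that unfolding bij_morphism_def by (metis option.sel)
  show "\<theta> (acomp C r c) = Some (acomp C r' c)"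
    if "\<theta> r = Some r'" "c \<in> arrows C" "adom C r = acod C c"
    using assms d[OF that(1)] that unfolding bij_morphism_def by (metis option.sel)
qed

lemma bij_morphismI:
  assumes "dom \<theta> = R1" "ran \<theta> = R2" "inj_on \<theta> (dom \<theta>)"
    "\<And>r r'. \<theta> r = Some r' \<Longrightarrow> adom C r' = adom C r"
    "\<And>r r' c. \<theta> r = Some r' \<Longrightarrow> c \<in> arrows C \<Longrightarrow> adom C r = acod C c \<Longrightarrow> \<theta> (acomp C r c) = Some (acomp C r' c)"
  shows "bij_morphism C R1 R2 \<theta>"
  unfolding bij_morphism_def using assms by auto

lemma bij_morphism_inverse:
  assumes "bij_morphism C R1 R2 \<theta>"
  shows "bij_morphism C R2 R1 (inverse_map \<theta>)"
proof (rule bij_morphismI)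
  note D = bij_morphismD[OF assms]
  show "dom (inverse_map \<theta>) = R2" "ran (inverse_map \<theta>) = R1"
    using D(1,2) dom_inverse_map[OF D(3)] ran_inverse_map[OF D(3)] by auto
  show "inj_on (inverse_map \<theta>) (dom (inverse_map \<theta>))" using inj_inverse_map[OF D(3)] .
  show "adom C r' = adom C r" if "inverse_map \<theta> r = Some r'" for r r'
    using that D(4)[of r' r] inverse_map_iff[OF D(3)] by simp
  show "inverse_map \<theta> (acomp C r c) = Some (acomp C r' c)"
    if "inverse_map \<theta> r = Some r'" "c \<in> arrows C" "adom C r = acod C c" for r r' c
    using that D(4)[of r' r] D(5)[of r' r c] inverse_map_iff[OF D(3)] by simp
qed

lemma R_monoid_simps [simp]:
  "mult (R_monoid C) = (\<circ>\<^sub>m)" "zero_elt (R_monoid C) = Map.empty"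
  by (simp_all add: R_monoid_def)

lemma carrier_R_monoid:
  "\<theta> \<in> carrier (R_monoid C) \<longleftrightarrow>
     fg_right_ideal C (dom \<theta>) \<and> fg_right_ideal C (ran \<theta>) \<and> bij_morphism C (dom \<theta>) (ran \<theta>) \<theta>"
  unfolding R_monoid_def using bij_morphismD(1,2) by (auto, blast+)

lemma R_monoid_inj: "\<theta> \<in> carrier (R_monoid C) \<Longrightarrow> inj_on \<theta> (dom \<theta>)"
  unfolding carrier_R_monoid using bij_morphismD(3) by blast

lemma R_monoid_inverse: "\<theta> \<in> carrier (R_monoid C) \<Longrightarrow> inverse_map \<theta> \<in> carrier (R_monoid C)"
  using R_monoid_inj[of \<theta> C] unfolding carrier_R_monoid
  by (simp add: dom_inverse_map ran_inverse_map bij_morphism_inverse)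

lemma sinv_R_monoid: "\<theta> \<in> carrier (R_monoid C) \<Longrightarrow> sinv (R_monoid C) \<theta> = inverse_map \<theta>"
  by (rule sinv_map) (simp_all add: R_monoid_inj R_monoid_inverse)

lemma ident_on_carrier:
  assumes "fg_right_ideal C R"
  shows "ident_on R \<in> carrier (R_monoid C)"
proof -
  have "set_comp C R (arrows C) \<subseteq> R" using assms by (simp add: fg_right_ideal_def right_ideal_def)
  then have "acomp C r c \<in> R" if "r \<in> R" "c \<in> arrows C" "adom C r = acod C c" for r c
    using that unfolding set_comp_def by blast
  then have "bij_morphism C R R (ident_on R)"
    by (intro bij_morphismI) (auto simp: inj_on_def ident_on_def dom_def ran_def split: if_splits)
  then show ?thesis using assms unfolding carrier_R_monoid by simp
qed

lemma idempotents_R_monoid: "idempotents (R_monoid C) = ident_on ` {R. fg_right_ideal C R}"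
proof (intro equalityI subsetI)
  fix \<theta> assume "\<theta> \<in> idempotents (R_monoid C)"
  then have \<theta>: "\<theta> \<in> carrier (R_monoid C)" "\<theta> \<circ>\<^sub>m \<theta> = \<theta>" by (auto simp: idempotents_def)
  have i: "inj_on \<theta> (dom \<theta>)" using R_monoid_inj \<theta>(1) .
  have "\<theta> a = ident_on (dom \<theta>) a" for a
  proof (cases "\<theta> a")
    case (Some b)
    then have "\<theta> b = Some b" using fun_cong[OF \<theta>(2), of a] by (simp add: map_comp_def)
    then show ?thesis using Some inj_on_domD[OF i] by (auto simp: ident_on_def dom_def)
  qed (auto simp: ident_on_def dom_def)
  then have "\<theta> = ident_on (dom \<theta>)" by auto
  then show "\<theta> \<in> ident_on ` {R. fg_right_ideal C R}" using \<theta>(1) unfolding carrier_R_monoid by blast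
qed (auto simp: idempotents_def ident_on_carrier)

lemma essential_ident_on: "essential (R_monoid C) (ident_on R) \<longleftrightarrow> essential_ideal C R"
proof -
  have "ident_on R \<in> ident_on ` {R. fg_right_ideal C R} \<longleftrightarrow> fg_right_ideal C R"
    by (metis dom_ident_on image_iff mem_Collect_eq)
  then show ?thesis unfolding essential_def essential_ideal_def idempotents_R_monoid by auto
qed

text \<open>
  The idempotents \<open>s\<^sup>-\<^sup>1s\<close> and \<open>ss\<^sup>-\<^sup>1\<close> are the identities of the domain and the range of \<open>s\<close>.
\<close>

lemma carrier_essential_part:
  "\<theta> \<in> carrier (essential_part (R_monoid C)) \<longleftrightarrow>
    essential_ideal C (dom \<theta>) \<and> essential_ideal C (ran \<theta>) \<and> bij_morphism C (dom \<theta>) (ran \<theta>) \<theta>"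
proof -
  have "\<theta> \<in> carrier (essential_part (R_monoid C)) \<longleftrightarrow> \<theta> \<in> carrier (R_monoid C) \<and>
      essential_ideal C (dom \<theta>) \<and> essential_ideal C (ran \<theta>)"
    unfolding essential_part_def
    by (auto simp: sinv_R_monoid inverse_map_comp R_monoid_inj essential_ident_on)
  then show ?thesis unfolding carrier_R_monoid essential_ideal_def by blast
qed

lemma essential_part_mult [simp]: "mult (essential_part (R_monoid C)) = (\<circ>\<^sub>m)"
  by (simp add: essential_part_def)

lemma essential_part_inj: "\<theta> \<in> carrier (essential_part (R_monoid C)) \<Longrightarrow> inj_on \<theta> (dom \<theta>)"
  unfolding carrier_essential_part using bij_morphismD(3) by blast

lemma essential_part_inverse:
  "\<theta> \<in> carrier (essential_part (R_monoid C)) \<Longrightarrow> inverse_map \<theta> \<in> carrier (essential_part (R_monoid C))"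
  using essential_part_inj[of \<theta> C] unfolding carrier_essential_part
  by (simp add: dom_inverse_map ran_inverse_map bij_morphism_inverse)

lemma nat_le_essential_part:
  assumes "\<theta> \<in> carrier (essential_part (R_monoid C))"
  shows "nat_le (essential_part (R_monoid C)) \<theta> \<theta>' \<longleftrightarrow> \<theta> \<subseteq>\<^sub>m \<theta>'"
proof -
  have "sinv (essential_part (R_monoid C)) \<theta> = inverse_map \<theta>"
    by (rule sinv_map) (simp_all add: essential_part_inj essential_part_inverse assms)
  then have "nat_le (essential_part (R_monoid C)) \<theta> \<theta>' \<longleftrightarrow> \<theta> = \<theta>' |` dom \<theta>"
    unfolding nat_le_def
    by (simp add: map_comp_assoc inverse_map_comp essential_part_inj[OF assms] comp_ident_on)
  also have "\<dots> \<longleftrightarrow> \<theta> \<subseteq>\<^sub>m \<theta>'"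
    by (auto simp: map_le_def restrict_map_def fun_eq_iff dom_def)
  finally show ?thesis .
qed

lemma sigma_essential_part:
  "(s, t) \<in> sigma (essential_part (R_monoid C)) \<longleftrightarrow>
    s \<in> carrier (essential_part (R_monoid C)) \<and> t \<in> carrier (essential_part (R_monoid C)) \<and>
    (\<exists>z \<in> carrier (essential_part (R_monoid C)). z \<subseteq>\<^sub>m s \<and> z \<subseteq>\<^sub>m t)"
  unfolding sigma_def using nat_le_essential_part by blast

lemma bij_morphism_comp:
  assumes "bij_morphism C R1 R2 \<theta>" "bij_morphism C R2 R3 \<theta>'"
  shows "bij_morphism C R1 R3 (\<theta>' \<circ>\<^sub>m \<theta>)"
proof (rule bij_morphismI)
  note D = bij_morphismD[OF assms(1)] and D' = bij_morphismD[OF assms(2)]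
  have comp: "(\<theta>' \<circ>\<^sub>m \<theta>) r = Some r'' \<longleftrightarrow> (\<exists>r'. \<theta> r = Some r' \<and> \<theta>' r' = Some r'')" for r r''
    by (auto simp: map_comp_def split: option.splits)
  have rd: "ran \<theta> = dom \<theta>'" using D D' by simp
  show "dom (\<theta>' \<circ>\<^sub>m \<theta>) = R1"
  proof -
    have "r \<in> dom (\<theta>' \<circ>\<^sub>m \<theta>) \<longleftrightarrow> r \<in> dom \<theta>" for r
      using comp[of r] rd unfolding dom_def ran_def by blast
    then show ?thesis using D(1) by blast
  qed
  show "ran (\<theta>' \<circ>\<^sub>m \<theta>) = R3"
  proof -
    have "r \<in> ran (\<theta>' \<circ>\<^sub>m \<theta>) \<longleftrightarrow> r \<in> ran \<theta>'" for r
      using comp[of _ r] rd unfolding dom_def ran_def by blast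
    then show ?thesis using D'(2) by blast
  qed
  show "inj_on (\<theta>' \<circ>\<^sub>m \<theta>) (dom (\<theta>' \<circ>\<^sub>m \<theta>))"
  proof (rule inj_onI)
    fix a b assume "a \<in> dom (\<theta>' \<circ>\<^sub>m \<theta>)" "b \<in> dom (\<theta>' \<circ>\<^sub>m \<theta>)" "(\<theta>' \<circ>\<^sub>m \<theta>) a = (\<theta>' \<circ>\<^sub>m \<theta>) b"
    then obtain c where "(\<theta>' \<circ>\<^sub>m \<theta>) a = Some c" "(\<theta>' \<circ>\<^sub>m \<theta>) b = Some c" by auto
    then show "a = b" using comp inj_on_domD[OF D(3)] inj_on_domD[OF D'(3)] by metis
  qed
  show "adom C r' = adom C r" if "(\<theta>' \<circ>\<^sub>m \<theta>) r = Some r'" for r r'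
    using that comp D(4) D'(4) by metis
  show "(\<theta>' \<circ>\<^sub>m \<theta>) (acomp C r c) = Some (acomp C r' c)"
    if "(\<theta>' \<circ>\<^sub>m \<theta>) r = Some r'" "c \<in> arrows C" "adom C r = acod C c" for r r' c
    using that comp D(4,5) D'(5) by metis
qed

lemma bij_morphism_restrict:
  assumes "bij_morphism C R1 R2 \<theta>" "right_ideal C R" "R \<subseteq> R1"
  shows "bij_morphism C R (ran (\<theta> |` R)) (\<theta> |` R)"
proof (rule bij_morphismI)
  note D = bij_morphismD[OF assms(1)]
  show "dom (\<theta> |` R) = R" using D(1) assms(3) by auto
  show "inj_on (\<theta> |` R) (dom (\<theta> |` R))"
    using inj_on_domD[OF D(3)] by (intro inj_onI) (auto simp: restrict_map_def split: if_splits)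
  show "adom C r' = adom C r" if "(\<theta> |` R) r = Some r'" for r r'
    using that D(4) by (auto simp: restrict_map_def split: if_splits)
  have "acomp C r c \<in> R" if "r \<in> R" "c \<in> arrows C" "adom C r = acod C c" for r c
    using that assms(2) unfolding right_ideal_def set_comp_def by blast
  then show "(\<theta> |` R) (acomp C r c) = Some (acomp C r' c)"
    if "(\<theta> |` R) r = Some r'" "c \<in> arrows C" "adom C r = acod C c" for r r' c
    using that D(5) by (auto simp: restrict_map_def split: if_splits)
qed simp

section \<open>The group of a labelling acts on the boundary\<close>

context labelled_alphabets
begin

abbreviation "T \<equiv> essential_part (R_monoid C)"

abbreviation generated_ideal :: "'x wordarrow set \<Rightarrow> (bit, 'x edge) path set set" where
  "generated_ideal A \<equiv> {arrow (c \<odot> u) | c u. c \<in> A \<and> u \<in> words}"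

lemma arrows_eq: "arrows C = arrow ` arr"
  by (simp add: arrows_C arr_def)

lemma arrow_in_arrows: "c \<in> arr \<Longrightarrow> arrow c \<in> arrows C"
  by (simp add: arrows_eq)

lemma arrow_eq_iff: "c \<in> arr \<Longrightarrow> d \<in> arr \<Longrightarrow> arrow c = arrow d \<longleftrightarrow> c = d"
  using arrow_inj unfolding arr_def by (auto dest: inj_onD)

lemma adom_arrow: "c \<in> arr \<Longrightarrow> adom C (arrow c) = arrow (source c, empty_word)"
  by (cases c) (auto simp: arr_def adom_C source_def)

lemma acod_arrow: "c \<in> arr \<Longrightarrow> acod C (arrow c) = arrow (fst c, empty_word)"
  by (cases c) (auto simp: arr_def acod_C)

lemma vertex_inj: "arrow (v, empty_word) = arrow (v', empty_word) \<longleftrightarrow> v = v'"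
  using arrow_eq_iff[of "(v, empty_word)" "(v', empty_word)"] by (auto simp: arr_def)

lemma composable_arrow: "c \<in> arr \<Longrightarrow> d \<in> arr \<Longrightarrow> adom C (arrow c) = acod C (arrow d) \<longleftrightarrow> fst d = source c"
  by (auto simp: adom_arrow acod_arrow vertex_inj)

lemma acomp_arrow: "c \<in> arr \<Longrightarrow> u \<in> words \<Longrightarrow> acomp C (arrow c) (arrow (source c, u)) = arrow (c \<odot> u)"
  by (cases c) (auto simp: arr_def acomp_C source_def extend_def)

lemma set_comp_arrow:
  assumes "A \<subseteq> arr"
  shows "set_comp C (arrow ` A) (arrows C) = generated_ideal A"
proof (intro equalityI subsetI)
  fix x assume "x \<in> set_comp C (arrow ` A) (arrows C)"
  then obtain c d where cd: "c \<in> A" "d \<in> arr" "x = acomp C (arrow c) (arrow d)" "adom C (arrow c) = acod C (arrow d)"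
    unfolding set_comp_def arrows_eq by blast
  then have "c \<in> arr" using assms by blast
  then have "d = (source c, snd d)" using cd composable_arrow by (simp add: prod_eq_iff)
  moreover have "snd d \<in> words" using cd by (auto simp: arr_def)
  ultimately have "x = arrow (c \<odot> snd d)" using acomp_arrow \<open>c \<in> arr\<close> cd by metis
  then show "x \<in> generated_ideal A" using cd \<open>snd d \<in> words\<close> by blast
next
  fix x assume "x \<in> generated_ideal A"
  then obtain c u where cu: "c \<in> A" "u \<in> words" "x = arrow (c \<odot> u)" by blast
  then have c: "c \<in> arr" using assms by blast
  have d: "(source c, u) \<in> arr" using cu by (simp add: arr_def)
  have "x = acomp C (arrow c) (arrow (source c, u))" "adom C (arrow c) = acod C (arrow (source c, u))"
    using acomp_arrow[OF c cu(2)] cu composable_arrow[OF c d] by simp_all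
  then show "x \<in> set_comp C (arrow ` A) (arrows C)"
    unfolding set_comp_def using cu(1) arrow_in_arrows[OF d] by blast
qed

lemma right_ideal_arrow: 
  "right_ideal C R \<longleftrightarrow> R \<subseteq> arrow ` arr \<and> (\<forall>c\<in>arr. \<forall>u\<in>words. arrow c \<in> R \<longrightarrow> arrow (c \<odot> u) \<in> R)"
proof -
  have "set_comp C R (arrows C) \<subseteq> R \<longleftrightarrow> (\<forall>c\<in>arr. \<forall>u\<in>words. arrow c \<in> R \<longrightarrow> arrow (c \<odot> u) \<in> R)"
    if "R \<subseteq> arrow ` arr"
  proof -
    define A where "A = {c \<in> arr. arrow c \<in> R}"
    have "R = arrow ` A" using that unfolding A_def by blast
    then have eq: "set_comp C R (arrows C) = generated_ideal A"
      using set_comp_arrow[of A] by (simp add: A_def)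
    show ?thesis unfolding eq by (auto simp: A_def)
  qed
  then show ?thesis unfolding right_ideal_def arrows_eq by blast
qed

lemma right_idealD: "right_ideal C R \<Longrightarrow> c \<in> arr \<Longrightarrow> u \<in> words \<Longrightarrow> arrow c \<in> R \<Longrightarrow> arrow (c \<odot> u) \<in> R"
  using right_ideal_arrow by blast

lemma fg_right_ideal_generated:
  assumes "finite A" "A \<subseteq> arr"
  shows "fg_right_ideal C (generated_ideal A)"
proof -
  let ?R = "generated_ideal A"
  have "right_ideal C ?R" unfolding right_ideal_arrow
  proof (intro conjI ballI impI)
    show "?R \<subseteq> arrow ` arr" using assms(2) by blast
    fix c u assume c: "c \<in> arr" "u \<in> words" "arrow c \<in> ?R"
    then obtain a v where a: "a \<in> A" "v \<in> words" "arrow c = arrow (a \<odot> v)" by blast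
    then have "c = a \<odot> v" using arrow_eq_iff c(1) assms(2) by blast
    then have "arrow (c \<odot> u) = arrow (a \<odot> (v \<cdot> u))" by (simp add: extend_extend)
    then show "arrow (c \<odot> u) \<in> ?R" using a c(2) by blast
  qed
  moreover have "arrow ` A \<subseteq> arrows C" using assms(2) arrows_eq by blast
  ultimately show ?thesis unfolding fg_right_ideal_def
    using set_comp_arrow[OF assms(2)] assms(1) by (intro conjI exI[of _ "arrow ` A"]) auto
qed

lemma fg_right_idealE:
  assumes "fg_right_ideal C R"
  obtains A where "finite A" "A \<subseteq> arr" "R = generated_ideal A"
proof -
  obtain Z where Z: "finite Z" "Z \<subseteq> arrow ` arr" "R = set_comp C Z (arrows C)"
    using assms unfolding fg_right_ideal_def arrows_eq by blast
  then obtain A where A: "A \<subseteq> arr" "finite A" "Z = arrow ` A"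
    using finite_subset_image by metis
  then show ?thesis using that[of A] Z set_comp_arrow by simp
qed

lemma fg_right_ideal_right: "fg_right_ideal C R \<Longrightarrow> right_ideal C R"
  by (simp add: fg_right_ideal_def)

lemma fg_arrow: "fg_right_ideal C R \<Longrightarrow> r \<in> R \<Longrightarrow> \<exists>c\<in>arr. r = arrow c"
  using fg_right_ideal_right right_ideal_arrow by blast

lemma fg_cone: "c \<in> arr \<Longrightarrow> fg_right_ideal C {arrow (c \<odot> u) | u. u \<in> words}"
proof -
  assume "c \<in> arr"
  then have "fg_right_ideal C {arrow (d \<odot> u) | d u. d \<in> {c} \<and> u \<in> words}"
    by (intro fg_right_ideal_generated) auto
  moreover have "{arrow (d \<odot> u) | d u. d \<in> {c} \<and> u \<in> words} = {arrow (c \<odot> u) | u. u \<in> words}" by blast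
  ultimately show ?thesis by simp
qed

lemma essential_idealI:
  assumes "fg_right_ideal C R" "\<And>c. c \<in> arr \<Longrightarrow> \<exists>u\<in>words. arrow (c \<odot> u) \<in> R"
  shows "essential_ideal C R"
  unfolding essential_ideal_def
proof (intro conjI allI impI)
  have "(0, empty_word) \<in> arr" by (simp add: arr_def)
  from assms(2)[OF this] show "R \<noteq> {}" by blast
  fix R' assume R': "fg_right_ideal C R'" "R' \<noteq> {}"
  then obtain c where c: "c \<in> arr" "arrow c \<in> R'" using fg_arrow by blast
  obtain u where u: "u \<in> words" "arrow (c \<odot> u) \<in> R" using assms(2)[OF c(1)] by blast
  then have "arrow (c \<odot> u) \<in> R'" using right_idealD[OF fg_right_ideal_right[OF R'(1)]] c by blast
  then show "R \<inter> R' \<noteq> {}" using u by blast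
qed (fact assms(1))

lemma essential_idealD:
  assumes "essential_ideal C R" "c \<in> arr"
  obtains u where "u \<in> words" "arrow (c \<odot> u) \<in> R"
proof -
  have "arrow (c \<odot> empty_word) \<in> {arrow (c \<odot> u) | u. u \<in> words}" by blast
  then have "R \<inter> {arrow (c \<odot> u) | u. u \<in> words} \<noteq> {}"
    using assms fg_cone unfolding essential_ideal_def by blast
  then show ?thesis using that by blast
qed

definition long_ideal :: "nat \<Rightarrow> (bit, 'x edge) path set set" where
  "long_ideal N = arrow ` {c \<in> arr. long N (snd c)}"

lemma long_ideal_iff: "c \<in> arr \<Longrightarrow> arrow c \<in> long_ideal N \<longleftrightarrow> long N (snd c)"
  unfolding long_ideal_def using arrow_eq_iff by blast

lemma long_ideal_mono: "M \<le> N \<Longrightarrow> long_ideal N \<subseteq> long_ideal M"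
  unfolding long_ideal_def using long_mono by blast

lemma long_cat1: "long M u \<Longrightarrow> long M (u \<cdot> v)"
  by (auto simp: long_def word_cat_def trans_le_add1)

lemma long_ideal_generated: "long_ideal N = generated_ideal (level_arrows N)"
proof (intro equalityI subsetI)
  fix r assume "r \<in> long_ideal N"
  then obtain c where c: "c \<in> arr" "long (N + 0) (snd c)" "r = arrow c" by (auto simp: long_ideal_def)
  obtain d u where "d \<in> level_arrows N" "u \<in> words" "c = d \<odot> u" using arr_split[OF c(1,2)] .
  then show "r \<in> generated_ideal (level_arrows N)" using c by blast
next
  fix r assume "r \<in> generated_ideal (level_arrows N)"
  then obtain c u where c: "c \<in> level_arrows N" "u \<in> words" "r = arrow (c \<odot> u)" by blast
  then have "c \<odot> u \<in> arr" "long N (snd (c \<odot> u))"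
    using level_arr level_long by (auto simp: extend_def long_cat1 arr_def level_words)
  then show "r \<in> long_ideal N" using c unfolding long_ideal_def by blast
qed

lemma fg_long_ideal: "fg_right_ideal C (long_ideal N)"
  unfolding long_ideal_generated
  by (rule fg_right_ideal_generated) (auto intro: finite_level_arrows level_arr)

lemma long_word_exists: "\<exists>u\<in>words. long N u"
  using boundary_nonempty take_level level_words level_long by blast

lemma essential_long_ideal: "essential_ideal C (long_ideal N)"
proof (rule essential_idealI[OF fg_long_ideal])
  fix c assume c: "c \<in> arr"
  obtain u where u: "u \<in> words" "long N u" using long_word_exists by blast
  then have "arrow (c \<odot> u) \<in> long_ideal N" using c by (subst long_ideal_iff) (auto simp: extend_def long_cat arr_def)
  then show "\<exists>u\<in>words. arrow (c \<odot> u) \<in> long_ideal N" using u by blast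
qed

text \<open>
  An arrow \<open>c\<close> that is longer than all generators of \<open>R\<close> has a multiple in common with some
  generator, and then that generator is a prefix of \<open>c\<close>.
\<close>

lemma essential_contains_long:
  assumes "essential_ideal C R"
  obtains N where "long_ideal N \<subseteq> R"
proof -
  have "fg_right_ideal C R" using assms by (simp add: essential_ideal_def)
  then obtain A where A: "finite A" "A \<subseteq> arr" "R = generated_ideal A"
    by (rule fg_right_idealE)
  obtain N where N: "\<And>c. c \<in> A \<Longrightarrow> short N (snd c)" using short_bound[OF A(1,2)] by blast
  have "long_ideal N \<subseteq> R"
  proof
    fix r assume "r \<in> long_ideal N"
    then obtain c where c: "c \<in> arr" "long N (snd c)" "r = arrow c" by (auto simp: long_ideal_def)
    obtain u where u: "u \<in> words" "arrow (c \<odot> u) \<in> R" using essential_idealD[OF assms c(1)] .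
    then obtain a v where a: "a \<in> A" "v \<in> words" "arrow (c \<odot> u) = arrow (a \<odot> v)" unfolding A(3) by blast
    then have "a \<in> arr" using A(2) by blast
    then have eq: "c \<odot> u = a \<odot> v" using a u c arrow_eq_iff by blast
    obtain \<omega> where "\<omega> \<in> boundary" using boundary_nonempty by blast
    have "act a (v \<triangleright> \<omega>) = act c (u \<triangleright> \<omega>)" using eq act_extend by metis
    then obtain u' where "u' \<in> words" "c = a \<odot> u'"
      using prefix_long[OF \<open>a \<in> arr\<close> c(1) _ N[OF a(1)] c(2)] by metis
    then show "r \<in> R" unfolding A(3) c(3) using a by blast
  qed
  then show ?thesis using that by blast
qed

definition induces :: "((bit, 'x edge) path set \<rightharpoonup> (bit, 'x edge) path set) \<Rightarrow>
    ('x point \<Rightarrow> 'x point) \<Rightarrow> bool" where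
  "induces \<theta> f \<longleftrightarrow> (\<forall>c\<in>arr. \<forall>c'\<in>arr. \<theta> (arrow c) = Some (arrow c') \<longrightarrow> replaces f c c')"

lemma T_dom: "\<theta> \<in> carrier T \<Longrightarrow> essential_ideal C (dom \<theta>)"
  and T_ran: "\<theta> \<in> carrier T \<Longrightarrow> essential_ideal C (ran \<theta>)"
  and T_bij: "\<theta> \<in> carrier T \<Longrightarrow> bij_morphism C (dom \<theta>) (ran \<theta>) \<theta>"
  by (simp_all add: carrier_essential_part)

lemma essential_fg: "essential_ideal C R \<Longrightarrow> fg_right_ideal C R"
  by (simp add: essential_ideal_def)

lemma T_value:
  assumes "\<theta> \<in> carrier T" "r \<in> dom \<theta>"
  obtains c' where "c' \<in> arr" "\<theta> r = Some (arrow c')"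
proof -
  obtain r' where r': "\<theta> r = Some r'" using assms(2) by blast
  then have "r' \<in> ran \<theta>" by (rule ranI)
  then obtain c' where "c' \<in> arr" "r' = arrow c'"
    using fg_arrow[OF essential_fg[OF T_ran[OF assms(1)]]] by blast
  then show ?thesis using that r' by blast
qed

lemma T_source:
  assumes "\<theta> \<in> carrier T" "c \<in> arr" "c' \<in> arr" "\<theta> (arrow c) = Some (arrow c')"
  shows "source c' = source c"
  using bij_morphismD(4)[OF T_bij[OF assms(1)] assms(4)] assms(2,3) by (simp add: adom_arrow vertex_inj)

lemma T_extend:
  assumes "\<theta> \<in> carrier T" "c \<in> arr" "c' \<in> arr" "\<theta> (arrow c) = Some (arrow c')" "u \<in> words"
  shows "\<theta> (arrow (c \<odot> u)) = Some (arrow (c' \<odot> u))"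
proof -
  have d: "(source c, u) \<in> arr" using assms(5) by (simp add: arr_def)
  have "\<theta> (acomp C (arrow c) (arrow (source c, u))) = Some (acomp C (arrow c') (arrow (source c, u)))"
    by (rule bij_morphismD(5)[OF T_bij[OF assms(1)] assms(4) arrow_in_arrows[OF d]])
      (simp add: composable_arrow[OF assms(2) d])
  then show ?thesis using acomp_arrow[OF assms(2,5)] acomp_arrow[OF assms(3,5)] T_source[OF assms(1-4)] by simp
qed

lemma T_long:
  assumes "\<theta> \<in> carrier T"
  obtains N where "\<And>c. c \<in> arr \<Longrightarrow> long N (snd c) \<Longrightarrow> \<exists>c'\<in>arr. \<theta> (arrow c) = Some (arrow c')"
proof -
  obtain N where N: "long_ideal N \<subseteq> dom \<theta>" using essential_contains_long[OF T_dom[OF assms]] .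
  show ?thesis
  proof (rule that[of N])
    fix c assume "c \<in> arr" "long N (snd c)"
    then have "arrow c \<in> dom \<theta>" using N long_ideal_iff by blast
    then obtain c' where "c' \<in> arr" "\<theta> (arrow c) = Some (arrow c')" by (rule T_value[OF assms])
    then show "\<exists>c'\<in>arr. \<theta> (arrow c) = Some (arrow c')" by blast
  qed
qed

text \<open>
  Two arrows that are prefixes of the same point have a common extension that is still a prefix of
  it, and \<open>\<theta>\<close> commutes with extensions.
\<close>

lemma T_consistent:
  assumes "\<theta> \<in> carrier T" "c \<in> arr" "c' \<in> arr" "\<theta> (arrow c) = Some (arrow c')"
    "d \<in> arr" "d' \<in> arr" "\<theta> (arrow d) = Some (arrow d')" 
    "\<omega> \<in> boundary" "\<omega>' \<in> boundary" "act c \<omega> = act d \<omega>'"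
  shows "act c' \<omega> = act d' \<omega>'"
proof -
  obtain N where N: "short N (snd c)" "short N (snd d)"
  proof -
    obtain N where "\<And>x. x \<in> {c, d} \<Longrightarrow> short N (snd x)"
      using short_bound[of "{c, d}"] assms(2,5) by blast
    then show ?thesis using that by blast
  qed
  obtain b \<omega>'' where b: "b \<in> level_arrows N" "b \<in> arr" "\<omega>'' \<in> boundary" "act c \<omega> = act b \<omega>''"
    using points_split[OF act_points[OF assms(2,8)]] by metis
  have lb: "long N (snd b)" using b(1) level_long by auto
  obtain u where u: "u \<in> words" "b = c \<odot> u" "\<omega> = u \<triangleright> \<omega>''"
    using prefix_long[OF assms(2) b(2) b(4) N(1) lb] .
  obtain v where v: "v \<in> words" "b = d \<odot> v" "\<omega>' = v \<triangleright> \<omega>''"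
    using prefix_long[OF assms(5) b(2) _ N(2) lb] b(4) assms(10) by metis
  have "Some (arrow (c' \<odot> u)) = Some (arrow (d' \<odot> v))"
    using T_extend[OF assms(1-4) u(1)] T_extend[OF assms(1,5-7) v(1)] u(2) v(2) by metis
  then have "c' \<odot> u = d' \<odot> v" using arrow_eq_iff assms u v by blast
  then show ?thesis unfolding u(3) v(3) by (metis act_extend)
qed

lemma T_inverse:
  assumes "\<theta> \<in> carrier T"
  shows "inverse_map \<theta> \<in> carrier T" "inverse_map \<theta> (arrow c') = Some (arrow c) \<longleftrightarrow> \<theta> (arrow c) = Some (arrow c')"
  using essential_part_inverse[OF assms] inverse_map_iff[OF essential_part_inj[OF assms]] by blast+

text \<open>
  The value at a point is computed with any prefix of it in the domain of \<open>\<theta>\<close>.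
\<close>

lemma T_function:
  assumes "\<theta> \<in> carrier T"
  shows "\<exists>f. (\<forall>x. x \<notin> points \<longrightarrow> f x = x) \<and> induces \<theta> f \<and> f ` points \<subseteq> points"
proof -
  obtain N where N: "\<And>c. c \<in> arr \<Longrightarrow> long N (snd c) \<Longrightarrow> \<exists>c'\<in>arr. \<theta> (arrow c) = Some (arrow c')"
    using T_long[OF assms] by blast
  have "\<exists>y. (x \<notin> points \<longrightarrow> y = x) \<and> (x \<in> points \<longrightarrow> y \<in> points \<and>
     (\<forall>d\<in>arr. \<forall>d'\<in>arr. \<forall>\<omega>\<in>boundary. \<theta> (arrow d) = Some (arrow d') \<longrightarrow> x = act d \<omega> \<longrightarrow> y = act d' \<omega>))" for x
  proof (cases "x \<in> points")
    case True
    then obtain c \<omega> where c: "c \<in> level_arrows N" "c \<in> arr" "\<omega> \<in> boundary" "x = act c \<omega>"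
      by (rule points_split)
    obtain c' where c': "c' \<in> arr" "\<theta> (arrow c) = Some (arrow c')" using N[OF c(2)] c(1) level_long by auto
    show ?thesis
    proof (intro exI conjI impI ballI)
      show "act c' \<omega> \<in> points" using c' c by blast
      fix d d' \<omega>' assume d: "d \<in> arr" "d' \<in> arr" "\<omega>' \<in> boundary" "\<theta> (arrow d) = Some (arrow d')" "x = act d \<omega>'"
      then have "act c \<omega> = act d \<omega>'" using c(4) by simp
      then show "act c' \<omega> = act d' \<omega>'"
        by (rule T_consistent[OF assms c(2) c' d(1,2,4) c(3) d(3)])
    qed (use True in blast)
  qed blast
  then obtain f where f: "\<And>x. (x \<notin> points \<longrightarrow> f x = x) \<and> (x \<in> points \<longrightarrow> f x \<in> points \<and>
     (\<forall>d\<in>arr. \<forall>d'\<in>arr. \<forall>\<omega>\<in>boundary. \<theta> (arrow d) = Some (arrow d') \<longrightarrow> x = act d \<omega> \<longrightarrow> f x = act d' \<omega>))"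
    by metis
  have "replaces f c c'" if "c \<in> arr" "c' \<in> arr" "\<theta> (arrow c) = Some (arrow c')" for c c'
    unfolding replaces_def using that T_source[OF assms that] f by (metis act_points)
  then have "induces \<theta> f" unfolding induces_def by blast
  then show ?thesis using f by (intro exI[of _ f]) blast
qed

lemma induces_inverse_comp:
  assumes "\<theta> \<in> carrier T" "induces \<theta> f" "induces (inverse_map \<theta>) g" "x \<in> points"
  shows "g (f x) = x"
proof -
  obtain N where N: "\<And>c. c \<in> arr \<Longrightarrow> long N (snd c) \<Longrightarrow> \<exists>c'\<in>arr. \<theta> (arrow c) = Some (arrow c')"
    using T_long[OF assms(1)] by blast
  obtain c \<omega> where c: "c \<in> level_arrows N" "c \<in> arr" "\<omega> \<in> boundary" "x = act c \<omega>"
    using assms(4) by (rule points_split)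
  obtain c' where c': "c' \<in> arr" "\<theta> (arrow c) = Some (arrow c')" using N[OF c(2)] c(1) level_long by auto
  have "replaces f c c'" using assms(2) c c' unfolding induces_def by blast
  moreover have "replaces g c' c"
    using assms(3) c c' T_inverse(2)[OF assms(1)] unfolding induces_def by blast
  ultimately show ?thesis using c replacesD(3) by metis
qed

lemma T_induces_H:
  assumes "\<theta> \<in> carrier T"
  obtains f where "f \<in> H" "induces \<theta> f"
proof -
  obtain f where f: "\<And>x. x \<notin> points \<Longrightarrow> f x = x" "induces \<theta> f" "f ` points \<subseteq> points"
    using T_function[OF assms] by blast
  obtain g where g: "\<And>x. x \<notin> points \<Longrightarrow> g x = x" "induces (inverse_map \<theta>) g" "g ` points \<subseteq> points"
    using T_function[OF T_inverse(1)[OF assms]] by blast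
  have "inverse_map (inverse_map \<theta>) = \<theta>"
  proof
    fix a
    have "inverse_map (inverse_map \<theta>) a = Some b \<longleftrightarrow> \<theta> a = Some b" for b
      using inverse_map_iff[OF essential_part_inj[OF T_inverse(1)[OF assms]]]
        inverse_map_iff[OF essential_part_inj[OF assms]] by simp
    then show "inverse_map (inverse_map \<theta>) a = \<theta> a" by (metis not_None_eq)
  qed
  then have "f (g x) = x" if "x \<in> points" for x
    using induces_inverse_comp[OF T_inverse(1)[OF assms] g(2) _ that] f(2) by simp
  moreover have "g (f x) = x" if "x \<in> points" for x
    using induces_inverse_comp[OF assms f(2) g(2) that] .
  ultimately have "bij_betw f points points"
    using f(3) g(3) by (intro bij_betw_byWitness[of _ g]) auto
  moreover have "locally_prefix points f"
  proof -
    obtain N where N: "\<And>c. c \<in> arr \<Longrightarrow> long N (snd c) \<Longrightarrow> \<exists>c'\<in>arr. \<theta> (arrow c) = Some (arrow c')"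
      using T_long[OF assms] by blast
    then show ?thesis using f(2) unfolding locally_prefix_def induces_def by meson
  qed
  ultimately have "f \<in> H" using f(1) by (simp add: H_def)
  then show ?thesis using that f(2) by blast
qed

lemma induces_unique:
  assumes "\<theta> \<in> carrier T" "induces \<theta> f" "induces \<theta> g" "f \<in> H" "g \<in> H"
  shows "f = g"
proof
  fix x show "f x = g x"
  proof (cases "x \<in> points")
    case False
    then show ?thesis using assms(4,5) unfolding H_def by (metis (mono_tags, lifting) mem_Collect_eq)
  next
    case True
    obtain N where N: "\<And>c. c \<in> arr \<Longrightarrow> long N (snd c) \<Longrightarrow> \<exists>c'\<in>arr. \<theta> (arrow c) = Some (arrow c')"
      using T_long[OF assms(1)] by blast
    obtain c \<omega> where c: "c \<in> level_arrows N" "c \<in> arr" "\<omega> \<in> boundary" "x = act c \<omega>"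
      using True by (rule points_split)
    obtain c' where c': "c' \<in> arr" "\<theta> (arrow c) = Some (arrow c')" using N[OF c(2)] c(1) level_long by auto
    have "replaces f c c'" "replaces g c c'" using assms(2,3) c c' unfolding induces_def by blast+
    then show ?thesis using c replacesD(3) by metis
  qed
qed

lemma induces_submap: "induces \<theta> f \<Longrightarrow> \<theta>' \<subseteq>\<^sub>m \<theta> \<Longrightarrow> induces \<theta>' f"
  unfolding induces_def map_le_def by (metis domI)

text \<open>
  The image is generated by the values of \<open>\<theta>\<close> at the generators.
\<close>

lemma fg_image:
  assumes "\<theta> \<in> carrier T" "fg_right_ideal C R" "R \<subseteq> dom \<theta>"
  shows "fg_right_ideal C (ran (\<theta> |` R))"
proof -
  obtain A where A: "finite A" "A \<subseteq> arr" "R = generated_ideal A"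
    using fg_right_idealE[OF assms(2)] .
  have "\<exists>c'. c' \<in> arr \<and> \<theta> (arrow c) = Some (arrow c')" if "c \<in> A" for c
  proof -
    have "arrow (c \<odot> empty_word) \<in> R" unfolding A(3) using that by blast
    then show ?thesis using T_value[OF assms(1)] assms(3) by (metis extend_empty subsetD)
  qed
  then obtain \<tau> where \<tau>: "\<And>c. c \<in> A \<Longrightarrow> \<tau> c \<in> arr \<and> \<theta> (arrow c) = Some (arrow (\<tau> c))" by metis
  have ext: "\<theta> (arrow (c \<odot> u)) = Some (arrow (\<tau> c \<odot> u))" if "c \<in> A" "u \<in> words" for c u
    using T_extend[OF assms(1) _ _ _ that(2)] \<tau>[OF that(1)] that A(2) by blast
  have "ran (\<theta> |` R) = generated_ideal (\<tau> ` A)"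
  proof (intro equalityI subsetI)
    fix y assume "y \<in> ran (\<theta> |` R)"
    then obtain x where "x \<in> R" "\<theta> x = Some y" by (auto simp: ran_def restrict_map_def split: if_splits)
    then obtain c u where "c \<in> A" "u \<in> words" "\<theta> (arrow (c \<odot> u)) = Some y" unfolding A(3) by blast
    then show "y \<in> generated_ideal (\<tau> ` A)" using ext by fastforce
  next
    fix y assume "y \<in> generated_ideal (\<tau> ` A)"
    then obtain c u where cu: "c \<in> A" "u \<in> words" "y = arrow (\<tau> c \<odot> u)" by blast
    have "arrow (c \<odot> u) \<in> R" unfolding A(3) using cu by blast
    then have "(\<theta> |` R) (arrow (c \<odot> u)) = Some y" using ext[OF cu(1,2)] cu(3) by (simp add: restrict_map_def)
    then show "y \<in> ran (\<theta> |` R)" by (rule ranI)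
  qed
  moreover have "\<tau> ` A \<subseteq> arr" using \<tau> by blast
  ultimately show ?thesis using fg_right_ideal_generated[of "\<tau> ` A"] A(1) by simp
qed

text \<open>
  The range stays essential: an extension of a given arrow that is a value of \<open>\<theta>\<close> at some \<open>b\<close> can be
  extended further so that \<open>b\<close> enters \<open>R\<close>.
\<close>

lemma T_restrict:
  assumes "\<theta> \<in> carrier T" "essential_ideal C R" "R \<subseteq> dom \<theta>"
  shows "\<theta> |` R \<in> carrier T"
proof -
  have fg: "fg_right_ideal C R" using essential_fg[OF assms(2)] .
  have dom: "dom (\<theta> |` R) = R" using assms(3) by auto
  have "essential_ideal C (ran (\<theta> |` R))"
  proof (rule essential_idealI[OF fg_image[OF assms(1) fg assms(3)]])
    fix c assume c: "c \<in> arr"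
    obtain u where u: "u \<in> words" "arrow (c \<odot> u) \<in> ran \<theta>"
      using essential_idealD[OF T_ran[OF assms(1)] c] .
    then obtain a where a: "\<theta> a = Some (arrow (c \<odot> u))" by (auto simp: ran_def)
    then obtain b where b: "b \<in> arr" "a = arrow b"
      using fg_arrow[OF essential_fg[OF T_dom[OF assms(1)]]] by blast
    obtain v where v: "v \<in> words" "arrow (b \<odot> v) \<in> R" using essential_idealD[OF assms(2) b(1)] .
    have "\<theta> (arrow (b \<odot> v)) = Some (arrow (c \<odot> u \<odot> v))"
      using T_extend[OF assms(1) b(1) _ _ v(1)] a b(2) c u(1) by blast
    then have "(\<theta> |` R) (arrow (b \<odot> v)) = Some (arrow (c \<odot> (u \<cdot> v)))"
      using v(2) by (simp add: restrict_map_def extend_extend)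
    then have "arrow (c \<odot> (u \<cdot> v)) \<in> ran (\<theta> |` R)" by (rule ranI)
    then show "\<exists>u\<in>words. arrow (c \<odot> u) \<in> ran (\<theta> |` R)" using u(1) v(1) by blast
  qed
  moreover have "bij_morphism C R (ran (\<theta> |` R)) (\<theta> |` R)"
    using bij_morphism_restrict[OF T_bij[OF assms(1)] fg_right_ideal_right[OF fg] assms(3)] .
  ultimately show ?thesis unfolding carrier_essential_part dom using assms(2) by blast
qed

lemma restrict_le: "\<theta> |` R \<subseteq>\<^sub>m \<theta>"
  by (auto simp: map_le_def restrict_map_def split: if_splits)

text \<open>
  Two bijective morphisms with the same action agree on all sufficiently long arrows, because the
  action is faithful. The restriction to these arrows is a common lower bound.
\<close>

lemma induces_same_iff_sigma:
  assumes "s \<in> carrier T" "t \<in> carrier T" "f \<in> H" "induces s f"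
  shows "(s, t) \<in> sigma T \<longleftrightarrow> induces t f"
proof
  assume "(s, t) \<in> sigma T"
  then obtain z where z: "z \<in> carrier T" "z \<subseteq>\<^sub>m s" "z \<subseteq>\<^sub>m t" unfolding sigma_essential_part by blast
  obtain g where g: "g \<in> H" "induces t g" using T_induces_H[OF assms(2)] .
  have "f = g"
    using induces_unique[OF z(1)] induces_submap z g assms by blast
  then show "induces t f" using g by simp
next
  assume t: "induces t f"
  obtain N where N: "long_ideal N \<subseteq> dom s" using essential_contains_long[OF T_dom[OF assms(1)]] .
  obtain M where M: "long_ideal M \<subseteq> dom t" using essential_contains_long[OF T_dom[OF assms(2)]] .
  let ?I = "long_ideal (max N M)"
  have sub: "?I \<subseteq> dom s" "?I \<subseteq> dom t" using N M long_ideal_mono by (meson max.cobounded1 max.cobounded2 order_trans)+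
  have z: "s |` ?I \<in> carrier T" using T_restrict[OF assms(1) essential_long_ideal sub(1)] .
  have "s r = t r" if r: "r \<in> ?I" for r
  proof -
    obtain c where c: "c \<in> arr" "r = arrow c" using r unfolding long_ideal_def by blast
    obtain c1 where c1: "c1 \<in> arr" "s r = Some (arrow c1)" using T_value[OF assms(1)] sub(1) r by blast
    obtain c2 where c2: "c2 \<in> arr" "t r = Some (arrow c2)" using T_value[OF assms(2)] sub(2) r by blast
    have "replaces f c c1" "replaces f c c2" using c c1 c2 assms(4) t unfolding induces_def by blast+
    then have "c1 = c2" by (rule replaces_unique)
    then show ?thesis using c1 c2 by simp
  qed
  then have "s |` ?I \<subseteq>\<^sub>m t" by (auto simp: map_le_def restrict_map_def split: if_splits)
  then show "(s, t) \<in> sigma T" unfolding sigma_essential_part using assms(1,2) z restrict_le by blast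
qed

text \<open>
  On long arrows \<open>c\<close>, let \<open>\<tau> c\<close> be the unique arrow by which \<open>f\<close> replaces \<open>c\<close>. Uniqueness makes
  \<open>\<tau>\<close> compatible with extensions. The ideal generated by its values is essential because \<open>f\<close> is
  surjective.
\<close>

lemma H_induced:
  assumes "f \<in> H"
  obtains \<theta> where "\<theta> \<in> carrier T" "induces \<theta> f"
proof -
  obtain N where N: "\<And>c. c \<in> arr \<Longrightarrow> long N (snd c) \<Longrightarrow> \<exists>c'. replaces f c c' \<and> long 0 (snd c')"
    using H_replaces[OF assms] by blast
  then have "\<exists>c'. c \<in> arr \<and> long N (snd c) \<longrightarrow> replaces f c c'" for c by blast
  then obtain \<tau> where \<tau>: "\<And>c. c \<in> arr \<Longrightarrow> long N (snd c) \<Longrightarrow> replaces f c (\<tau> c)" by metis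
  define \<theta> where "\<theta> r = (if r \<in> long_ideal N then Some (arrow (\<tau> (the_inv_into arr arrow r))) else None)" for r
  have inv: "the_inv_into arr arrow (arrow c) = c" if "c \<in> arr" for c
    using that arrow_eq_iff by (intro the_inv_into_f_f) (auto simp: inj_on_def)
  have \<theta>: "\<theta> (arrow c) = Some (arrow (\<tau> c))" if "c \<in> arr" "long N (snd c)" for c
    using that inv long_ideal_iff by (simp add: \<theta>_def)
  have \<theta>D: "\<exists>c. c \<in> arr \<and> long N (snd c) \<and> r = arrow c \<and> r' = arrow (\<tau> c)" if "\<theta> r = Some r'" for r r'
  proof -
    have "r \<in> long_ideal N" using that by (auto simp: \<theta>_def split: if_splits)
    then obtain c where "c \<in> arr" "long N (snd c)" "r = arrow c" unfolding long_ideal_def by blast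
    then show ?thesis using that \<theta>[of c] by (intro exI[of _ c]) simp
  qed
  have \<tau>arr: "\<tau> c \<in> arr" if "c \<in> arr" "long N (snd c)" for c using \<tau>[OF that] replacesD(1) by blast
  have \<tau>ext: "\<tau> (c \<odot> u) = \<tau> c \<odot> u" if c: "c \<in> arr" "long N (snd c)" "u \<in> words" for c u
  proof -
    have "long N (snd (c \<odot> u))" using c by (simp add: extend_def long_cat1)
    then show ?thesis using replaces_unique \<tau> replaces_extend c arr_extend by metis
  qed
  have dom: "dom \<theta> = long_ideal N" by (auto simp: \<theta>_def dom_def)
  have inj: "f x = f y \<longleftrightarrow> x = y" for x y using H_bij[OF assms] by (simp add: bij_is_inj inj_eq)
  have bm: "bij_morphism C (long_ideal N) (ran \<theta>) \<theta>"
  proof (rule bij_morphismI)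
    show "inj_on \<theta> (dom \<theta>)"
    proof (rule inj_onI)
      fix r r' assume "r \<in> dom \<theta>" "r' \<in> dom \<theta>" and eq: "\<theta> r = \<theta> r'"
      then obtain c d where c: "c \<in> arr" "long N (snd c)" "r = arrow c"
        and d: "d \<in> arr" "long N (snd d)" "r' = arrow d" unfolding dom long_ideal_def by blast
      then have "\<tau> c = \<tau> d" using eq \<theta> \<tau>arr arrow_eq_iff by simp
      then have "replaces f c (\<tau> c)" "replaces f d (\<tau> c)" using \<tau> c d by metis+
      then have "f (act c \<omega>) = f (act d \<omega>)" if "\<omega> \<in> boundary" for \<omega>
        using that replacesD(3) by metis
      then have "act c \<omega> = act d \<omega>" if "\<omega> \<in> boundary" for \<omega> using that inj by blast
      then show "r = r'" using faithful c d by metis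
    qed
    fix r r' assume rr: "\<theta> r = Some r'"
    then obtain c where c: "c \<in> arr" "long N (snd c)" "r = arrow c" "r' = arrow (\<tau> c)" using \<theta>D by blast
    have src: "source (\<tau> c) = source c" using \<tau>[OF c(1,2)] replacesD(2) by blast
    show "adom C r' = adom C r" using c \<tau>arr src by (simp add: adom_arrow)
    fix x assume x: "x \<in> arrows C" "adom C r = acod C x"
    then obtain d where d: "d \<in> arr" "x = arrow d" by (auto simp: arrows_eq)
    then have "d = (source c, snd d)" "snd d \<in> words"
      using x(2) c composable_arrow by (auto simp: prod_eq_iff arr_def)
    then have "acomp C r x = arrow (c \<odot> snd d)" "acomp C r' x = arrow (\<tau> c \<odot> snd d)"
      using acomp_arrow c d \<tau>arr src by metis+
    moreover have "long N (snd (c \<odot> snd d))" using c by (simp add: extend_def long_cat1)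
    ultimately show "\<theta> (acomp C r x) = Some (acomp C r' x)"
      using \<theta>[of "c \<odot> snd d"] \<tau>ext[OF c(1,2)] c \<open>snd d \<in> words\<close> arr_extend by simp
  qed (simp_all add: dom)
  have ran: "ran \<theta> = generated_ideal (\<tau> ` (level_arrows N))"
  proof (intro equalityI subsetI)
    fix y assume "y \<in> ran \<theta>"
    then obtain r where "\<theta> r = Some y" by (auto simp: ran_def)
    then obtain c where c: "c \<in> arr" "long (N + 0) (snd c)" "y = arrow (\<tau> c)"
      using \<theta>D by (metis add_0_right)
    obtain d u where d: "d \<in> level_arrows N" "u \<in> words" "c = d \<odot> u" using arr_split[OF c(1,2)] .
    have "d \<in> arr" "long N (snd d)" using d level_arr level_long by auto
    then have "y = arrow (\<tau> d \<odot> u)" using c d \<tau>ext by simp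
    then show "y \<in> generated_ideal (\<tau> ` (level_arrows N))" using d by blast
  next
    fix y assume "y \<in> generated_ideal (\<tau> ` (level_arrows N))"
    then obtain d u where d: "d \<in> level_arrows N" "u \<in> words" "y = arrow (\<tau> d \<odot> u)" by blast
    have d': "d \<in> arr" "long N (snd d)" using d level_arr level_long by auto
    have "long N (snd (d \<odot> u))" using d' by (simp add: extend_def long_cat1)
    then have "\<theta> (arrow (d \<odot> u)) = Some y" using \<theta>[of "d \<odot> u"] d d' \<tau>ext arr_extend by simp
    then show "y \<in> ran \<theta>" by (rule ranI)
  qed
  have im: "\<tau> ` (level_arrows N) \<subseteq> arr"
  proof (intro image_subsetI)
    fix c assume "c \<in> level_arrows N"
    then have "c \<in> arr" "long N (snd c)" using level_arr level_long by auto
    then show "\<tau> c \<in> arr" by (rule \<tau>arr)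
  qed
  have fin: "finite (\<tau> ` (level_arrows N))" by (intro finite_imageI finite_level_arrows)
  have "fg_right_ideal C (ran \<theta>)" unfolding ran
  proof (rule fg_right_ideal_generated)
    show "\<tau> ` (level_arrows N) \<subseteq> arr" by (rule im)
  qed (intro finite_imageI finite_level_arrows)
  then have "essential_ideal C (ran \<theta>)"
  proof (rule essential_idealI)
    fix c assume c: "c \<in> arr"
    \<comment> \<open>If \<open>c u\<close> is longer than all generators of the range, then any generator whose cylinder meets that of \<open>c u\<close> is a prefix of \<open>c u\<close>.\<close>
    obtain M where M: "\<And>d. d \<in> \<tau> ` (level_arrows N) \<Longrightarrow> short M (snd d)"
      using short_bound[OF fin im] by blast
    obtain u where u: "u \<in> words" "long M u" using long_word_exists by blast
    obtain \<omega> where \<omega>: "\<omega> \<in> boundary" using boundary_nonempty by blast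
    have cu: "c \<odot> u \<in> arr" "long M (snd (c \<odot> u))" using c u by (auto simp: extend_def long_cat arr_def)
    have "act (c \<odot> u) \<omega> \<in> points" using cu(1) \<omega> by (rule act_points)
    then have "act (c \<odot> u) \<omega> \<in> f ` points" using assms by (auto simp: H_def bij_betw_def)
    then obtain x where x: "x \<in> points" "act (c \<odot> u) \<omega> = f x" by blast
    obtain d \<omega>' where d: "d \<in> level_arrows N" "d \<in> arr" "\<omega>' \<in> boundary" "x = act d \<omega>'"
      using x(1) by (rule points_split)
    have dl: "long N (snd d)" using d(1) level_long by auto
    have eq: "act (\<tau> d) \<omega>' = act (c \<odot> u) \<omega>" using x(2) d replacesD(3)[OF \<tau>[OF d(2) dl] d(3)] by simp
    have "short M (snd (\<tau> d))" using M d(1) by blast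
    then obtain v where v: "v \<in> words" "c \<odot> u = \<tau> d \<odot> v"
      using prefix_long[OF \<tau>arr[OF d(2) dl] cu(1) eq _ cu(2)] by metis
    have "\<tau> d \<in> \<tau> ` (level_arrows N)" using d(1) by (rule imageI)
    then have "arrow (c \<odot> u) \<in> ran \<theta>" unfolding ran v(2) using v(1) by blast
    then show "\<exists>u\<in>words. arrow (c \<odot> u) \<in> ran \<theta>" using u by blast
  qed
  then have "\<theta> \<in> carrier T" unfolding carrier_essential_part dom using bm essential_long_ideal by blast
  moreover have "induces \<theta> f"
    unfolding induces_def using \<theta>D \<tau> arrow_eq_iff \<tau>arr by metis
  ultimately show ?thesis using that by blast
qed

lemma map_comp_restrict_ran: "s \<circ>\<^sub>m t = (s |` ran t) \<circ>\<^sub>m t"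
proof
  fix a show "(s \<circ>\<^sub>m t) a = ((s |` ran t) \<circ>\<^sub>m t) a"
    by (cases "t a") (simp_all add: map_comp_def restrict_map_def ranI)
qed

lemma induces_comp:
  assumes "s \<in> carrier T" "t \<in> carrier T" "induces s f" "induces t g"
  shows "induces (s \<circ>\<^sub>m t) (f \<circ> g)"
  unfolding induces_def
proof (intro ballI impI)
  fix c c' assume c: "c \<in> arr" "c' \<in> arr" "(s \<circ>\<^sub>m t) (arrow c) = Some (arrow c')"
  then obtain r where r: "t (arrow c) = Some r" "s r = Some (arrow c')"
    by (auto simp: map_comp_def split: option.splits)
  have "arrow c \<in> dom t" using r by blast
  then obtain d where "d \<in> arr" "r = arrow d" using T_value[OF assms(2)] r by (metis option.sel)
  then show "replaces (f \<circ> g) c c'"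
    using c r assms(3,4) replaces_comp unfolding induces_def by blast
qed

text \<open>
  The class modulo \<open>\<sigma>\<close> that corresponds to \<open>f\<close>.
\<close>

definition germ_class ::
  "('x point \<Rightarrow> 'x point) \<Rightarrow>
   ((bit, 'x edge) path set \<rightharpoonup> (bit, 'x edge) path set) set" where
  "germ_class f = {\<theta> \<in> carrier T. induces \<theta> f}"

lemma germ_class_eq:
  assumes "f \<in> H" "s \<in> germ_class f"
  shows "sigma T `` {s} = germ_class f"
proof -
  have s: "s \<in> carrier T" "induces s f" using assms(2) by (auto simp: germ_class_def)
  have "(s, t) \<in> sigma T \<longleftrightarrow> t \<in> germ_class f" for t
    using induces_same_iff_sigma[OF s(1) _ assms(1) s(2), of t] unfolding germ_class_def
    by (auto simp: sigma_essential_part)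
  then show ?thesis by blast
qed

lemma germ_class_nonempty: "f \<in> H \<Longrightarrow> \<exists>s. s \<in> germ_class f"
  using H_induced[of f] unfolding germ_class_def by blast

text \<open>
  The product of two classes is computed with representatives that compose: if the second factor is
  restricted to sufficiently long arrows, its range lies in the domain of the first one.
\<close>

lemma germ_class_mult:
  assumes f: "f \<in> H" and g: "g \<in> H"
  shows "germ_class (f \<circ> g) = sigma T `` {s \<circ>\<^sub>m t | s t. s \<in> germ_class f \<and> t \<in> germ_class g}"
proof -
  have fg: "f \<circ> g \<in> H" using comp_H[OF f g] .
  let ?P = "{s \<circ>\<^sub>m t | s t. s \<in> germ_class f \<and> t \<in> germ_class g}"
  have sub: "sigma T `` {r} = germ_class (f \<circ> g)" if "r \<in> ?P" "r \<in> carrier T" for r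
  proof -
    have "induces r (f \<circ> g)" using that(1) induces_comp unfolding germ_class_def by blast
    then show ?thesis using germ_class_eq[OF fg] that(2) unfolding germ_class_def by blast
  qed
  have "\<exists>r\<in>?P. r \<in> carrier T"
  proof -
    obtain s where s: "s \<in> germ_class f" using germ_class_nonempty[OF f] by blast
    then have sT: "s \<in> carrier T" "induces s f" by (auto simp: germ_class_def)
    obtain t where t: "t \<in> germ_class g" using germ_class_nonempty[OF g] by blast
    then have tT: "t \<in> carrier T" "induces t g" by (auto simp: germ_class_def)
    obtain M where M: "long_ideal M \<subseteq> dom s" using essential_contains_long[OF T_dom[OF sT(1)]] .
    obtain N where N: "long_ideal N \<subseteq> dom t" using essential_contains_long[OF T_dom[OF tT(1)]] .
    \<comment> \<open>The first \<open>N\<close> letters put an arrow into the domain of \<open>t\<close>, the last \<open>M\<close> put its image into that of \<open>s\<close>.\<close>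
    let ?I = "long_ideal (N + M)"
    let ?t = "t |` ?I"
    have I: "?I \<subseteq> dom t" using N long_ideal_mono[of N "N + M"] by auto
    have t': "?t \<in> carrier T" using T_restrict[OF tT(1) essential_long_ideal I] .
    have ran: "ran ?t \<subseteq> dom s"
    proof
      fix y assume "y \<in> ran ?t"
      then obtain c where c: "c \<in> arr" "long (N + M) (snd c)" "t (arrow c) = Some y"
        by (auto simp: ran_def restrict_map_def long_ideal_def split: if_splits)
      obtain d u where d: "d \<in> level_arrows N" "u \<in> words" "c = d \<odot> u" "long M u"
        using arr_split[OF c(1,2)] .
      have d': "d \<in> arr" "long N (snd d)" using d level_arr level_long by auto
      then have "arrow d \<in> dom t" using N long_ideal_iff by blast
      then obtain d1 where d1: "d1 \<in> arr" "t (arrow d) = Some (arrow d1)" by (rule T_value[OF tT(1)])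
      have "y = arrow (d1 \<odot> u)" using T_extend[OF tT(1) d'(1) d1 d(2)] c d by simp
      moreover have "arrow (d1 \<odot> u) \<in> long_ideal M"
        using d d1 by (subst long_ideal_iff) (auto simp: extend_def long_cat arr_def)
      ultimately show "y \<in> dom s" using M by blast
    qed
    let ?s = "s |` ran ?t"
    have s': "?s \<in> carrier T" using T_restrict[OF sT(1) T_ran[OF t'] ran] .
    have ds: "dom ?s = ran ?t" using ran by auto
    have eq: "s \<circ>\<^sub>m ?t = ?s \<circ>\<^sub>m ?t"
      by (rule map_comp_restrict_ran)
    have bm: "bij_morphism C (dom ?t) (ran ?s) (s \<circ>\<^sub>m ?t)"
    proof -
      have "bij_morphism C (ran ?t) (ran ?s) ?s" using T_bij[OF s'] unfolding ds .
      from bij_morphism_comp[OF T_bij[OF t'] this] show ?thesis unfolding eq .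
    qed
    have "dom (s \<circ>\<^sub>m ?t) = dom ?t" "ran (s \<circ>\<^sub>m ?t) = ran ?s"
      by (rule bij_morphismD(1)[OF bm], rule bij_morphismD(2)[OF bm])
    then have "s \<circ>\<^sub>m ?t \<in> carrier T"
      using bm T_dom[OF t'] T_ran[OF s'] unfolding carrier_essential_part by (simp only:)
    moreover have "?t \<in> germ_class g"
      using t' induces_submap[OF tT(2) restrict_le] unfolding germ_class_def by blast
    ultimately show ?thesis using s by blast
  qed
  then obtain r where r: "r \<in> ?P" "r \<in> carrier T" by blast
  show ?thesis
  proof (intro equalityI subsetI)
    fix z assume "z \<in> germ_class (f \<circ> g)"
    then show "z \<in> sigma T `` ?P" using sub[OF r] r(1) by blast
  next
    fix z assume "z \<in> sigma T `` ?P"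
    then obtain q where q: "q \<in> ?P" "(q, z) \<in> sigma T" by blast
    then have "q \<in> carrier T" unfolding sigma_essential_part by blast
    then show "z \<in> germ_class (f \<circ> g)" using sub[OF q(1)] q(2) by blast
  qed
qed

lemma germ_class_iso: "germ_class \<in> iso H_group (G_group C)"
proof -
  have carr: "carrier (G_group C) = carrier T // sigma T"
    by (simp add: G_group_def sigma_quotient_def)
  have mult: "A \<otimes>\<^bsub>G_group C\<^esub> B = sigma T `` {a \<circ>\<^sub>m b | a b. a \<in> A \<and> b \<in> B}" for A B
    by (simp add: G_group_def sigma_quotient_def)
  have im: "germ_class ` H = carrier T // sigma T"
  proof (intro equalityI subsetI)
    fix A assume "A \<in> germ_class ` H"
    then obtain f where f: "f \<in> H" "A = germ_class f" by blast
    then obtain s where "s \<in> germ_class f" using germ_class_nonempty by blast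
    then show "A \<in> carrier T // sigma T"
      using germ_class_eq f unfolding germ_class_def quotient_def by blast
  next
    fix A assume "A \<in> carrier T // sigma T"
    then obtain s where s: "s \<in> carrier T" "A = sigma T `` {s}" by (auto simp: quotient_def)
    obtain f where f: "f \<in> H" "induces s f" using T_induces_H[OF s(1)] .
    then have "A = germ_class f" using germ_class_eq s unfolding germ_class_def by blast
    then show "A \<in> germ_class ` H" using f by blast
  qed
  have "inj_on germ_class H"
  proof (rule inj_onI)
    fix f g assume f: "f \<in> H" "g \<in> H" "germ_class f = germ_class g"
    then obtain s where "s \<in> germ_class f" "s \<in> germ_class g" using germ_class_nonempty by blast
    then show "f = g" using induces_unique f unfolding germ_class_def by blast
  qed
  then show ?thesis
    unfolding iso_def hom_def bij_betw_def using im germ_class_mult by (auto simp: carr mult)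
qed

end

section \<open>Partitions into cylinders\<close>

context labelled_alphabets
begin

definition cyl_partition :: "'x wordarrow set \<Rightarrow>
    'x point set \<Rightarrow> bool" where
  "cyl_partition A U \<longleftrightarrow> finite A \<and> A \<subseteq> arr \<and>
    (\<forall>c\<in>A. \<forall>d\<in>A. c \<noteq> d \<longrightarrow> cyl c \<inter> cyl d = {}) \<and> U = \<Union>(cyl ` A)"

lemma cyl_partitionD:
  assumes "cyl_partition A U"
  shows "finite A" "A \<subseteq> arr" "U = \<Union>(cyl ` A)" "c \<in> A \<Longrightarrow> d \<in> A \<Longrightarrow> x \<in> cyl c \<Longrightarrow> x \<in> cyl d \<Longrightarrow> c = d"
  using assms unfolding cyl_partition_def by blast+

lemma cyl_partition_unique:
  assumes "cyl_partition A U" "c \<in> A" "d \<in> A" "\<omega> \<in> boundary" "\<omega>' \<in> boundary" "act c \<omega> = act d \<omega>'"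
  shows "c = d \<and> \<omega> = \<omega>'"
proof -
  have "act c \<omega> \<in> cyl c" "act c \<omega> \<in> cyl d" using assms(4-6) unfolding cyl_def by blast+
  then have "c = d" using cyl_partitionD(4)[OF assms(1-3)] by blast
  then show ?thesis using assms(6) act_inj by blast
qed

lemma words_of_length_disjoint:
  assumes "u \<in> words_of_length len" "v \<in> words_of_length len" "u \<triangleright> \<omega> = v \<triangleright> \<omega>'"
  shows "u = v"
proof -
  have uv: "u \<in> words" "v \<in> words" "\<And>i. i \<in> colours \<Longrightarrow> length (u i) = length (v i)"
    using assms by (auto simp: words_of_length_def)
  obtain w where w: "w \<in> words" "v = u \<cdot> w" 
    by (rule prefix_words[OF uv(1,2) assms(3)]) (use uv in auto)
  have "w i = []" for i
    using uv(3)[of i] words_outside[OF w(1), of i] w(2) by (cases "i \<in> colours") (auto simp: word_cat_def)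
  then have "w = empty_word" by (auto simp: empty_word_def)
  then show ?thesis using w by simp
qed

lemma words_of_length_prefix:
  assumes "\<omega> \<in> boundary"
  obtains u \<omega>' where "u \<in> words_of_length len" "\<omega>' \<in> boundary" "\<omega> = u \<triangleright> \<omega>'"
proof -
  define u where "u = (\<lambda>i. if i \<in> colours then stake (len i) (\<omega> i) else [])"
  define \<omega>' where "\<omega>' = (\<lambda>i. if i \<in> colours then sdrop (len i) (\<omega> i) else \<omega> i)"
  have eq: "\<omega> = u \<triangleright> \<omega>'" by (auto simp: u_def \<omega>'_def shift_word_def stake_sdrop)
  have ss: "sset (\<omega> i) = set (u i) \<union> sset (\<omega>' i)" for i
    unfolding eq by (simp add: shift_word_def)
  have "u \<in> words_of_length len"
  proof -
    have "set (u i) \<subseteq> Y i" for i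
      using ss[of i] assms by (cases "i \<in> colours") (auto simp: boundary_def u_def)
    then show ?thesis by (auto simp: words_of_length_def words_def u_def)
  qed
  moreover have "\<omega>' \<in> boundary" using ss assms by (fastforce simp: boundary_def)
  ultimately show ?thesis using that eq by blast
qed

lemma words_of_length_words: "u \<in> words_of_length len \<Longrightarrow> u \<in> words"
  by (simp add: words_of_length_def)

lemma extend_inj: "c \<odot> u = c \<odot> v \<longleftrightarrow> u = v"
  by (auto simp: extend_def word_cat_def fun_eq_iff)

lemma cyl_partition_extend:
  assumes "c \<in> arr"
  shows "cyl_partition ((\<odot>) c ` words_of_length len) (cyl c)"
  unfolding cyl_partition_def
proof (intro conjI)
  show "finite ((\<odot>) c ` words_of_length len)" by (intro finite_imageI finite_words_of_length)
  show "(\<odot>) c ` words_of_length len \<subseteq> arr" using assms words_of_length_words by blast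
  show "\<forall>d\<in>(\<odot>) c ` words_of_length len. \<forall>d'\<in>(\<odot>) c ` words_of_length len. d \<noteq> d' \<longrightarrow> cyl d \<inter> cyl d' = {}"
  proof (intro ballI impI)
    fix d d' assume "d \<in> (\<odot>) c ` words_of_length len" "d' \<in> (\<odot>) c ` words_of_length len" "d \<noteq> d'"
    then obtain u v where uv: "u \<in> words_of_length len" "v \<in> words_of_length len" "d = c \<odot> u" "d' = c \<odot> v" "u \<noteq> v"
      by blast
    show "cyl d \<inter> cyl d' = {}"
    proof (rule ccontr)
      assume "cyl d \<inter> cyl d' \<noteq> {}"
      then obtain \<omega> \<omega>' where "act d \<omega> = act d' \<omega>'" unfolding cyl_def by blast
      then have "u \<triangleright> \<omega> = v \<triangleright> \<omega>'" using uv act_inj by simp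
      then show False using words_of_length_disjoint uv by blast
    qed
  qed
  show "cyl c = \<Union>(cyl ` (\<odot>) c ` words_of_length len)"
  proof (intro equalityI subsetI)
    fix x assume "x \<in> cyl c"
    then obtain \<omega> where \<omega>: "\<omega> \<in> boundary" "x = act c \<omega>" by (auto simp: cyl_def)
    obtain u \<omega>' where u: "u \<in> words_of_length len" "\<omega>' \<in> boundary" "\<omega> = u \<triangleright> \<omega>'"
      using words_of_length_prefix[OF \<omega>(1)] .
    then have "x \<in> cyl (c \<odot> u)" using \<omega> by (simp add: cyl_def)
    then show "x \<in> \<Union>(cyl ` (\<odot>) c ` words_of_length len)" using u by blast
  next
    fix x assume "x \<in> \<Union>(cyl ` (\<odot>) c ` words_of_length len)"
    then show "x \<in> cyl c" using cyl_extend words_of_length_words by blast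
  qed
qed

lemma cyl_partition_refine:
  assumes "cyl_partition A U" "\<And>c. c \<in> A \<Longrightarrow> cyl_partition (B c) (cyl c)"
  shows "cyl_partition (\<Union>c\<in>A. B c) U"
    and "c \<in> A \<Longrightarrow> d \<in> A \<Longrightarrow> c \<noteq> d \<Longrightarrow> B c \<inter> B d = {}"
proof -
  have sub: "cyl b \<subseteq> cyl c" if "c \<in> A" "b \<in> B c" for c b
    using cyl_partitionD(3)[OF assms(2)[OF that(1)]] that(2) by blast
  show "B c \<inter> B d = {}" if "c \<in> A" "d \<in> A" "c \<noteq> d" for c d
  proof (rule ccontr)
    assume "B c \<inter> B d \<noteq> {}"
    then obtain b where "b \<in> B c" "b \<in> B d" by blast
    then have "cyl b \<subseteq> cyl c \<inter> cyl d" using sub that by blast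
    then show False using cyl_nonempty[of b] cyl_partitionD(4)[OF assms(1) that(1,2)] that(3) by blast
  qed
  show "cyl_partition (\<Union>c\<in>A. B c) U"
    unfolding cyl_partition_def
  proof (intro conjI ballI impI)
    show "finite (\<Union>c\<in>A. B c)" using assms cyl_partitionD(1) by blast
    show "(\<Union>c\<in>A. B c) \<subseteq> arr" using assms(2) cyl_partitionD(2) by blast
    show "U = \<Union> (cyl ` (\<Union>c\<in>A. B c))"
      using cyl_partitionD(3)[OF assms(1)] cyl_partitionD(3)[OF assms(2)] by blast
    fix b b' assume b: "b \<in> (\<Union>c\<in>A. B c)" "b' \<in> (\<Union>c\<in>A. B c)" "b \<noteq> b'"
    then obtain c c' where c: "c \<in> A" "b \<in> B c" "c' \<in> A" "b' \<in> B c'" by blast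
    show "cyl b \<inter> cyl b' = {}"
    proof (rule ccontr)
      assume "cyl b \<inter> cyl b' \<noteq> {}"
      then obtain x where x: "x \<in> cyl b" "x \<in> cyl b'" by blast
      then have "c = c'" using cyl_partitionD(4)[OF assms(1) c(1,3)] sub c by blast
      then show False using cyl_partitionD(4)[OF assms(2)[OF c(1)] c(2) _ x] c b(3) by blast
    qed
  qed
qed

definition refinement :: "nat \<Rightarrow> 'x wordarrow \<Rightarrow> 'x wordarrow set" where
  "refinement N c = (\<odot>) c ` words_of_length (\<lambda>i. N - length (snd c i))"

lemma refinement_level:
  assumes "c \<in> arr" "short N (snd c)"
  shows "refinement N c \<subseteq> level_arrows N"
proof
  fix d assume "d \<in> refinement N c"
  then obtain u where u: "u \<in> words_of_length (\<lambda>i. N - length (snd c i))" "d = c \<odot> u"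
    unfolding refinement_def by blast
  then have "d \<in> arr" using assms words_of_length_words by blast
  then show "d \<in> level_arrows N"
    using u assms(2) by (auto simp: arr_def level_def words_of_length_def extend_def word_cat_def short_def)
qed

lemma refinement_partition: "c \<in> arr \<Longrightarrow> cyl_partition (refinement N c) (cyl c)"
  unfolding refinement_def by (rule cyl_partition_extend)

lemma Un_refinement:
  assumes "cyl_partition A U" "\<And>c. c \<in> A \<Longrightarrow> short N (snd c)"
  shows "(\<Union>c\<in>A. refinement N c) = {d \<in> level_arrows N. cyl d \<subseteq> U}"
proof (intro equalityI subsetI)
  fix d assume "d \<in> (\<Union>c\<in>A. refinement N c)"
  then obtain c where c: "c \<in> A" "d \<in> refinement N c" by blast
  have "c \<in> arr" using c cyl_partitionD(2)[OF assms(1)] by blast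
  then have "d \<in> level_arrows N" using refinement_level assms(2) c by blast
  moreover have "cyl d \<subseteq> cyl c" using cyl_partitionD(3)[OF refinement_partition[OF \<open>c \<in> arr\<close>]] c(2) by blast
  ultimately show "d \<in> {d \<in> level_arrows N. cyl d \<subseteq> U}" using c cyl_partitionD(3)[OF assms(1)] by blast
next
  fix d assume "d \<in> {d \<in> level_arrows N. cyl d \<subseteq> U}"
  then have d: "d \<in> level_arrows N" "cyl d \<subseteq> U" by auto
  then obtain x where "x \<in> cyl d" "x \<in> U" using cyl_nonempty by blast
  then obtain c \<omega> \<omega>' where c: "c \<in> A" "act c \<omega> = act d \<omega>'"
  proof -
    obtain c where "c \<in> A" "x \<in> cyl c" using \<open>x \<in> U\<close> cyl_partitionD(3)[OF assms(1)] by blast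
    moreover obtain \<omega> \<omega>' where "x = act c \<omega>" "x = act d \<omega>'"
      using \<open>x \<in> cyl c\<close> \<open>x \<in> cyl d\<close> unfolding cyl_def by blast
    ultimately show ?thesis using that by metis
  qed
  have ca: "c \<in> arr" using c cyl_partitionD(2)[OF assms(1)] by blast
  have "long N (snd d)" using d level_long by auto
  then obtain u where u: "u \<in> words" "d = c \<odot> u"
    using prefix_long[OF ca level_arr[OF d(1)] c(2) assms(2)[OF c(1)]] by metis
  have "length (u i) = N - length (snd c i)" if "i \<in> colours" for i
    using d(1) u(2) that by (auto simp: level_def extend_def word_cat_def)
  then have "d \<in> refinement N c" unfolding refinement_def words_of_length_def using u by blast
  then show "d \<in> (\<Union>c\<in>A. refinement N c)" using c by blast
qed

lemma level_cylinders_disjoint: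
  assumes "c \<in> level_arrows M" "d \<in> level_arrows M" "x \<in> cyl c" "x \<in> cyl d"
  shows "c = d"
proof -
  obtain \<omega> \<omega>' where "act c \<omega> = act d \<omega>'" using assms(3,4) unfolding cyl_def by blast
  then have "fst c = fst d" "snd c \<triangleright> \<omega> = snd d \<triangleright> \<omega>'" by (auto simp: act_def)
  moreover have "snd c \<in> words_of_length (\<lambda>i. M)" "snd d \<in> words_of_length (\<lambda>i. M)"
    using assms(1,2) by (auto simp: level_eq)
  ultimately show ?thesis using words_of_length_disjoint by (simp add: prod_eq_iff)
qed

lemma level_partition:
  assumes "clopen U"
  obtains N where "\<And>M. N \<le> M \<Longrightarrow> cyl_partition {d \<in> level_arrows M. cyl d \<subseteq> U} U"
proof -
  obtain N where N: "\<And>c. c \<in> arr \<Longrightarrow> long N (snd c) \<Longrightarrow> cyl c \<subseteq> U \<or> cyl c \<inter> U = {}"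
    using clopenE[OF assms] by blast
  have "cyl_partition {d \<in> level_arrows M. cyl d \<subseteq> U} U" if M: "N \<le> M" for M
    unfolding cyl_partition_def
  proof (intro conjI ballI impI)
    show "finite {d \<in> level_arrows M. cyl d \<subseteq> U}" using finite_level_arrows by simp
    show "{d \<in> level_arrows M. cyl d \<subseteq> U} \<subseteq> arr" using level_arr by blast
    fix c d assume cd: "c \<in> {d \<in> level_arrows M. cyl d \<subseteq> U}" "d \<in> {d \<in> level_arrows M. cyl d \<subseteq> U}" "c \<noteq> d"
    then show "cyl c \<inter> cyl d = {}" using level_cylinders_disjoint[of c M d] by blast
  next
    show "U = \<Union> (cyl ` {d \<in> level_arrows M. cyl d \<subseteq> U})"
    proof (intro equalityI subsetI)
      fix x assume x: "x \<in> U"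
      then have "x \<in> points" using clopen_subset[OF assms] by blast
      then obtain c \<omega> where c: "c \<in> level_arrows M" "c \<in> arr" "\<omega> \<in> boundary" "x = act c \<omega>"
        by (rule points_split)
      have "x \<in> cyl c" using c by (auto simp: cyl_def)
      moreover have "long N (snd c)" using c level_long long_mono[OF _ M] by auto
      ultimately have "cyl c \<subseteq> U" using N[OF c(2)] x by blast
      then show "x \<in> \<Union> (cyl ` {d \<in> level_arrows M. cyl d \<subseteq> U})" using c(1) \<open>x \<in> cyl c\<close> by blast
    qed blast
  qed
  then show ?thesis using that by blast
qed

lemma cyl_partition_image:
  assumes "h \<in> H" "cyl_partition A U" "\<And>c. c \<in> A \<Longrightarrow> replaces h c (\<tau> c)"
  shows "cyl_partition (\<tau> ` A) (h ` U)" "inj_on \<tau> A"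
proof -
  have inj: "inj h" using H_bij[OF assms(1)] by (simp add: bij_is_inj)
  have im: "h ` cyl c = cyl (\<tau> c)" if "c \<in> A" for c using replaces_cyl[OF assms(3)[OF that]] .
  have disj: "c = d" if cd: "c \<in> A" "d \<in> A" and x: "x \<in> cyl (\<tau> c)" "x \<in> cyl (\<tau> d)" for c d x
  proof -
    obtain y z where "y \<in> cyl c" "x = h y" "z \<in> cyl d" "x = h z" using im cd x by blast
    moreover then have "y = z" using inj by (simp add: inj_eq)
    ultimately show ?thesis using cyl_partitionD(4)[OF assms(2) cd] by blast
  qed
  show "inj_on \<tau> A"
  proof (rule inj_onI)
    fix c d assume "c \<in> A" "d \<in> A" "\<tau> c = \<tau> d"
    then show "c = d" using disj cyl_nonempty[of "\<tau> c"] by (metis ex_in_conv)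
  qed
  show "cyl_partition (\<tau> ` A) (h ` U)" unfolding cyl_partition_def
  proof (intro conjI ballI impI)
    show "finite (\<tau> ` A)" using cyl_partitionD(1)[OF assms(2)] by simp
    show "\<tau> ` A \<subseteq> arr" using assms(3) replacesD(1) by blast
    show "h ` U = \<Union> (cyl ` \<tau> ` A)" using im cyl_partitionD(3)[OF assms(2)] by (simp add: image_UN)
    fix b b' assume "b \<in> \<tau> ` A" "b' \<in> \<tau> ` A" "b \<noteq> b'"
    then show "cyl b \<inter> cyl b' = {}" using disj by blast
  qed
qed

definition moved :: "('x point \<Rightarrow> 'x point) \<Rightarrow>
    'x point set" where
  "moved s = {x. s x \<noteq> x}"

lemma moved_points: "s \<in> H \<Longrightarrow> moved s \<subseteq> points"
  unfolding moved_def H_def by blast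

lemma moved_conj:
  assumes "h \<in> H" "h \<circ> s = t \<circ> h"
  shows "moved t = h ` moved s"
proof -
  have h: "bij h" using H_bij[OF assms(1)] .
  have eq: "t (h x) = h (s x)" for x using fun_cong[OF assms(2), of x] by simp
  show ?thesis
  proof (intro equalityI subsetI)
    fix y assume y: "y \<in> moved t"
    obtain x where x: "y = h x" using h by (meson bij_pointE)
    then show "y \<in> h ` moved s" using y eq unfolding moved_def by auto
  next
    fix y assume "y \<in> h ` moved s"
    then show "y \<in> moved t" using eq h unfolding moved_def by (auto simp: bij_is_inj inj_eq)
  qed
qed

end

section \<open>Many classes of involutions for uniform labels\<close>

lemma involution_with_support:
  assumes "finite S" "2 * p \<le> card S"
  shows "\<exists>\<pi> D. D \<subseteq> S \<and> card D = 2 * p \<and> (\<forall>x. \<pi> (\<pi> x) = x) \<and> (\<forall>x. \<pi> x \<noteq> x \<longleftrightarrow> x \<in> D)"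
  using assms
proof (induction p arbitrary: S)
  case 0
  show ?case by (intro exI[of _ id] exI[of _ "{}"]) auto
next
  case (Suc p)
  obtain S' where S': "S' \<subseteq> S" "card S' = 2" using obtain_subset_with_card_n[of 2 S] Suc.prems by auto
  then obtain a b where ab: "S' = {a, b}" "a \<noteq> b" by (meson card_2_iff)
  have "2 * p \<le> card (S - S')"
    using Suc.prems S' by (subst card_Diff_subset) (auto intro: finite_subset)
  then obtain \<pi> D where D: "D \<subseteq> S - S'" "card D = 2 * p" "\<And>x. \<pi> (\<pi> x) = x" "\<And>x. \<pi> x \<noteq> x \<longleftrightarrow> x \<in> D"
    using Suc.IH[of "S - S'"] Suc.prems by blast
  have fix_ab: "\<pi> a = a" "\<pi> b = b" using D ab by blast+
  have ne: "\<pi> x \<noteq> a" "\<pi> x \<noteq> b" if "x \<noteq> a" "x \<noteq> b" for x using that D(3) fix_ab by metis+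
  define \<pi>' where "\<pi>' = \<pi>(a := b, b := a)"
  have "\<pi>' (\<pi>' x) = x" for x using ab D(3) ne by (auto simp: \<pi>'_def)
  moreover have "\<pi>' x \<noteq> x \<longleftrightarrow> x \<in> insert a (insert b D)" for x using ab D(4) by (auto simp: \<pi>'_def)
  moreover have "card (insert a (insert b D)) = 2 * Suc p"
  proof -
    have "finite D" using D(1) Suc.prems(1) finite_subset by blast
    moreover have "a \<notin> D" "b \<notin> D" using D(1) ab by auto
    ultimately show ?thesis using ab D(2) by simp
  qed
  moreover have "insert a (insert b D) \<subseteq> S" using D(1) S' ab by blast
  ultimately show ?case by blast
qed

context labelled_alphabets
begin
lemma take_drop_level:
  assumes "w \<in> level N"
  shows "take_word N (w \<triangleright> \<omega>) = w" "drop_word N (w \<triangleright> \<omega>) = \<omega>"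
proof -
  have "length (w i) = N" if "i \<in> colours" for i using assms that by (simp add: level_def)
  moreover have "w i = []" if "i \<notin> colours" for i using words_outside[OF level_words[OF assms] that] .
  ultimately show "take_word N (w \<triangleright> \<omega>) = w" "drop_word N (w \<triangleright> \<omega>) = \<omega>"
    by (auto simp: take_word_def drop_word_def shift_word_def stake_shift sdrop_shift fun_eq_iff)
qed

text \<open>
  The homology class of a cylinder with domain \<open>j\<close> in the uniform case, where \<open>e\<^sub>0 = 1\<close> and
  \<open>e\<^sub>1 = n\<close> in \<open>\<int>/(n\<^sup>2 - 1)\<close>.
\<close>

definition cong_weight :: "bit \<Rightarrow> nat" where
  "cong_weight j = (if j = 0 then 1 else 2 * m)"

definition total_weight :: "'x wordarrow set \<Rightarrow> nat" where
  "total_weight A = (\<Sum>c\<in>A. cong_weight (source c))"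

abbreviation "modulus \<equiv> (2 * m) ^ 2 - 1"

text \<open>
  Extending a cylinder by \<open>r\<close> letters gives \<open>n\<^sup>r\<close> cylinders, and every letter changes the vertex. Two
  steps multiply the weight by \<open>n\<^sup>2\<close>, which is \<open>1\<close> modulo \<open>n\<^sup>2 - 1\<close>.
\<close>

lemma cong_weight_power:
  "[(2 * m) ^ r * cong_weight (j + of_nat r) = cong_weight j] (mod modulus)"
proof (induction r arbitrary: j)
  case (Suc r)
  have sq: "[(2 * m) * (2 * m) = 1] (mod modulus)"
  proof -
    have "(2 * m) * (2 * m) = 1 + modulus" using m_pos by (simp add: power2_eq_square)
    then show ?thesis unfolding cong_def by (simp only: mod_add_self2)
  qed
  have step: "[(2 * m) * cong_weight (j + 1) = cong_weight j] (mod modulus)"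
    using sq by (cases j) (auto simp: cong_weight_def)
  have "(2 * m) ^ Suc r * cong_weight (j + of_nat (Suc r)) =
      (2 * m) * ((2 * m) ^ r * cong_weight ((j + 1) + of_nat r))" by (simp add: add.assoc)
  also have "[\<dots> = (2 * m) * cong_weight (j + 1)] (mod modulus)"
    by (intro cong_mult cong_refl Suc)
  finally show ?case using step cong_trans by blast
qed simp

end

locale uniform_labels = labelled_alphabets k m X l
  for k m :: nat and X :: "nat \<Rightarrow> 'x set" and l :: "'x \<Rightarrow> bit" +
  assumes uniform: "l x = 1"
begin

lemma letter_sum_uniform: "letter_sum ys = of_nat (length ys)"
proof (induction ys)
  case (Cons y ys)
  then show ?case by (simp only: letter_sum_simps uniform[of "base_letter y"] list.size) simp
qed (simp only: letter_sum_simps list.size of_nat_0)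

lemma label_sum_uniform: "u \<in> words_of_length len \<Longrightarrow> label_sum u = of_nat (\<Sum>i\<in>colours. len i)"
  by (simp add: label_sum_def letter_sum_uniform words_of_length_def colours_def)

lemma total_weight_extend:
  "[total_weight ((\<odot>) c ` words_of_length len) = cong_weight (source c)] (mod modulus)"
proof -
  let ?r = "\<Sum>i\<in>colours. len i"
  have "total_weight ((\<odot>) c ` words_of_length len) = (\<Sum>u\<in>words_of_length len. cong_weight (source (c \<odot> u)))"
    unfolding total_weight_def by (subst sum.reindex) (auto simp: inj_on_def extend_inj)
  also have "\<dots> = (\<Sum>u\<in>words_of_length len. cong_weight (source c + of_nat ?r))"
    by (intro sum.cong) (simp_all add: label_sum_uniform)
  also have "\<dots> = (2 * m) ^ ?r * cong_weight (source c + of_nat ?r)"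
    by (simp add: card_words_of_length)
  finally show ?thesis using cong_weight_power by metis
qed

lemma total_weight_refinement:
  assumes "cyl_partition A U" "\<And>c. c \<in> A \<Longrightarrow> short N (snd c)"
  shows "[total_weight {d \<in> level_arrows N. cyl d \<subseteq> U} = total_weight A] (mod modulus)"
proof -
  have arr: "c \<in> arr" if "c \<in> A" for c using cyl_partitionD(2)[OF assms(1)] that by blast
  have "total_weight (\<Union>c\<in>A. refinement N c) = (\<Sum>c\<in>A. total_weight (refinement N c))"
    unfolding total_weight_def
  proof (rule sum.UNION_disjoint)
    show "finite A" using cyl_partitionD(1)[OF assms(1)] .
    show "\<forall>c\<in>A. finite (refinement N c)"
      unfolding refinement_def by (intro ballI finite_imageI finite_words_of_length)
    show "\<forall>c\<in>A. \<forall>d\<in>A. c \<noteq> d \<longrightarrow> refinement N c \<inter> refinement N d = {}"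
    proof (intro ballI impI)
      fix c d assume "c \<in> A" "d \<in> A" "c \<noteq> d"
      then show "refinement N c \<inter> refinement N d = {}"
        using cyl_partition_refine(2)[of A U "refinement N"] assms(1) refinement_partition arr by blast
    qed
  qed
  also have "[\<dots> = total_weight A] (mod modulus)"
    unfolding total_weight_def[of A] refinement_def by (intro cong_sum total_weight_extend)
  finally show ?thesis using Un_refinement[OF assms] by simp
qed

text \<open>
  Both partitions refine to the partition of \<open>U\<close> into cylinders of one sufficiently high level, and
  refining does not change the weight.
\<close>

lemma total_weight_unique:
  assumes "cyl_partition A U" "cyl_partition A' U"
  shows "[total_weight A = total_weight A'] (mod modulus)"
proof -
  obtain N where N: "\<And>c. c \<in> A \<union> A' \<Longrightarrow> short N (snd c)"
    using short_bound[of "A \<union> A'"] cyl_partitionD(1,2)[OF assms(1)] cyl_partitionD(1,2)[OF assms(2)] by blast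
  show ?thesis
    using total_weight_refinement[OF assms(1), of N] total_weight_refinement[OF assms(2), of N] N
    by (meson UnI1 UnI2 cong_sym cong_trans)
qed

text \<open>
  An element of \<open>H\<close> maps the cylinders of a fine partition to cylinders with the same domains.
\<close>

lemma total_weight_image:
  assumes "h \<in> H" "cyl_partition A U" "cyl_partition A' (h ` U)"
  shows "[total_weight A = total_weight A'] (mod modulus)"
proof -
  obtain N1 where N1: "\<And>c. c \<in> arr \<Longrightarrow> long N1 (snd c) \<Longrightarrow> \<exists>c'. replaces h c c' \<and> long 0 (snd c')"
    using H_replaces[OF assms(1)] by blast
  obtain N2 where N2: "\<And>c. c \<in> A \<Longrightarrow> short N2 (snd c)"
    using short_bound[of A] cyl_partitionD(1,2)[OF assms(2)] by blast
  \<comment> \<open>From level \<open>N1\<close> on, \<open>h\<close> replaces prefixes; from level \<open>N2\<close> on, the levels refine \<open>A\<close>.\<close>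
  define N where "N = max N1 N2"
  have N: "short N (snd c)" if "c \<in> A" for c using N2[OF that] short_mono unfolding N_def by auto
  define B where "B = {d \<in> level_arrows N. cyl d \<subseteq> U}"
  have arr: "c \<in> arr" if "c \<in> A" for c using cyl_partitionD(2)[OF assms(2)] that by blast
  have B: "cyl_partition B U"
    using cyl_partition_refine(1)[of A U "refinement N"] assms(2) refinement_partition[OF arr]
      Un_refinement[OF assms(2) N] unfolding B_def by simp
  have "\<exists>c'. replaces h c c'" if "c \<in> B" for c
  proof -
    have "c \<in> arr" "long N1 (snd c)"
      using that level_arr level_long long_mono[of N _ N1] unfolding B_def N_def by auto
    then show ?thesis using N1 by blast
  qed
  then obtain \<tau> where \<tau>: "\<And>c. c \<in> B \<Longrightarrow> replaces h c (\<tau> c)" by metis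
  note im = cyl_partition_image[OF assms(1) B \<tau>]
  have "total_weight (\<tau> ` B) = total_weight B"
    unfolding total_weight_def using im(2) replacesD(2)[OF \<tau>] by (simp add: sum.reindex)
  then show ?thesis
    using total_weight_unique[OF assms(2) B] total_weight_unique[OF im(1) assms(3)] cong_trans by metis
qed

text \<open>
  A permutation of the words of length \<open>2\<close> in each colour acts on prefixes of points with first
  vertex \<open>0\<close>. The length is even, so all these words lead back to the vertex \<open>0\<close> and any two of them
  may be exchanged.
\<close>

lemma swap_involution:
  assumes "2 * p \<le> card (level 2)"
  obtains s A where "s \<in> H" "s \<circ> s = id" "cyl_partition A (moved s)" "total_weight A = 2 * p"
proof -
  obtain \<pi> D where D: "D \<subseteq> level 2" "card D = 2 * p" "\<And>w. \<pi> (\<pi> w) = w" "\<And>w. \<pi> w \<noteq> w \<longleftrightarrow> w \<in> D"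
    using involution_with_support[OF finite_level assms] by blast
  have \<pi>: "\<pi> w \<in> level 2" if "w \<in> level 2" for w using D(1,3,4) that by (metis subsetD)
  have lab: "label_sum w = 0" if "w \<in> level 2" for w
    using label_sum_uniform[of w "\<lambda>i. 2"] that by (simp add: level_eq)
  define s where "s x = (if x \<in> points \<and> fst x = 0
    then (0, \<pi> (take_word 2 (snd x)) \<triangleright> drop_word 2 (snd x)) else x)"
    for x :: "'x point"
  have s0: "s (act (0, w) \<omega>) = act (0, \<pi> w) \<omega>" if "w \<in> level 2" "\<omega> \<in> boundary" for w \<omega>
    using that take_drop_level[OF that(1)] level_words
    by (auto simp: s_def act_def points_def)
  have s1: "s (act (1, w) \<omega>) = act (1, w) \<omega>" for w \<omega>
    by (auto simp: s_def act_def)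
  have sout: "s x = x" if "x \<notin> points" for x using that by (simp add: s_def)
  have invol: "s (s x) = x" and pts: "x \<in> points \<Longrightarrow> s x \<in> points" 
    and mv: "x \<in> points \<Longrightarrow> s x \<noteq> x \<longleftrightarrow> x \<in> \<Union>(cyl ` ({0} \<times> D))" for x
  proof -
    have "s (s x) = x \<and> s x \<in> points \<and> (s x \<noteq> x \<longleftrightarrow> x \<in> \<Union>(cyl ` ({0} \<times> D)))" if x: "x \<in> points"
    proof -
      obtain c \<omega> where c: "c \<in> level_arrows 2" "c \<in> arr" "\<omega> \<in> boundary" "x = act c \<omega>"
        using x by (rule points_split)
      obtain j w where jw: "c = (j, w)" "w \<in> level 2" using c(1) by auto
      show ?thesis
      proof (cases "j = 0")
        case True
        have "s x = act (0, \<pi> w) \<omega>" using s0 jw c True by simp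
        moreover have "act (0, \<pi> w) \<omega> \<in> points"
          using c(3) \<pi>[OF jw(2)] level_words by (auto simp: act_def points_def)
        moreover have "s (act (0, \<pi> w) \<omega>) = act (0, w) \<omega>" using s0 \<pi>[OF jw(2)] c(3) D(3) by simp
        moreover have "act (0, \<pi> w) \<omega> \<noteq> act (0, w) \<omega> \<longleftrightarrow> w \<in> D"
        proof -
          have "\<pi> w \<triangleright> \<omega> = w \<triangleright> \<omega> \<longleftrightarrow> \<pi> w = w"
            using words_of_length_disjoint[of "\<pi> w" "\<lambda>i. 2" w] \<pi>[OF jw(2)] jw(2)
            unfolding level_eq by metis
          then show ?thesis using D(4)[of w] by (simp add: act_def)
        qed
        moreover have "act (0, w) \<omega> \<in> \<Union>(cyl ` ({0} \<times> D)) \<longleftrightarrow> w \<in> D"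
        proof
          assume "act (0, w) \<omega> \<in> \<Union>(cyl ` ({0} \<times> D))"
          then obtain w' \<omega>' where w': "w' \<in> D" "act (0, w) \<omega> = act (0, w') \<omega>'"
            unfolding cyl_def by blast
          then have "w \<triangleright> \<omega> = w' \<triangleright> \<omega>'" by (simp add: act_def)
          then have "w = w'"
            using words_of_length_disjoint[of w "\<lambda>i. 2" w'] jw(2) w'(1) D(1) unfolding level_eq by blast
          then show "w \<in> D" using w' by simp
        next
          assume "w \<in> D"
          then show "act (0, w) \<omega> \<in> \<Union>(cyl ` ({0} \<times> D))" using c(3) unfolding cyl_def by blast
        qed
        ultimately show ?thesis using c(4) jw(1) True by simp
      next
        case False
        then have "s x = x" using s1 jw c by (cases j) auto
        moreover have "x \<notin> \<Union>(cyl ` ({0} \<times> D))" using False jw c by (auto simp: cyl_def act_def)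
        ultimately show ?thesis using x by simp
      qed
    qed
    then show "s (s x) = x" "x \<in> points \<Longrightarrow> s x \<in> points" 
      "x \<in> points \<Longrightarrow> s x \<noteq> x \<longleftrightarrow> x \<in> \<Union>(cyl ` ({0} \<times> D))"
      using sout[of x] by (cases "x \<in> points"; simp)+
  qed
  have "s \<in> H" unfolding H_def
  proof (intro CollectI conjI allI impI)
    show "bij_betw s points points"
      by (rule bij_betw_byWitness[of _ s]) (use invol pts in auto)
    show "s x = x" if "x \<notin> points" for x using sout that .
    show "locally_prefix points s"
    proof (rule locally_prefixI[OF finite_level_arrows[of 2]])
      show "points \<subseteq> \<Union> (cyl ` (level_arrows 2))"
      proof
        fix x assume "x \<in> points"
        then obtain c \<omega> where "c \<in> level_arrows 2" "c \<in> arr" "\<omega> \<in> boundary" "x = act c \<omega>"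
          by (rule points_split)
        then show "x \<in> \<Union> (cyl ` (level_arrows 2))" unfolding cyl_def by blast
      qed
      show "level_arrows 2 \<subseteq> arr" using level_arr by blast
      fix c assume "c \<in> level_arrows 2"
      then obtain j w where jw: "c = (j, w)" "w \<in> level 2" by auto
      show "\<exists>c'. replaces s c c'"
      proof (cases "j = 0")
        case True
        have "replaces s c (0, \<pi> w)"
          unfolding replaces_def using jw True s0 \<pi>[OF jw(2)] lab level_arr by (auto simp: source_def)
        then show ?thesis by blast
      next
        case False
        have "replaces s c c"
          unfolding replaces_def using jw False s1 level_arr[of c 2] by (cases j) auto
        then show ?thesis by blast
      qed
    qed
  qed
  moreover have "s \<circ> s = id" using invol by auto
  moreover have "cyl_partition ({0} \<times> D) (moved s)"
    unfolding cyl_partition_def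
  proof (intro conjI ballI impI)
    show "finite ({0 :: bit} \<times> D)" using finite_subset[OF D(1) finite_level] by simp
    show "{0} \<times> D \<subseteq> arr" using D(1) level_arr by blast
    have "\<Union>(cyl ` ({0} \<times> D)) \<subseteq> points" using D(1) level_arr cyl_points by blast
    then show "moved s = \<Union>(cyl ` ({0} \<times> D))" using mv sout unfolding moved_def by blast
    fix c d assume cd: "c \<in> {0 :: bit} \<times> D" "d \<in> {0} \<times> D" "c \<noteq> d"
    then have "c \<in> level_arrows 2" "d \<in> level_arrows 2" using D(1) by auto
    then show "cyl c \<inter> cyl d = {}" using level_cylinders_disjoint cd(3) by blast
  qed
  moreover have "total_weight ({0} \<times> D) = 2 * p"
  proof -
    have "cong_weight (source c) = 1" if "c \<in> {0} \<times> D" for c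
      using that lab D(1) by (auto simp: source_def cong_weight_def)
    then show ?thesis unfolding total_weight_def using D(2) by (simp add: card_cartesian_product)
  qed
  ultimately show ?thesis using that by blast
qed

lemma nonconjugate_involutions:
  assumes "k \<ge> 2"
  obtains s where "\<And>p. p \<in> {1..modulus} \<Longrightarrow> s p \<in> H \<and> s p \<circ> s p = id \<and> s p \<noteq> id"
    "\<And>p p' h. p \<in> {1..modulus} \<Longrightarrow> p' \<in> {1..modulus} \<Longrightarrow> h \<in> H \<Longrightarrow> h \<circ> s p = s p' \<circ> h \<Longrightarrow> p = p'"
proof -
  let ?n = "2 * m"
  have n: "?n \<ge> 2" using m_pos by simp
  have "card (level 2) = ?n ^ (2 * k)"
    unfolding level_eq card_words_of_length by (simp add: colours_def mult.commute)
  moreover have "?n ^ 4 \<le> ?n ^ (2 * k)" using assms n by (intro power_increasing) auto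
  moreover have "2 * modulus \<le> ?n ^ 4"
  proof -
    have "2 * modulus \<le> 4 * ?n ^ 2" by simp
    also have "\<dots> \<le> ?n ^ 2 * ?n ^ 2" using power_mono[OF n, of 2] by (intro mult_right_mono) auto
    also have "\<dots> = ?n ^ 4" by (simp flip: power_add)
    finally show ?thesis .
  qed
  ultimately have big: "2 * modulus \<le> card (level 2)" by simp
  have "\<exists>s A. s \<in> H \<and> s \<circ> s = id \<and> cyl_partition A (moved s) \<and> total_weight A = 2 * p"
    if "p \<in> {1..modulus}" for p
  proof -
    have "2 * p \<le> card (level 2)" using that big by auto
    then show ?thesis using swap_involution by metis
  qed
  then obtain s A where s: "\<And>p. p \<in> {1..modulus} \<Longrightarrow>
    s p \<in> H \<and> s p \<circ> s p = id \<and> cyl_partition (A p) (moved (s p)) \<and> total_weight (A p) = 2 * p" by metis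
  show ?thesis
  proof (rule that[of s])
    fix p assume p: "p \<in> {1..modulus}"
    have "moved (s p) \<noteq> {}"
    proof
      assume "moved (s p) = {}"
      then have "\<Union>(cyl ` A p) = {}" using cyl_partitionD(3) s[OF p] by metis
      then have "A p = {}" using cyl_nonempty by (metis SUP_bot_conv(1) equals0I)
      then show False using s[OF p] p by (auto simp: total_weight_def)
    qed
    then have "s p \<noteq> id" unfolding moved_def by auto
    then show "s p \<in> H \<and> s p \<circ> s p = id \<and> s p \<noteq> id" using s[OF p] by blast
  next
    fix p p' h assume p: "p \<in> {1..modulus}" "p' \<in> {1..modulus}" and h: "h \<in> H" "h \<circ> s p = s p' \<circ> h"
    have "moved (s p') = h ` moved (s p)" using moved_conj[OF h] .
    then have "[total_weight (A p) = total_weight (A p')] (mod modulus)"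
      using total_weight_image[OF h(1)] s[OF p(1)] s[OF p(2)] by metis
    then have "[2 * p = 2 * p'] (mod modulus)" using s p by simp
    moreover have "coprime 2 modulus"
    proof -
      have "odd modulus" using m_pos by (simp add: power2_eq_square)
      then show ?thesis by simp
    qed
    ultimately have "[p = p'] (mod modulus)" by (simp add: cong_mult_lcancel_nat)
    \<comment> \<open>The shift by \<open>1\<close> moves the range \<open>{1..modulus}\<close> to the residues \<open>{0..<modulus}\<close>.\<close>
    then have "[p - 1 = p' - 1] (mod modulus)"
      using p cong_diff_nat[of p p' modulus 1 1] by auto
    moreover have "p - 1 < modulus" "p' - 1 < modulus" using p by auto
    ultimately have "p - 1 = p' - 1" by (simp add: cong_def)
    then show "p = p'" using p by auto
  qed
qed

end

section \<open>Involutions\<close>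

context labelled_alphabets
begin

text \<open>
  Suppose that \<open>s\<close> replaces \<open>c\<close> by \<open>c'\<close> and that the two cylinders meet, say \<open>c u' = c' u\<close>. Then \<open>s\<close>
  maps \<open>c u\<close> to \<open>c' u = c u'\<close>, and this to \<open>c' u'\<close>, so \<open>c u = c' u'\<close> as \<open>s\<close> is an involution. Comparing
  degrees in the two equations shows that \<open>c\<close> and \<open>c'\<close> have equal degree, so they coincide. In other
  words, no involution has a contracting germ.
\<close>

lemma involution_local:
  assumes s: "s \<in> H" "s \<circ> s = id"
  obtains N where "\<And>c. c \<in> arr \<Longrightarrow> long N (snd c) \<Longrightarrow> (\<forall>x\<in>cyl c. s x = x) \<or> s ` cyl c \<inter> cyl c = {}"
proof -
  have ss: "s (s x) = x" for x using fun_cong[OF s(2), of x] by simp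
  obtain N where N: "\<And>c. c \<in> arr \<Longrightarrow> long N (snd c) \<Longrightarrow> \<exists>c'. replaces s c c' \<and> long 0 (snd c')"
    using H_replaces[OF s(1)] by blast
  have "(\<forall>x\<in>cyl c. s x = x) \<or> s ` cyl c \<inter> cyl c = {}" if c: "c \<in> arr" "long N (snd c)" for c
  proof (rule disjCI)
    assume "s ` cyl c \<inter> cyl c \<noteq> {}"
    obtain c' where c': "replaces s c c'" using N[OF c] by blast
    have c'a: "c' \<in> arr" using replacesD(1)[OF c'] .
    have "cyl c' \<inter> cyl c \<noteq> {}" using \<open>s ` cyl c \<inter> cyl c \<noteq> {}\<close> replaces_cyl[OF c'] by simp
    then obtain x where x: "x \<in> cyl c" "x \<in> cyl c'" by blast
    obtain \<omega> where \<omega>b: "\<omega> \<in> boundary" "x = act c \<omega>" using x(1) unfolding cyl_def by blast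
    obtain \<omega>' where "x = act c' \<omega>'" using x(2) unfolding cyl_def by blast
    then have \<omega>: "\<omega> \<in> boundary" "act c \<omega> = act c' \<omega>'" using \<omega>b by simp_all
    obtain M where M: "\<And>x. x \<in> {c, c'} \<Longrightarrow> short M (snd x)" using short_bound[of "{c, c'}"] c(1) c'a by blast
    obtain d \<omega>'' where d: "d \<in> level_arrows M" "d \<in> arr" "\<omega>'' \<in> boundary" "act c \<omega> = act d \<omega>''"
      using points_split[OF act_points[OF c(1) \<omega>(1)]] by metis
    have dl: "long M (snd d)" using d(1) level_long by auto
    have cs: "short M (snd c)" "short M (snd c')" using M by blast+
    obtain u' where u': "u' \<in> words" "d = c \<odot> u'" using prefix_long[OF c(1) d(2) d(4) cs(1) dl] .
    have "act c' \<omega>' = act d \<omega>''" using d(4) \<omega>(2) by simp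
    then obtain u where u: "u \<in> words" "d = c' \<odot> u" using prefix_long[OF c'a d(2) _ cs(2) dl] by metis
    have eq: "c \<odot> u' = c' \<odot> u" using u u' by simp
    have r: "replaces s (c \<odot> u) (c' \<odot> u)" "replaces s (c \<odot> u') (c' \<odot> u')"
      using replaces_extend[OF c'] u u' by blast+
    have "act (c \<odot> u) \<eta> = act (c' \<odot> u') \<eta>" if "\<eta> \<in> boundary" for \<eta>
    proof -
      have "s (act (c \<odot> u) \<eta>) = act (c \<odot> u') \<eta>" using replacesD(3)[OF r(1) that] eq by simp
      then have "s (s (act (c \<odot> u) \<eta>)) = act (c' \<odot> u') \<eta>" using replacesD(3)[OF r(2) that] by simp
      then show ?thesis using ss by simp
    qed
    then have eq2: "c \<odot> u = c' \<odot> u'" using faithful c(1) c'a u(1) u'(1) by blast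
    have "length (snd c i) = length (snd c' i)" for i
    proof -
      have "length (snd c i) + length (u' i) = length (snd c' i) + length (u i)"
        using arg_cong[OF eq, of "\<lambda>x. length (snd x i)"] by (simp add: extend_def word_cat_def)
      moreover have "length (snd c i) + length (u i) = length (snd c' i) + length (u' i)"
        using arg_cong[OF eq2, of "\<lambda>x. length (snd x i)"] by (simp add: extend_def word_cat_def)
      ultimately show ?thesis by linarith
    qed
    moreover have "snd c i @ u' i = snd c' i @ u i" for i
      using arg_cong[OF eq, of "\<lambda>x. snd x i"] by (simp add: extend_def word_cat_def)
    ultimately have "snd c i = snd c' i" for i by (metis append_eq_append_conv)
    then have "snd c = snd c'" by auto
    moreover have "fst c = fst c'" using arg_cong[OF eq, of fst] by (simp add: extend_def)
    ultimately have "c' = c" by (simp add: prod_eq_iff)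
    then show "\<forall>x\<in>cyl c. s x = x" using replacesD(3)[OF c'] unfolding cyl_def by auto
  qed
  then show ?thesis using that by blast
qed

lemma clopen_image_involution:
  assumes "s \<in> H" "s \<circ> s = id" "clopen V"
  shows "clopen (s ` V)"
proof -
  have ss: "s (s x) = x" for x using fun_cong[OF assms(2), of x] by simp
  have V: "V \<subseteq> points" using clopen_subset[OF assms(3)] .
  have "s ` V = {x \<in> points. s x \<in> V}"
  proof (intro equalityI subsetI)
    fix x assume "x \<in> s ` V"
    then show "x \<in> {x \<in> points. s x \<in> V}" using V ss H_points[OF assms(1)] by auto
  next
    fix x assume "x \<in> {x \<in> points. s x \<in> V}"
    then have "x = s (s x)" "s x \<in> V" using ss by auto
    then show "x \<in> s ` V" by blast
  qed
  then show ?thesis using clopen_preimage[OF assms(1,3)] by simp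
qed

text \<open>
  The cylinders that are disjoint from their image are added to \<open>V\<close> one by one, each without the part
  that \<open>V\<close> and its image cover already.
\<close>

lemma involution_halves:
  assumes s: "s \<in> H" "s \<circ> s = id"
  obtains V where "clopen V" "V \<inter> s ` V = {}" "moved s = V \<union> s ` V"
proof -
  have ss: "s (s x) = x" for x using fun_cong[OF s(2), of x] by simp
  have simg: "s x \<in> s ` U \<longleftrightarrow> x \<in> U" for x U using ss by (metis image_iff)
  have simg2: "x \<in> s ` U \<longleftrightarrow> s x \<in> U" for x U using simg[of "s x" U] ss by simp
  obtain N where N: "\<And>c. c \<in> arr \<Longrightarrow> long N (snd c) \<Longrightarrow> (\<forall>x\<in>cyl c. s x = x) \<or> s ` cyl c \<inter> cyl c = {}"
    using involution_local[OF s] by blast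
  define A where "A = {c \<in> level_arrows N. s ` cyl c \<inter> cyl c = {}}"
  have A: "finite A" "A \<subseteq> arr"
    unfolding A_def using finite_level_arrows level_arr by auto
  have greedy: "\<exists>V. clopen V \<and> V \<inter> s ` V = {} \<and> V \<union> s ` V = (\<Union>c\<in>B. cyl c \<union> s ` cyl c)" if "B \<subseteq> A" for B
    using finite_subset[OF that A(1)] that
  proof (induction B rule: finite_induct)
    case empty
    show ?case using clopen_empty by (intro exI[of _ "{}"]) auto
  next
    case (insert c B)
    then obtain V where V: "clopen V" "V \<inter> s ` V = {}" "V \<union> s ` V = (\<Union>c\<in>B. cyl c \<union> s ` cyl c)" by auto
    have c: "c \<in> arr" "s ` cyl c \<inter> cyl c = {}" using insert.prems A(2) unfolding A_def by auto
    \<comment> \<open>The set \<open>V \<union> s ` V\<close> is invariant under \<open>s\<close>, so \<open>s\<close> maps \<open>?W\<close> outside of it.\<close>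
    let ?W = "cyl c - (V \<union> s ` V)"
    have "clopen (cyl c)" using clopen_cylinders[of "{c}"] c(1) by simp
    then have "clopen (V \<union> ?W)"
      using V(1) clopen_image_involution[OF s V(1)] clopen_Un clopen_Diff by metis
    moreover have "(V \<union> ?W) \<inter> s ` (V \<union> ?W) = {}"
    proof -
      have "\<not> (x \<in> V \<union> ?W \<and> s x \<in> V \<union> ?W)" for x
      proof
        assume *: "x \<in> V \<union> ?W \<and> s x \<in> V \<union> ?W"
        have "\<not> (x \<in> V \<and> s x \<in> V)" using V(2) simg2[of x V] by blast
        moreover have "\<not> (x \<in> cyl c \<and> s x \<in> cyl c)" using c(2) by blast
        ultimately show False using * simg2[of x V] simg2[of "s x" V] ss by auto
      qed
      then show ?thesis using simg2[of _ "V \<union> ?W"] by blast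
    qed
    moreover have "(V \<union> ?W) \<union> s ` (V \<union> ?W) = (\<Union>c\<in>insert c B. cyl c \<union> s ` cyl c)"
    proof -
      have "x \<in> (V \<union> ?W) \<union> s ` (V \<union> ?W) \<longleftrightarrow> x \<in> (V \<union> s ` V) \<union> (cyl c \<union> s ` cyl c)" for x
        using simg2[of x "V \<union> ?W"] simg2[of x V] simg2[of "s x" V] simg2[of x "cyl c"] ss by auto
      then have "(V \<union> ?W) \<union> s ` (V \<union> ?W) = (V \<union> s ` V) \<union> (cyl c \<union> s ` cyl c)" by blast
      then show ?thesis using V(3) by auto
    qed
    ultimately show ?case by blast
  qed
  from greedy[OF order_refl]
  obtain V where V: "clopen V" "V \<inter> s ` V = {}" "V \<union> s ` V = (\<Union>c\<in>A. cyl c \<union> s ` cyl c)"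
    by (elim exE conjE)
  have "moved s = (\<Union>c\<in>A. cyl c \<union> s ` cyl c)"
  proof (intro equalityI subsetI)
    fix x assume x: "x \<in> moved s"
    then have "x \<in> points" using moved_points[OF s(1)] by blast
    then obtain c \<omega> where c: "c \<in> level_arrows N" "c \<in> arr" "\<omega> \<in> boundary" "x = act c \<omega>"
      by (rule points_split)
    have xc: "x \<in> cyl c" unfolding cyl_def c(4) using c(3) by (rule imageI)
    have "long N (snd c)" using c(1) level_long by auto
    moreover have "s x \<noteq> x" using x by (simp add: moved_def)
    ultimately have "s ` cyl c \<inter> cyl c = {}" using N[OF c(2)] xc by blast
    then have "c \<in> A" using c(1) unfolding A_def by blast
    then show "x \<in> (\<Union>c\<in>A. cyl c \<union> s ` cyl c)" using xc by blast
  next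
    fix x assume "x \<in> (\<Union>c\<in>A. cyl c \<union> s ` cyl c)"
    then obtain c where c: "c \<in> A" "x \<in> cyl c \<union> s ` cyl c" by blast
    then have disj: "s ` cyl c \<inter> cyl c = {}" unfolding A_def by blast
    have "s x \<noteq> x"
    proof
      assume eq: "s x = x"
      then have "x \<in> cyl c" using c(2) simg2[of x "cyl c"] by fastforce
      then have "s x \<in> s ` cyl c" by (rule imageI)
      then show False using disj \<open>x \<in> cyl c\<close> unfolding eq by blast
    qed
    then show "x \<in> moved s" by (simp add: moved_def)
  qed
  then show ?thesis using that V by simp
qed

lemma locally_prefix_subset: "locally_prefix U f \<Longrightarrow> V \<subseteq> U \<Longrightarrow> locally_prefix V f"
  unfolding locally_prefix_def by (meson order_trans)

text \<open>
  An equivariant bijection is determined by its values on one half of the moved set and on the fixed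
  points. On the other half it must be \<open>t \<circ> h1 \<circ> s\<close>.
\<close>

lemma involutions_conjugate:
  assumes s: "s \<in> H" "s \<circ> s = id" "clopen V" "V \<inter> s ` V = {}" "moved s = V \<union> s ` V"
    and t: "t \<in> H" "t \<circ> t = id" "clopen V'" "V' \<inter> t ` V' = {}" "moved t = V' \<union> t ` V'"
    and h1: "bij_betw h1 V V'" "locally_prefix V h1"
    and h2: "bij_betw h2 (points - moved s) (points - moved t)" "locally_prefix (points - moved s) h2"
  obtains h where "h \<in> H" "h \<circ> s = t \<circ> h"
proof -
  have ss: "s (s x) = x" for x using fun_cong[OF s(2), of x] by simp
  have tt: "t (t x) = x" for x using fun_cong[OF t(2), of x] by simp
  have simg: "x \<in> s ` U \<longleftrightarrow> s x \<in> U" for x U using ss by (metis image_iff)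
  have pts: "V \<union> s ` V \<subseteq> points" "V' \<union> t ` V' \<subseteq> points"
    using moved_points s(1,5) t(1,5) by blast+
  define h where "h x = (if x \<in> V then h1 x else if x \<in> s ` V then t (h1 (s x))
     else if x \<in> points then h2 x else x)" for x
  have hV: "h x = h1 x" if "x \<in> V" for x using that by (simp add: h_def)
  have hsV: "h x = t (h1 (s x))" if "x \<in> s ` V" for x using that s(4) by (auto simp: h_def)
  have hF: "h x = h2 x" if "x \<in> points - moved s" for x using that s(5) by (auto simp: h_def)
  have hout: "h x = x" if "x \<notin> points" for x using that pts by (auto simp: h_def)
  have "bij_betw h V V'" using h1(1) hV bij_betw_cong[of V h h1 V'] by blast
  moreover have sb: "bij_betw h (s ` V) (t ` V')"
  proof -
    have "bij_betw s (s ` V) V" by (rule bij_betw_byWitness[of _ s]) (use ss in auto)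
    moreover have "bij_betw t V' (t ` V')" by (rule bij_betw_byWitness[of _ t]) (use tt in auto)
    ultimately have "bij_betw (t \<circ> (h1 \<circ> s)) (s ` V) (t ` V')"
      using h1(1) bij_betw_trans by blast
    moreover have "h x = (t \<circ> (h1 \<circ> s)) x" if "x \<in> s ` V" for x using hsV[OF that] by simp
    ultimately show ?thesis using bij_betw_cong[of "s ` V" h "t \<circ> (h1 \<circ> s)"] by blast
  qed
  ultimately have "bij_betw h (V \<union> s ` V) (V' \<union> t ` V')" using t(4) by (rule bij_betw_combine)
  then have "bij_betw h (moved s) (moved t)" using s(5) t(5) by simp
  moreover have hFb: "bij_betw h (points - moved s) (points - moved t)"
    using h2(1) hF bij_betw_cong[of "points - moved s" h h2] by blast
  ultimately have "bij_betw h (moved s \<union> (points - moved s)) (moved t \<union> (points - moved t))"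
    by (rule bij_betw_combine) blast
  then have bij: "bij_betw h points points"
    using moved_points[OF s(1)] moved_points[OF t(1)] by (simp add: Un_absorb1)
  have cV: "clopen (s ` V)" using clopen_image_involution[OF s(1-3)] .
  have "locally_prefix (s ` V) (t \<circ> (h1 \<circ> s))"
  proof -
    have "locally_prefix (s ` V) s" using locally_prefix_subset[OF H_locally[OF s(1)]] pts by blast
    moreover have "s ` s ` V \<subseteq> V" using ss by auto
    ultimately have "locally_prefix (s ` V) (h1 \<circ> s)" using locally_prefix_comp cV h1(2) by blast
    moreover have "(h1 \<circ> s) ` s ` V \<subseteq> points" using ss h1(1) pts by (auto simp: bij_betw_def)
    ultimately show ?thesis using locally_prefix_comp cV H_locally[OF t(1)] by blast
  qed
  then have "locally_prefix (s ` V) h" by (rule locally_prefix_cong) (simp add: hsV)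
  moreover have "locally_prefix V h" using h1(2) by (rule locally_prefix_cong) (simp add: hV)
  ultimately have "locally_prefix (moved s) h" using locally_prefix_Un[of V h "s ` V"] s(3,5) by simp
  moreover have "locally_prefix (points - moved s) h" using h2(2) by (rule locally_prefix_cong) (simp add: hF)
  moreover have "clopen (moved s)" unfolding s(5) using s(3) cV by (rule clopen_Un)
  ultimately have "locally_prefix (moved s \<union> (points - moved s)) h" by (rule locally_prefix_Un)
  then have "locally_prefix points h" using moved_points[OF s(1)] by (simp add: Un_absorb1)
  then have "h \<in> H" using bij hout by (simp add: H_def)
  moreover have "h (s x) = t (h x)" for x
  proof -
    consider "x \<in> V" | "x \<in> s ` V" | "x \<in> points - moved s" | "x \<notin> points" using s(5) by blast
    then show ?thesis
    proof cases
      case 1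
      then have "s x \<in> s ` V" by blast
      then show ?thesis using hsV[of "s x"] hV[OF 1] ss by simp
    next
      case 2
      then have "s x \<in> V" using simg by blast
      then show ?thesis using hsV[OF 2] hV[of "s x"] tt by simp
    next
      case 3
      then have "h x \<in> points - moved t" using hFb by (auto simp: bij_betw_def)
      then show ?thesis using 3 by (simp add: moved_def)
    next
      case 4
      have "s x = x" "t x = x" using 4 s(1) t(1) unfolding H_def by blast+
      then show ?thesis using hout[OF 4] by simp
    qed
  qed
  then have "h \<circ> s = t \<circ> h" by (simp add: fun_eq_iff del: split_paired_All)
  ultimately show ?thesis using that by blast
qed

text \<open>
  Domain \<open>0\<close> is required of all cylinders so that any two of them can be matched by an element of
  \<open>H\<close>; the sizes of two tilings are then the only obstruction to matching them.
\<close>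

definition tiled :: "'x point set \<Rightarrow> nat \<Rightarrow> bool" where
  "tiled V p \<longleftrightarrow> (\<exists>A. cyl_partition A V \<and> card A = p \<and> (\<forall>c\<in>A. source c = 0))"

lemma cyl_partition_subdivide:
  assumes "cyl_partition A U" "c \<in> A"
  shows "cyl_partition (A - {c} \<union> (\<odot>) c ` words_of_length len) U"
    and "card (A - {c} \<union> (\<odot>) c ` words_of_length len) = card A - 1 + card (words_of_length len)"
proof -
  define B where "B d = (if d = c then (\<odot>) c ` words_of_length len else {d})" for d
  have A: "finite A" "A \<subseteq> arr" using cyl_partitionD[OF assms(1)] by blast+
  have B: "cyl_partition (B d) (cyl d)" if "d \<in> A" for d
  proof (cases "d = c")
    case True
    have "c \<in> arr" using A(2) assms(2) by blast
    then show ?thesis using cyl_partition_extend[of c len] True by (simp add: B_def)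
  next
    case False
    then show ?thesis using that A(2) unfolding B_def cyl_partition_def by auto
  qed
  have eq: "(\<Union>d\<in>A. B d) = A - {c} \<union> (\<odot>) c ` words_of_length len"
    using assms(2) by (auto simp: B_def)
  show "cyl_partition (A - {c} \<union> (\<odot>) c ` words_of_length len) U"
    using cyl_partition_refine(1)[of A U B] assms(1) B unfolding eq by blast
  have "d \<notin> (\<odot>) c ` words_of_length len" if "d \<in> A - {c}" for d
  proof -
    have "B c \<inter> B d = {}" using cyl_partition_refine(2)[of A U B c d] assms B that by blast
    then show ?thesis using that by (auto simp: B_def)
  qed
  then have "(A - {c}) \<inter> (\<odot>) c ` words_of_length len = {}" by blast
  then have "card (A - {c} \<union> (\<odot>) c ` words_of_length len) =
      card (A - {c}) + card ((\<odot>) c ` words_of_length len)"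
    using A(1) finite_words_of_length by (intro card_Un_disjoint) auto
  moreover have "card ((\<odot>) c ` words_of_length len) = card (words_of_length len)"
    by (intro card_image) (auto simp: inj_on_def extend_inj)
  ultimately show "card (A - {c} \<union> (\<odot>) c ` words_of_length len) = card A - 1 + card (words_of_length len)"
    using A(1) assms(2) by simp
qed

lemma tiled_bijection:
  assumes "tiled V p" "tiled V' p"
  obtains h where "bij_betw h V V'" "locally_prefix V h"
proof -
  obtain A where A: "cyl_partition A V" "card A = p" "\<And>c. c \<in> A \<Longrightarrow> source c = 0"
    using assms(1) unfolding tiled_def by blast
  obtain A' where A': "cyl_partition A' V'" "card A' = p" "\<And>c. c \<in> A' \<Longrightarrow> source c = 0"
    using assms(2) unfolding tiled_def by blast
  obtain \<beta> where \<beta>: "bij_betw \<beta> A A'"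
    using finite_same_card_bij[of A A'] cyl_partitionD(1)[OF A(1)] cyl_partitionD(1)[OF A'(1)] A(2) A'(2) by auto
  have \<beta>A: "\<beta> c \<in> A'" if "c \<in> A" for c using \<beta> that by (auto simp: bij_betw_def)
  have ex: "\<exists>c\<in>A. \<exists>\<omega>\<in>boundary. x = act c \<omega>" if "x \<in> V" for x
    using that cyl_partitionD(3)[OF A(1)] unfolding cyl_def by blast
  note uniq = cyl_partition_unique[OF A(1)] and uniq' = cyl_partition_unique[OF A'(1)]
  have "\<exists>y. \<forall>c\<in>A. \<forall>\<omega>\<in>boundary. x = act c \<omega> \<longrightarrow> y = act (\<beta> c) \<omega>" for x
  proof (cases "x \<in> V")
    case True
    then obtain c \<omega> where c: "c \<in> A" "\<omega> \<in> boundary" "x = act c \<omega>" using ex by blast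
    have "act (\<beta> c) \<omega> = act (\<beta> d) \<omega>'" if "d \<in> A" "\<omega>' \<in> boundary" "x = act d \<omega>'" for d \<omega>'
      using uniq[OF c(1) that(1) c(2) that(2)] c(3) that(3) by simp
    then show ?thesis by blast
  next
    case False
    then have "x \<noteq> act c \<omega>" if "c \<in> A" "\<omega> \<in> boundary" for c \<omega>
      using that cyl_partitionD(3)[OF A(1)] unfolding cyl_def by blast
    then show ?thesis by blast
  qed
  then obtain h where h: "\<And>x c \<omega>. c \<in> A \<Longrightarrow> \<omega> \<in> boundary \<Longrightarrow> x = act c \<omega> \<Longrightarrow> h x = act (\<beta> c) \<omega>" by metis
  have arr': "A' \<subseteq> arr" using cyl_partitionD(2)[OF A'(1)] .
  have rep: "replaces h c (\<beta> c)" if "c \<in> A" for c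
    unfolding replaces_def using h[OF that] A(3)[OF that] A'(3)[OF \<beta>A[OF that]] \<beta>A[OF that] arr' by auto
  have "locally_prefix V h"
  proof (rule locally_prefixI[of A])
    show "V \<subseteq> \<Union> (cyl ` A)" using cyl_partitionD(3)[OF A(1)] by simp
  qed (use cyl_partitionD(1,2)[OF A(1)] rep in blast)+
  moreover have "bij_betw h V V'" unfolding bij_betw_def
  proof
    show "inj_on h V"
    proof (rule inj_onI)
      fix x y assume xy: "x \<in> V" "y \<in> V" "h x = h y"
      obtain c \<omega> where c: "c \<in> A" "\<omega> \<in> boundary" "x = act c \<omega>" using ex xy(1) by blast
      obtain d \<omega>' where d: "d \<in> A" "\<omega>' \<in> boundary" "y = act d \<omega>'" using ex xy(2) by blast
      have "act (\<beta> c) \<omega> = act (\<beta> d) \<omega>'" using h c d xy(3) by metis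
      then have "\<beta> c = \<beta> d \<and> \<omega> = \<omega>'" using uniq' \<beta>A c d by blast
      moreover then have "c = d" using \<beta> c d unfolding bij_betw_def inj_on_def by blast
      ultimately show "x = y" using c d by simp
    qed
    have "h ` V = (\<Union>c\<in>A. h ` cyl c)" using cyl_partitionD(3)[OF A(1)] by auto
    also have "\<dots> = (\<Union>c\<in>A. cyl (\<beta> c))" using replaces_cyl[OF rep] by simp
    also have "\<dots> = \<Union>(cyl ` A')" using \<beta> unfolding bij_betw_def by auto
    finally show "h ` V = V'" using cyl_partitionD(3)[OF A'(1)] by simp
  qed
  ultimately show ?thesis using that by blast
qed

text \<open>
  The degree of a single letter of colour \<open>i\<close>.
\<close>

definition one_letter :: "nat \<Rightarrow> nat \<Rightarrow> nat" where
  "one_letter i = (\<lambda>i'. if i' = i then 1 else 0)"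

lemma card_one_letter:
  assumes "i \<in> colours"
  shows "card (words_of_length (one_letter i)) = 2 * m"
proof -
  have "(\<Sum>i'\<in>colours. one_letter i i') = 1"
    using assms by (simp add: one_letter_def colours_def)
  then show ?thesis by (simp add: card_words_of_length)
qed

lemma label_sum_one_letter:
  assumes "u \<in> words_of_length (one_letter i)" "i \<in> colours"
  obtains x where "x \<in> X i" "label_sum u = l x"
proof -
  have u: "u \<in> words" "\<And>i'. i' \<in> colours \<Longrightarrow> length (u i') = one_letter i i'"
    using assms(1) by (auto simp: words_of_length_def)
  then have "length (u i) = 1" using assms(2) by (simp add: one_letter_def)
  then obtain y where y: "u i = [y]" by (metis One_nat_def length_0_conv length_Suc_conv)
  have "y \<in> Y i" using u(1) y unfolding words_def by (metis (mono_tags, lifting) list.set_intros(1) mem_Collect_eq subsetD)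
  then have "base_letter y \<in> X i" by (simp add: Y_def)
  moreover have "label_sum u = l (base_letter y)"
  proof -
    have "letter_sum (u i') = (if i' = i then l (base_letter y) else 0)" if "i' \<in> {1..k}" for i'
      using u(2)[of i'] that y by (auto simp: colours_def one_letter_def)
    then have "label_sum u = (\<Sum>i'\<in>{1..k}. if i' = i then l (base_letter y) else 0)"
      unfolding label_sum_def by (intro sum.cong) auto
    then show ?thesis using assms(2) by (simp add: colours_def)
  qed
  ultimately show ?thesis using that by blast
qed

end

section \<open>Few classes of involutions for mixed labels\<close>

locale mixed_labels = labelled_alphabets k m X l
  for k m :: nat and X :: "nat \<Rightarrow> 'x set" and l :: "'x \<Rightarrow> bit" +
  assumes mixed: "l x = (if x \<in> X 1 then 0 else 1)" and two_colours: "k \<ge> 2"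
begin

lemma colour_1: "u \<in> words_of_length (one_letter 1) \<Longrightarrow> label_sum u = 0"
  using label_sum_one_letter[of u 1] mixed two_colours by (metis atLeastAtMost_iff colours_def le_trans one_le_numeral order_refl)

lemma colour_2:
  assumes "u \<in> words_of_length (one_letter 2)"
  shows "label_sum u = 1"
proof -
  have "2 \<in> colours" using two_colours by (simp add: colours_def)
  then obtain x where x: "x \<in> X 2" "label_sum u = l x" using label_sum_one_letter[OF assms] by blast
  have "x \<notin> X 1"
    using disjoint_Y[of "Pos x" 1 2] x two_colours by (auto simp: Y_def)
  then show ?thesis using x mixed[of x] by simp
qed

text \<open>
  Splitting a cylinder with domain \<open>1\<close> by its next letter of colour \<open>2\<close> moves the domain to \<open>0\<close>.
\<close>

lemma tiled_exists:
  assumes "clopen V"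
  shows "\<exists>p. tiled V p"
proof -
  have "\<exists>p. tiled V p" if "cyl_partition A V" for A
    using that
  proof (induction "card {c \<in> A. source c \<noteq> 0}" arbitrary: A rule: less_induct)
    case less
    have A: "finite A" "A \<subseteq> arr" using cyl_partitionD[OF less.prems] by blast+
    show ?case
    proof (cases "\<exists>c\<in>A. source c \<noteq> 0")
      case False
      then show ?thesis using less.prems unfolding tiled_def by blast
    next
      case True
      then obtain c where c: "c \<in> A" "source c \<noteq> 0" by blast
      then have c1: "source c = 1" by simp
      let ?B = "A - {c} \<union> (\<odot>) c ` words_of_length (one_letter 2)"
      have "source d = 0" if "d \<in> (\<odot>) c ` words_of_length (one_letter 2)" for d
        using that colour_2 c1 by auto
      then have "{d \<in> ?B. source d \<noteq> 0} \<subset> {d \<in> A. source d \<noteq> 0}" using c by blast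
      then have "card {d \<in> ?B. source d \<noteq> 0} < card {d \<in> A. source d \<noteq> 0}"
        using A(1) by (intro psubset_card_mono) auto
      then show ?thesis using less.hyps cyl_partition_subdivide(1)[OF less.prems c(1)] by blast
    qed
  qed
  then show ?thesis using level_partition[OF assms] by blast
qed

lemma tiled_nonempty: "tiled V p \<Longrightarrow> V \<noteq> {} \<Longrightarrow> p \<ge> 1"
  unfolding tiled_def cyl_partition_def by (metis One_nat_def Suc_leI SUP_empty card_gt_0_iff)

text \<open>
  Splitting by the next letter of colour \<open>1\<close> keeps the domain and replaces one cylinder by \<open>n\<close>. This
  is the point where the mixed labelling differs from the uniform one.
\<close>

lemma tiled_more:
  assumes "tiled V p" "p \<ge> 1"
  shows "tiled V (p + r * (2 * m - 1))"
proof (induction r)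
  case 0
  then show ?case using assms by simp
next
  case (Suc r)
  let ?p = "p + r * (2 * m - 1)"
  obtain A where A: "cyl_partition A V" "card A = ?p" "\<And>c. c \<in> A \<Longrightarrow> source c = 0"
    using Suc unfolding tiled_def by blast
  obtain c where c: "c \<in> A" using A(2) assms(2) by (metis all_not_in_conv card.empty le_add1 le_trans not_one_le_zero)
  let ?B = "A - {c} \<union> (\<odot>) c ` words_of_length (one_letter 1)"
  have "1 \<in> colours" using two_colours by (simp add: colours_def)
  then have "card ?B = ?p - 1 + 2 * m"
    using cyl_partition_subdivide(2)[OF A(1) c] card_one_letter A(2) by simp
  also have "\<dots> = p + Suc r * (2 * m - 1)" using m_pos assms(2) by simp
  finally have "card ?B = p + Suc r * (2 * m - 1)" .
  moreover have "source d = 0" if d: "d \<in> ?B" for d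
  proof (cases "d \<in> A")
    case False
    then obtain u where "u \<in> words_of_length (one_letter 1)" "d = c \<odot> u" using d by blast
    then show ?thesis using A(3)[OF c] colour_1 by simp
  qed (rule A(3))
  ultimately show ?case unfolding tiled_def using cyl_partition_subdivide(1)[OF A(1) c] by blast
qed

lemma common_tiling:
  assumes "tiled V p" "tiled V' p'" "p \<ge> 1" "p' \<ge> 1" "p mod (2 * m - 1) = p' mod (2 * m - 1)"
  shows "\<exists>q. tiled V q \<and> tiled V' q"
proof -
  have main: "\<exists>q. tiled U q \<and> tiled U' q"
    if U: "tiled U a" "tiled U' b" "a \<ge> 1" "a \<le> b" "a mod (2 * m - 1) = b mod (2 * m - 1)" for U U' a b
  proof -
    obtain r where "b = a + (2 * m - 1) * r" using U(4,5) by (metis mod_eq_nat1E)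
    then have "tiled U b" using tiled_more[OF U(1,3), of r] by (simp add: mult.commute)
    then show ?thesis using U(2) by blast
  qed
  show ?thesis
  proof (cases "p \<le> p'")
    case True
    then show ?thesis using main assms by blast
  next
    case False
    then show ?thesis using main[OF assms(2,1,4)] assms(5) by auto
  qed
qed

text \<open>
  The code of an involution: the sizes, modulo \<open>n - 1\<close>, of tilings of one half of its moved set and of
  its fixed point set. The value \<open>b = n - 1\<close>, which is not a residue, stands for an empty fixed point
  set, as the empty set has no tilings of other sizes.
\<close>

definition has_code :: "('x point \<Rightarrow> 'x point) \<Rightarrow> nat \<Rightarrow> nat \<Rightarrow> bool" where
  "has_code s a b \<longleftrightarrow> (\<exists>V p q. clopen V \<and> V \<inter> s ` V = {} \<and> moved s = V \<union> s ` V \<and>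
     tiled V p \<and> p \<ge> 1 \<and> a = p mod (2 * m - 1) \<and> tiled (points - moved s) q \<and>
     (q = 0 \<and> b = 2 * m - 1 \<or> q \<ge> 1 \<and> b = q mod (2 * m - 1)))"

lemma has_code_exists:
  assumes "s \<in> H" "s \<circ> s = id" "s \<noteq> id"
  shows "\<exists>a<2 * m - 1. \<exists>b\<le>2 * m - 1. has_code s a b"
proof -
  obtain V where V: "clopen V" "V \<inter> s ` V = {}" "moved s = V \<union> s ` V"
    using involution_halves[OF assms(1,2)] .
  have "V \<noteq> {}" using V(3) assms(3) unfolding moved_def by auto
  then obtain p where p: "tiled V p" "p \<ge> 1" using tiled_exists[OF V(1)] tiled_nonempty by blast
  have "clopen (points - moved s)"
    unfolding V(3) using clopen_Diff clopen_points clopen_Un V(1) clopen_image_involution[OF assms(1,2) V(1)] by blast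
  then obtain q where q: "tiled (points - moved s) q" using tiled_exists by blast
  define b where "b = (if q = 0 then 2 * m - 1 else q mod (2 * m - 1))"
  have "has_code s (p mod (2 * m - 1)) b"
    unfolding has_code_def using V p q by (intro exI[of _ V] exI[of _ p] exI[of _ q]) (auto simp: b_def)
  moreover have "2 * m - 1 > 0" using m_pos by simp
  then have "p mod (2 * m - 1) < 2 * m - 1" "b \<le> 2 * m - 1" by (auto simp: b_def less_imp_le)
  ultimately show ?thesis by blast
qed

lemma same_code_conjugate:
  assumes "s \<in> H" "s \<circ> s = id" "t \<in> H" "t \<circ> t = id" "has_code s a b" "has_code t a b"
  shows "\<exists>h\<in>H. h \<circ> s = t \<circ> h"
proof -
  obtain V p q where V: "clopen V" "V \<inter> s ` V = {}" "moved s = V \<union> s ` V" "tiled V p" "p \<ge> 1"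
     "a = p mod (2 * m - 1)" "tiled (points - moved s) q"
     "q = 0 \<and> b = 2 * m - 1 \<or> q \<ge> 1 \<and> b = q mod (2 * m - 1)"
    using assms(5) unfolding has_code_def by blast
  obtain V' p' q' where V': "clopen V'" "V' \<inter> t ` V' = {}" "moved t = V' \<union> t ` V'" "tiled V' p'" "p' \<ge> 1"
     "a = p' mod (2 * m - 1)" "tiled (points - moved t) q'"
     "q' = 0 \<and> b = 2 * m - 1 \<or> q' \<ge> 1 \<and> b = q' mod (2 * m - 1)"
    using assms(6) unfolding has_code_def by blast
  have r: "x mod (2 * m - 1) \<noteq> 2 * m - 1" for x
    using m_pos mod_less_divisor[of "2 * m - 1" x] by linarith
  obtain P where P: "tiled V P" "tiled V' P" using common_tiling V(4-6) V'(4-6) by metis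
  have "\<exists>Q. tiled (points - moved s) Q \<and> tiled (points - moved t) Q"
  proof (cases "q = 0")
    case True
    then have "b = 2 * m - 1" using V(8) by linarith
    then have "q' = 0" using V'(8) r[of q'] by metis
    then show ?thesis using True V(7) V'(7) by blast
  next
    case False
    then have q: "q \<ge> 1" "b = q mod (2 * m - 1)" using V(8) by auto
    then have "b \<noteq> 2 * m - 1" using r by metis
    then have "q' \<ge> 1" "q mod (2 * m - 1) = q' mod (2 * m - 1)" using q(2) V'(8) by auto
    then show ?thesis using common_tiling[OF V(7) V'(7) q(1)] by blast
  qed
  then obtain Q where Q: "tiled (points - moved s) Q" "tiled (points - moved t) Q" by blast
  obtain h1 where h1: "bij_betw h1 V V'" "locally_prefix V h1" using tiled_bijection[OF P] .
  obtain h2 where h2: "bij_betw h2 (points - moved s) (points - moved t)" "locally_prefix (points - moved s) h2"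
    using tiled_bijection[OF Q] .
  show ?thesis
    using involutions_conjugate[OF assms(1,2) V(1-3) assms(3,4) V'(1-3) h1 h2] by blast
qed

end

section \<open>Comparison of the two groups\<close>

text \<open>
  An isomorphism would carry the \<open>n\<^sup>2 - 1\<close> pairwise nonconjugate involutions of the uniform group to
  involutions of the mixed group with at most \<open>(n - 1) n\<close> codes, so two of them would be conjugate.
\<close>

lemma not_isomorphic:
  fixes X :: "nat \<Rightarrow> 'x set"
  assumes "k \<ge> 2" "m \<ge> 1" "alphabets k m X"
  shows "\<not> G_group (C_u k X) \<cong> G_group (C_m k X)"
proof
  assume iso: "G_group (C_u k X) \<cong> G_group (C_m k X)"
  interpret U: uniform_labels k m X "\<lambda>x. 1" by unfold_locales (use assms in auto)
  define l :: "'x \<Rightarrow> bit" where "l = (\<lambda>x. if x \<in> X 1 then 0 else 1)"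
  interpret M: mixed_labels k m X l
    by unfold_locales (use assms in \<open>auto simp: l_def\<close>)
  have "U.H_group \<cong> G_group (C_u k X)" unfolding C_u_def is_iso_def using U.germ_class_iso by blast
  also note iso
  also have "G_group (C_m k X) \<cong> M.H_group"
    using group.iso_sym[OF M.group_H] M.germ_class_iso unfolding C_m_def l_def[symmetric] is_iso_def by blast
  finally obtain \<phi> where \<phi>: "\<phi> \<in> iso U.H_group M.H_group" unfolding is_iso_def by blast
  have bij: "bij_betw \<phi> U.H M.H" using \<phi> by (simp add: iso_def)
  have mult: "\<phi> (f \<circ> g) = \<phi> f \<circ> \<phi> g" if "f \<in> U.H" "g \<in> U.H" for f g
    using \<phi> that by (simp add: iso_def hom_def)
  have one: "\<phi> id = id"
    using group_hom.hom_one[of U.H_group M.H_group \<phi>] U.group_H M.group_H \<phi>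
    by (simp add: group_hom_def group_hom_axioms_def iso_def)
  have \<phi>H: "\<phi> f \<in> M.H" if "f \<in> U.H" for f using bij that by (auto simp: bij_betw_def)
  have inj: "\<phi> f = \<phi> g \<longleftrightarrow> f = g" if "f \<in> U.H" "g \<in> U.H" for f g
    using bij that by (auto simp: bij_betw_def inj_on_def)
  let ?r = "2 * m - 1"
  let ?I = "{1..(2 * m)\<^sup>2 - 1}"
  obtain s where s: "\<And>p. p \<in> ?I \<Longrightarrow> s p \<in> U.H \<and> s p \<circ> s p = id \<and> s p \<noteq> id"
    and nc: "\<And>p p' h. p \<in> ?I \<Longrightarrow> p' \<in> ?I \<Longrightarrow> h \<in> U.H \<Longrightarrow> h \<circ> s p = s p' \<circ> h \<Longrightarrow> p = p'"
    using U.nonconjugate_involutions[OF assms(1)] by blast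
  have inv: "\<phi> (s p) \<in> M.H" "\<phi> (s p) \<circ> \<phi> (s p) = id" "\<phi> (s p) \<noteq> id" if "p \<in> ?I" for p
    using s[OF that] \<phi>H mult[of "s p" "s p"] one inj[of "s p" id] U.id_H by auto
  have "\<exists>ab \<in> {..<?r} \<times> {..?r}. M.has_code (\<phi> (s p)) (fst ab) (snd ab)" if "p \<in> ?I" for p
    using M.has_code_exists[OF inv[OF that]] by force
  then obtain code where code: "\<And>p. p \<in> ?I \<Longrightarrow> code p \<in> {..<?r} \<times> {..?r} \<and>
      M.has_code (\<phi> (s p)) (fst (code p)) (snd (code p))" by metis
  have "\<not> inj_on code ?I"
  proof (rule pigeonhole)
    have "code ` ?I \<subseteq> {..<?r} \<times> {..?r}" using code by blast
    then have "card (code ` ?I) \<le> card ({..<?r} \<times> {..?r})" by (intro card_mono) auto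
    also have "\<dots> = ?r * (?r + 1)" by (simp add: card_cartesian_product)
    also have "\<dots> < card ?I"
    proof -
      obtain r where r: "2 * m = r + 1" "r \<ge> 1" using assms(2) by (metis add.commute le_add_diff_inverse mult_2 add_leD1 le_add1 Nat.le_diff_conv2 one_add_one add_mono)
      then show ?thesis by (simp add: power2_eq_square)
    qed
    finally show "card ?I > card (code ` ?I)" .
  qed
  then obtain p p' where p: "p \<in> ?I" "p' \<in> ?I" "code p = code p'" "p \<noteq> p'" unfolding inj_on_def by blast
  obtain h where h: "h \<in> M.H" "h \<circ> \<phi> (s p) = \<phi> (s p') \<circ> h"
    using M.same_code_conjugate[OF inv(1,2)[OF p(1)] inv(1,2)[OF p(2)]] code p by metis
  obtain g where g: "g \<in> U.H" "h = \<phi> g" using bij h(1) by (auto simp: bij_betw_def)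
  have "\<phi> (g \<circ> s p) = \<phi> (s p' \<circ> g)" using h(2) g mult s p(1,2) by metis
  then have "g \<circ> s p = s p' \<circ> g" using inj U.comp_H g(1) s p(1,2) by metis
  then show False using nc[OF p(1,2) g(1)] p(4) by blast
qed

theorem corollary10p1:
  fixes k :: nat
  assumes "k \<ge> 2"
  shows "infinite {m::nat. m \<ge> 1 \<and>
    (\<forall>X :: nat \<Rightarrow> 'x set. alphabets k m X \<longrightarrow> \<not> G_group (C_u k X) \<cong> G_group (C_m k X))}"
proof -
  have "{1..} \<subseteq> {m::nat. m \<ge> 1 \<and>
    (\<forall>X :: nat \<Rightarrow> 'x set. alphabets k m X \<longrightarrow> \<not> G_group (C_u k X) \<cong> G_group (C_m k X))}"
    using not_isomorphic[OF assms] by auto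
  then show ?thesis using infinite_Ici infinite_super by blast
qed

end
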